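(* Let $n\ge 2$ and let $I$ be a proper subset of $[0,n-1]$. Then $\mathcal{D}_n^I(x)$ cannot be expressed, up to sign, as a product of cyclotomic polynomials if and only if $n\equiv 0\ (\mathrm{mod}\ 2)$ and $\{0\}\cup\{i\in[n-1] : i\equiv 1\ (\mathrm{mod}\ 2)\}\subseteq I$. In this case, $$\mathcal{D}_n^I(x)=C_I\,\frac{1+x^{|I_0|}+2x^{\frac n2}}{1+x^{\frac n2}}\prod_{i=|I_0|+2}^{n}\left(1+(-1)^{i-1}x^{\left\lfloor\frac i2\right\rfloor}\right),$$ where $I_0$ is the connected component of $I$ containing $0$.
   Context: For integers $a\le b$ let $[a,b]=\{a,a+1,\dots,b\}$, and $[a,b]=\emptyset$ if $a>b$; $[n]=[1,n]$. A signed permutation of degree $n$ is a bijection $\sigma$ of $\{\pm1,\dots,\pm n\}$ with $\sigma(-i)=-\sigma(i)$; $\mathcal{D}_n$ is the group of signed permutations of degree $n$ with an even number of negative entries among $\sigma(1),\dots,\sigma(n)$. For $\sigma\in\mathcal{D}_n$, the Coxeter length is $\ell(\sigma)=|\{(i,j)\in[n]^2: i<j,\ \sigma(i)>\sigma(j)\}|+|\{(i,j)\in[n]^2: i<j,\ \sigma(i)+\sigma(j)<0\}|$, and the odd length is $L(\sigma)=|\{(i,j)\in[n]^2: i<j,\ \sigma(i)>\sigma(j),\ i\not\equiv j\ (\mathrm{mod}\ 2)\}|+|\{(i,j)\in[n]^2: i<j,\ \sigma(i)+\sigma(j)<0,\ i\not\equiv j\ (\mathrm{mod}\ 2)\}|$.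 For $I\subseteq[0,n-1]$, $\mathcal{D}_n^I=\{\sigma\in\mathcal{D}_n:\sigma(i)<\sigma(i+1)\text{ for all } i\in I\}$ with the convention $\sigma(0):=-\sigma(2)$, and $\mathcal{D}_n^I(x)=\sum_{\sigma\in\mathcal{D}_n^I}(-1)^{\ell(\sigma)}x^{L(\sigma)}$. Connected components: each $I\subseteq[0,n-1]$ is uniquely $I=I_0\cup I_1\cup\cdots\cup I_s$, where $I_0=[0,a_0-1]$ is the maximal interval of $I$ containing $0$ (with $I_0=\emptyset$ if $0\notin I$), and $I_1,\dots,I_s$ are the other maximal intervals of consecutive integers in $I$. Set $m_I=\sum_{k=0}^s\left\lfloor\frac{|I_k|+1}{2}\right\rfloor$ and let $C_I=\left[\begin{matrix}m_I\\ \lfloor\frac{|I_0|+1}{2}\rfloor,\lfloor\frac{|I_1|+1}{2}\rfloor,\dots,\lfloor\frac{|I_s|+1}{2}\rfloor\end{matrix}\right]_{x^2}$ be the $q$-multinomial coefficient at $q=x^2$, where $\left[\begin{matrix}N\\ n_1,\dots,n_k\end{matrix}\right]_q=\frac{[N]_q!}{[n_1]_q!\cdots[n_k]_q!}$, $[N]_q!=\prod_{i=1}^N\frac{1-q^i}{1-q}$, $[0]_q!=1$. Empty products equal $1$. The $k$-th cyclotomic polynomial is the monic polynomial whose roots are the distinct primitive $k$-th roots of unity, each with multiplicity one. The product may be empty. *)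

theory Defs
  imports
    Complex_Main
    "HOL-Combinatorics.Permutations"
    "HOL-Computational_Algebra.Computational_Algebra"
begin

(* permutes forces the identity outside {-n..n} - {0}, so each signed permutation has exactly
   one representative. *)
definition signed_perms :: "nat \<Rightarrow> (int \<Rightarrow> int) set" where
  "signed_perms n =
     {\<sigma>. \<sigma> permutes ({- int n..int n} - {0}) \<and>
          (\<forall>i\<in>{- int n..int n} - {0}. \<sigma> (- i) = - \<sigma> i)}"

definition even_signed_perms :: "nat \<Rightarrow> (int \<Rightarrow> int) set" where
  "even_signed_perms n =
     {\<sigma>\<in>signed_perms n. even (card {i\<in>{1..n}. \<sigma> (int i) < 0})}"

definition D_length :: "nat \<Rightarrow> (int \<Rightarrow> int) \<Rightarrow> nat" where
  "D_length n \<sigma> =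
     card {(i, j)\<in>{1..n} \<times> {1..n}. i < j \<and> \<sigma> (int i) > \<sigma> (int j)} +
     card {(i, j)\<in>{1..n} \<times> {1..n}. i < j \<and> \<sigma> (int i) + \<sigma> (int j) < 0}"

definition odd_length :: "nat \<Rightarrow> (int \<Rightarrow> int) \<Rightarrow> nat" where
  "odd_length n \<sigma> =
     card {(i, j)\<in>{1..n} \<times> {1..n}.
             i < j \<and> \<sigma> (int i) > \<sigma> (int j) \<and> i mod 2 \<noteq> j mod 2} +
     card {(i, j)\<in>{1..n} \<times> {1..n}.
             i < j \<and> \<sigma> (int i) + \<sigma> (int j) < 0 \<and> i mod 2 \<noteq> j mod 2}"

(* The type D convention for the value at 0; the representing function itself has \<sigma> 0 = 0. *)
definition D_val :: "(int \<Rightarrow> int) \<Rightarrow> nat \<Rightarrow> int" where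
  "D_val \<sigma> i = (if i = 0 then - \<sigma> 2 else \<sigma> (int i))"

definition D_quotient :: "nat \<Rightarrow> nat set \<Rightarrow> (int \<Rightarrow> int) set" where
  "D_quotient n I = {\<sigma>\<in>even_signed_perms n. \<forall>i\<in>I. D_val \<sigma> i < D_val \<sigma> (i + 1)}"

definition D_poly :: "nat \<Rightarrow> nat set \<Rightarrow> int poly" where
  "D_poly n I = (\<Sum>\<sigma>\<in>D_quotient n I. monom ((-1) ^ D_length n \<sigma>) (odd_length n \<sigma>))"

definition components :: "nat set \<Rightarrow> nat set set" where
  "components I =
     {J. (\<exists>a b. a \<le> b \<and> J = {a..b}) \<and> J \<subseteq> I \<and>
         (\<forall>a b. J \<subseteq> {a..b} \<and> {a..b} \<subseteq> I \<longrightarrow> {a..b} = J)}"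

definition component0 :: "nat set \<Rightarrow> nat set" where
  "component0 I = \<Union>{J\<in>components I. 0 \<in> J}"

(* I_0, I_1, ..., I_s; the member component0 I may be empty, the others never are. *)
definition all_components :: "nat set \<Rightarrow> nat set set" where
  "all_components I = insert (component0 I) {J\<in>components I. 0 \<notin> J}"

definition half_size :: "nat set \<Rightarrow> nat" where
  "half_size J = (card J + 1) div 2"

definition m_index :: "nat set \<Rightarrow> nat" where
  "m_index I = (\<Sum>J\<in>all_components I. half_size J)"

definition q_fact :: "'a::field \<Rightarrow> nat \<Rightarrow> 'a" where
  "q_fact q N = (\<Prod>i=1..N. (1 - q ^ i) / (1 - q))"

definition q_multinomial :: "'a::field \<Rightarrow> nat \<Rightarrow> ('b \<Rightarrow> nat) \<Rightarrow> 'b set \<Rightarrow> 'a" where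
  "q_multinomial q N f A = q_fact q N / (\<Prod>k\<in>A. q_fact q (f k))"

(* The indeterminate, as an element of the field of fractions of \<int>[x]. *)
definition X :: "int poly fract" where
  "X = to_fract (monom 1 1)"

definition C_coeff :: "nat set \<Rightarrow> int poly fract" where
  "C_coeff I = q_multinomial (X ^ 2) (m_index I) half_size (all_components I)"

definition primitive_roots :: "nat \<Rightarrow> complex set" where
  "primitive_roots k = {z. z ^ k = 1 \<and> (\<forall>j. 0 < j \<and> j < k \<longrightarrow> z ^ j \<noteq> 1)}"

(* Meaningful for k > 0 only. *)
definition cyclotomic :: "nat \<Rightarrow> complex poly" where
  "cyclotomic k = (\<Prod>z\<in>primitive_roots k. [:- z, 1:])"

definition signed_cyclotomic_product :: "int poly \<Rightarrow> bool" where
  "signed_cyclotomic_product p \<longleftrightarrow>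
     (\<exists>ks :: nat list. (\<forall>k\<in>set ks. k > 0) \<and>
        (map_poly of_int p = prod_list (map cyclotomic ks) \<or>
         map_poly of_int p = - prod_list (map cyclotomic ks)))"

end

theory Submission
  imports Defs
begin

text \<open>Work with words of signed values in which every position carries a parity, and weigh a word by
  a factor \<open>-1\<close> or \<open>-X\<close> for each inversion and each negative sum, according to whether the
  two parities agree. Changing the sign of the value \<open>\<plusminus>1\<close> shows that all signed permutations may
  be summed instead of the even ones; changing the sign of the first entry preserves the weight.

  Increasing conditions split the positions into blocks. Two adjacent blocks of sizes \<open>i\<close> and
  \<open>j\<close> can be merged: placing the values of their union from the smallest upwards, all terms in
  which neighbouring values receive equal parities cancel, and what remains is a multiple (a
  \<open>q\<close>-binomial coefficient at \<open>X\<^sup>2\<close>, up to simple factors) of the sum for one block of size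
  \<open>i + j\<close>. If \<open>0 \<notin> I\<close>, repeated merging leaves a single block, whose sum is
  \<open>\<Prod>\<^sub>i (1 + (-1)^(i-1) X^\<lfloor>i/2\<rfloor>)\<close>. If exactly one of 0 and 1 lies in \<open>I\<close>, a sign change of
  the first entry reduces to this case.

  If \<open>0, 1 \<in> I\<close>, the first block of size \<open>a\<close> satisfies \<open>\<bar>\<sigma> 1\<bar> < \<sigma> 2 < \<dots> < \<sigma> a\<close>. Dropping the
  condition at 0 and redistributing the signs in the block expresses the known sum through the
  wanted one; for even \<open>a\<close> the sum with flipped parities in the first block enters as well, and
  the resulting two linear equations are solved. If \<open>a\<close> or another block is odd, the solution is a
  product of factors \<open>1 \<plusminus> X^k\<close> and their inverses, hence a product of cyclotomic polynomials.
  If all blocks are even, the factor \<open>1 + X^a + 2 X^(n/2)\<close> appears, which always has a root off the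
  unit circle.\<close>

section \<open>Weights of signed words\<close>

definition swap_weight :: "bool \<Rightarrow> bool \<Rightarrow> int poly fract" where
  "swap_weight e f = (if e = f then - 1 else - X)"

definition pair_weight :: "int \<times> bool \<Rightarrow> int \<times> bool \<Rightarrow> int poly fract" where
  "pair_weight y z = swap_weight (snd y) (snd z) ^
     (of_bool (fst y > fst z) + of_bool (fst y + fst z < 0))"

fun weight :: "(int \<times> bool) list \<Rightarrow> int poly fract" where
  "weight [] = 1"
| "weight (z # zs) = (\<Prod>y\<leftarrow>zs. pair_weight z y) * weight zs"

definition cross_weight :: "(int \<times> bool) list \<Rightarrow> (int \<times> bool) list \<Rightarrow> int poly fract" where
  "cross_weight xs ys = (\<Prod>x\<leftarrow>xs. \<Prod>y\<leftarrow>ys. pair_weight x y)"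

lemma cross_weight_simps [simp]:
  "cross_weight [] ys = 1"
  "cross_weight (x # xs) ys = (\<Prod>y\<leftarrow>ys. pair_weight x y) * cross_weight xs ys"
  by (simp_all add: cross_weight_def)

lemma weight_append: "weight (xs @ ys) = weight xs * cross_weight xs ys * weight ys"
  by (induction xs) (auto simp: algebra_simps)

lemma swap_weight_commute: "swap_weight e f = swap_weight f e"
  by (auto simp: swap_weight_def)

lemma pair_weight_swap:
  assumes "fst z < fst y"
  shows "pair_weight y z = swap_weight (snd z) (snd y) * pair_weight z y"
  using assms by (auto simp: pair_weight_def swap_weight_commute add.commute)

text \<open>The cross weights with the surroundings depend only on the multiset of the rearranged
  entries, so a local reordering multiplies the whole weight by its local factor.\<close>

lemma weight_append_cong:
  assumes "weight xs = c * weight ys" "mset xs = mset ys"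
  shows "weight (pre @ xs @ post) = c * weight (pre @ ys @ post)"
proof -
  have prod: "(\<Prod>y\<leftarrow>xs. f y) = (\<Prod>y\<leftarrow>ys. f y)" for f :: "int \<times> bool \<Rightarrow> int poly fract"
    using assms(2) by (metis mset_map prod_mset_prod_list)
  have "cross_weight xs post = cross_weight ys post"
    unfolding cross_weight_def by (rule prod)
  moreover have "cross_weight pre (xs @ post) = cross_weight pre (ys @ post)"
    unfolding cross_weight_def by (simp add: prod)
  ultimately show ?thesis
    by (simp add: weight_append assms(1))
qed

text \<open>The large entry \<open>z\<close> forms an inversion with every entry of \<open>r\<close>
  exactly while it stands to their left; negative sums are symmetric in the two entries and do not
  change.\<close>

lemma weight_move_right_local:
  assumes "\<And>y. y \<in> set r \<Longrightarrow> fst y < fst z"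
  shows "weight (z # r) = (\<Prod>y\<leftarrow>r. swap_weight (snd y) (snd z)) * weight (r @ [z])"
  using assms
  by (induction r) (auto simp: algebra_simps pair_weight_swap weight_append)

lemma weight_move_right:
  assumes "\<And>y. y \<in> set r \<Longrightarrow> fst y < fst z"
  shows "weight (pre @ z # r @ post) =
    (\<Prod>y\<leftarrow>r. swap_weight (snd y) (snd z)) * weight (pre @ r @ z # post)"
  using weight_append_cong[OF weight_move_right_local[OF assms], of r pre post] by simp

lemma weight_move_left_local:
  assumes "\<And>y. y \<in> set l \<Longrightarrow> fst z < fst y"
  shows "weight (l @ [z]) = (\<Prod>y\<leftarrow>l. swap_weight (snd y) (snd z)) * weight (z # l)"
  using assms
proof (induction l)
  case (Cons y l)
  have "pair_weight y z = swap_weight (snd y) (snd z) * pair_weight z y"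
    using Cons.prems by (subst pair_weight_swap) (auto simp: swap_weight_commute)
  with Cons show ?case by (simp add: algebra_simps)
qed simp

lemma weight_move_left:
  assumes "\<And>y. y \<in> set l \<Longrightarrow> fst z < fst y"
  shows "weight (pre @ l @ z # post) =
    (\<Prod>y\<leftarrow>l. swap_weight (snd y) (snd z)) * weight (pre @ z # l @ post)"
  using weight_append_cong[OF weight_move_left_local[OF assms], of l pre post] by simp

text \<open>Negating the left entry of a pair turns \<open>v > w\<close> into
  \<open>v + w < 0\<close> and conversely, so the two indicators in the exponent of
  \<open>pair_weight\<close> merely change places.\<close>

lemma weight_flip_first: "weight ((- v, e) # zs) = weight ((v, e) # zs)"
proof -
  have "pair_weight (- v, e) = pair_weight (v, e)"
    by (rule ext) (auto simp: pair_weight_def of_bool_def)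
  then show ?thesis by simp
qed

section \<open>Alternating parity patterns\<close>

fun alt :: "bool \<Rightarrow> nat \<Rightarrow> bool list" where
  "alt p 0 = []"
| "alt p (Suc k) = p # alt (\<not> p) k"

lemma length_alt [simp]: "length (alt p k) = k"
  by (induction k arbitrary: p) auto

text \<open>The term \<open>p = even i\<close> is the parity reached from \<open>p\<close> after
  \<open>i\<close> alternations; it is written this way throughout.\<close>

lemma alt_append: "alt p (i + j) = alt p i @ alt (p = even i) j"
proof (induction i arbitrary: p)
  case (Suc i)
  have "((\<not> p) = even i) = (p = even (Suc i))" by auto
  with Suc[of "\<not> p"] show ?case by (simp only: alt.simps add_Suc append_Cons)
qed auto

lemma alt_Suc_right: "alt p (Suc k) = alt p k @ [p = even k]"
  using alt_append[of p k 1] by simp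

text \<open>Every entry contributes a sign, and those of parity other than \<open>q\<close> also a
  factor \<open>X\<close>. Among \<open>k\<close> alternating entries there are
  \<open>k div 2\<close> or \<open>(k + 1) div 2\<close> of the latter, depending on the first
  one.\<close>

lemma prod_swap_weight_alt:
  assumes "length vs = k"
  shows "(\<Prod>y\<leftarrow>zip vs (alt p k). swap_weight (snd y) q) =
    (- 1) ^ k * X ^ (if p = q then k div 2 else (k + 1) div 2)"
  using assms
proof (induction k arbitrary: p vs)
  case (Suc k)
  then obtain v vs' where "vs = v # vs'" "length vs' = k" by (cases vs) auto
  with Suc.IH[of vs' "\<not> p"] show ?case
    by (auto simp: swap_weight_def)
qed simp

section \<open>Gaussian binomial coefficients at \<open>X ^ 2\<close>\<close>

definition qpoch :: "nat \<Rightarrow> int poly fract" where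
  "qpoch k = (\<Prod>j=1..k. 1 - X ^ (2 * j))"

text \<open>With \<open>q = X ^ 2\<close>, \<open>qpoch k\<close> is the q-Pochhammer symbol
  \<open>(q; q)_k\<close>, and this is the Gaussian binomial coefficient of \<open>g + h\<close>
  over \<open>g\<close>.\<close>

definition qbinom :: "nat \<Rightarrow> nat \<Rightarrow> int poly fract" where
  "qbinom g h = qpoch (g + h) / (qpoch g * qpoch h)"

lemma X_power: "X ^ k = to_fract (monom 1 k)"
proof (induction k)
  case 0
  then show ?case by (simp add: one_poly_eq_simps flip: to_fract_1)
next
  case (Suc k)
  have "monom (1::int) (Suc k) = monom 1 1 * monom 1 k" by (simp add: mult_monom)
  with Suc show ?case by (simp add: X_def to_fract_mult)
qed

lemma X_power_eq_1_iff [simp]: "X ^ k = 1 \<longleftrightarrow> k = 0"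
proof
  assume "X ^ k = 1"
  then have "monom (1::int) k = 1"
    by (simp add: X_power flip: to_fract_1)
  then show "k = 0" by (metis degree_1 degree_monom_eq one_neq_zero)
qed simp

lemma qpoch_nonzero [simp]: "qpoch k \<noteq> 0"
  by (auto simp: qpoch_def)

lemma qpoch_0 [simp]: "qpoch 0 = 1"
  by (simp add: qpoch_def)

lemma qpoch_Suc: "qpoch (Suc k) = qpoch k * (1 - X ^ (2 * k + 2))"
  by (simp add: qpoch_def)

lemma qbinom_0 [simp]: "qbinom 0 h = 1" "qbinom g 0 = 1"
  by (simp_all add: qbinom_def)

text \<open>The q-Pascal rule. It comes from
  \<open>1 - q^(g+h+2) = (1 - q^(g+1)) + q^(g+1) (1 - q^(h+1))\<close> with
  \<open>q = X ^ 2\<close>.\<close>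

lemma qbinom_Suc_Suc:
  "qbinom (Suc g) (Suc h) = qbinom g (Suc h) + X ^ (2 * g + 2) * qbinom (Suc g) h"
proof -
  have nz: "1 - X ^ (2 * k + 2) \<noteq> 0" for k
    by (metis X_power_eq_1_iff add_is_0 eq_iff_diff_eq_0 zero_neq_numeral)
  have split: "s * (a + c * b) / ((u * a) * (v * b)) = s / (u * (v * b)) + c * (s / ((u * a) * v))"
    if "a \<noteq> 0" "b \<noteq> 0" "u \<noteq> 0" "v \<noteq> 0" for s a b c u v :: "int poly fract"
    using that by (simp add: field_simps)
  have e: "1 - X ^ (2 * (g + h + 1) + 2) =
      (1 - X ^ (2 * g + 2)) + X ^ (2 * g + 2) * (1 - X ^ (2 * h + 2))"
    by (simp add: algebra_simps flip: power_add)
  have p: "qpoch (Suc g + Suc h) = qpoch (Suc (g + h)) * (1 - X ^ (2 * (g + h + 1) + 2))"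
    using qpoch_Suc[of "Suc (g + h)"] by simp
  have "qbinom (Suc g) (Suc h) = qpoch (Suc (g + h)) *
      ((1 - X ^ (2 * g + 2)) + X ^ (2 * g + 2) * (1 - X ^ (2 * h + 2))) /
      (qpoch (Suc g) * qpoch (Suc h))"
    by (simp only: qbinom_def p e)
  also have "\<dots> = qbinom g (Suc h) + X ^ (2 * g + 2) * qbinom (Suc g) h"
    using split[OF nz nz qpoch_nonzero qpoch_nonzero]
    by (simp add: qbinom_def qpoch_Suc[of g] qpoch_Suc[of h])
  finally show ?thesis .
qed

text \<open>The factor for merging adjacent blocks of sizes \<open>i\<close> and \<open>j\<close>
  whose parities start alike; a closed form for the two-step recurrence in
  \<open>merge_coeff_rec\<close>.\<close>

definition merge_coeff :: "nat \<Rightarrow> nat \<Rightarrow> int poly fract" where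
  "merge_coeff i j = (if odd i \<and> odd j then 0
     else (if odd i then X ^ (j div 2) else 1) * qbinom (i div 2) (j div 2))"

lemma merge_coeff_0 [simp]: "merge_coeff 0 j = 1" "merge_coeff i 0 = 1"
  by (simp_all add: merge_coeff_def)

text \<open>The two terms stand for putting the two smallest values both into the left block or both
  into the right one.\<close>

lemma merge_coeff_rec:
  assumes "i > 0" "j > 0"
  shows "merge_coeff i j = (if i \<ge> 2 then merge_coeff (i - 2) j else 0) +
    (if j \<ge> 2 then X ^ i * merge_coeff i (j - 2) else 0)"
proof -
  have cases: "(\<exists>g. k = 2 * g + 2) \<or> (\<exists>g. k = 2 * g + 3) \<or> k = 1" if "k > 0" for k :: nat
    using that by presburger
  from cases[OF assms(1)] cases[OF assms(2)] show ?thesis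
    by (elim disjE exE)
       (simp_all add: merge_coeff_def qbinom_Suc_Suc algebra_simps power_add,
        simp_all add: numeral_3_eq_3 algebra_simps)
qed

section \<open>Merging two increasing blocks\<close>

definition splits :: "nat \<Rightarrow> nat \<Rightarrow> int list \<Rightarrow> (int list \<times> int list) set" where
  "splits i j ws = {(l, r). sorted_wrt (<) l \<and> sorted_wrt (<) r \<and> length l = i \<and> length r = j \<and>
     set l \<union> set r = set ws \<and> set l \<inter> set r = {}}"

lemma sorted_wrt_less_distinct: "sorted_wrt (<) (xs :: 'a :: linorder list) \<Longrightarrow> distinct xs"
  by (simp add: strict_sorted_iff)

lemma finite_splits: "finite (splits i j ws)"
proof (rule finite_subset)
  show "splits i j ws \<subseteq> {l. set l \<subseteq> set ws \<and> length l = i} \<times> {r. set r \<subseteq> set ws \<and> length r = j}"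
    by (auto simp: splits_def)
qed (auto intro: finite_lists_length_eq)

lemma splits_Nil: "splits 0 0 [] = {([], [])}"
  by (auto simp: splits_def)

lemma Cons_splits_left:
  assumes "sorted_wrt (<) (w # ws)"
  shows "(w # l, r) \<in> splits i j (w # ws) \<longleftrightarrow> i > 0 \<and> (l, r) \<in> splits (i - 1) j ws"
proof -
  have "w \<notin> set ws" "\<And>v. v \<in> set ws \<Longrightarrow> w < v" using assms by auto
  then have "insert w (set l \<union> set r) = insert w (set ws) \<and> w \<notin> set l \<union> set r \<longleftrightarrow>
      set l \<union> set r = set ws \<and> w \<notin> set l \<union> set r"
    by (metis insert_ident)
  moreover have "(\<forall>v\<in>set l. w < v) \<and> w \<notin> set r" if "set l \<union> set r = set ws"
    using that \<open>\<And>v. v \<in> set ws \<Longrightarrow> w < v\<close> \<open>w \<notin> set ws\<close> by blast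
  ultimately show ?thesis
    unfolding splits_def using sorted_wrt_less_distinct[of "w # l"] by auto
qed

lemma Cons_splits_right:
  assumes "sorted_wrt (<) (w # ws)"
  shows "(l, w # r) \<in> splits i j (w # ws) \<longleftrightarrow> j > 0 \<and> (l, r) \<in> splits i (j - 1) ws"
proof -
  have sym: "(l, r) \<in> splits i j ws \<longleftrightarrow> (r, l) \<in> splits j i ws" for l r i j ws
    by (auto simp: splits_def)
  show ?thesis
    using Cons_splits_left[OF assms, of r l j i] sym by blast
qed

text \<open>The smallest value must head whichever block receives it.\<close>

lemma splits_Cons:
  assumes "sorted_wrt (<) (w # ws)"
  shows "splits i j (w # ws) =
    (if i > 0 then (\<lambda>(l, r). (w # l, r)) ` splits (i - 1) j ws else {}) \<union>
    (if j > 0 then (\<lambda>(l, r). (l, w # r)) ` splits i (j - 1) ws else {})" (is "_ = ?A \<union> ?B")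
proof
  show "?A \<union> ?B \<subseteq> splits i j (w # ws)"
    using Cons_splits_left[OF assms] Cons_splits_right[OF assms] by (auto split: if_splits)
next
  have lt: "w < v" if "v \<in> set ws" for v using that assms by auto
  show "splits i j (w # ws) \<subseteq> ?A \<union> ?B"
  proof (clarify)
    fix l r assume lr: "(l, r) \<in> splits i j (w # ws)" "(l, r) \<notin> ?B"
    from lr(1) have "w \<in> set l \<or> w \<in> set r" and sub: "set l \<union> set r = insert w (set ws)"
      and srt: "sorted_wrt (<) l" "sorted_wrt (<) r"
      by (auto simp: splits_def)
    have hd: "\<exists>t'. t = w # t'" if t: "w \<in> set t" "sorted_wrt (<) t" "set t \<subseteq> insert w (set ws)" for t
      using t lt by (cases t) fastforce+
    from \<open>w \<in> set l \<or> w \<in> set r\<close> show "(l, r) \<in> ?A"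
    proof
      assume "w \<in> set l"
      then obtain l' where "l = w # l'" using hd[of l] srt sub by auto
      then show ?thesis using lr(1) Cons_splits_left[OF assms] by force
    next
      assume "w \<in> set r"
      then obtain r' where "r = w # r'" using hd[of r] srt sub by auto
      then have "(l, r) \<in> ?B" using lr(1) Cons_splits_right[OF assms] by force
      with lr(2) show ?thesis by simp
    qed
  qed
qed

lemma sum_splits_Cons:
  assumes "sorted_wrt (<) (w # ws)"
  shows "(\<Sum>(l, r)\<in>splits i j (w # ws). f l r) =
    (if i > 0 then \<Sum>(l, r)\<in>splits (i - 1) j ws. f (w # l) r else 0) +
    (if j > 0 then \<Sum>(l, r)\<in>splits i (j - 1) ws. f l (w # r) else (0 :: 'a :: comm_monoid_add))"
proof -
  let ?L = "\<lambda>(l, r). (w # l, r)" and ?R = "\<lambda>(l, r). (l, w # r)"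
  have "w \<notin> set ws" using assms by auto
  then have disj: "?L ` splits i' j' ws \<inter> ?R ` splits i'' j'' ws = {}" for i' j' i'' j''
    by (auto simp: splits_def)
  have "inj_on ?L S" "inj_on ?R S" for S :: "(int list \<times> int list) set"
    by (auto simp: inj_on_def)
  then have "(\<Sum>x\<in>?L ` S. case x of (l, r) \<Rightarrow> f l r) = (\<Sum>(l, r)\<in>S. f (w # l) r)"
    "(\<Sum>x\<in>?R ` S. case x of (l, r) \<Rightarrow> f l r) = (\<Sum>(l, r)\<in>S. f l (w # r))" for S
    by (simp_all add: sum.reindex case_prod_unfold)
  with disj show ?thesis
    unfolding splits_Cons[OF assms]
    by (auto simp: sum.union_disjoint finite_splits)
qed

text \<open>Induction over the values from the smallest upwards. Placing a value flips the next
  parity of the block that receives it, so equal starting parities become opposite and conversely;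
  with opposite ones, both patterns for the merged block occur. The condition
  \<open>i + j > 0\<close> excludes the empty word, for which the right side with
  \<open>p \<noteq> q\<close> is 0 and the left side is not.\<close>

lemma sum_splits_weight:
  assumes "sorted_wrt (<) ws" "length ws = i + j" "i + j > 0"
  shows "(\<Sum>(l, r)\<in>splits i j ws. weight (pre @ zip l (alt p i) @ zip r (alt q j) @ post)) =
    (if p = q then merge_coeff i j * weight (pre @ zip ws (alt p (i + j)) @ post)
     else (if i = 0 then 0 else merge_coeff (i - 1) j) * weight (pre @ zip ws (alt p (i + j)) @ post)
       + (if j = 0 then 0 else (- 1) ^ i * X ^ ((i + 1) div 2) * merge_coeff i (j - 1)) *
         weight (pre @ zip ws (alt q (i + j)) @ post))"
  using assms
proof (induction ws arbitrary: i j p q pre)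
  case (Cons w ws)
  \<comment> \<open>\<open>W p s\<close> is the weight when \<open>w\<close> has parity
    \<open>p\<close> and all larger values follow in one increasing block starting with parity
    \<open>s\<close>. \<open>A\<close> and \<open>B\<close> collect the splits with \<open>w\<close>
    in the left and in the right block, with \<open>w\<close> standing in front; \<open>c\<close> is
    the price of moving \<open>w\<close> there across the left block.\<close>
  define W where "W = (\<lambda>p s. weight ((pre @ [(w, p)]) @ zip ws (alt s (i + j - 1)) @ post))"
  define A where "A = (\<Sum>(l, r)\<in>splits (i - 1) j ws.
    weight ((pre @ [(w, p)]) @ zip l (alt (\<not> p) (i - 1)) @ zip r (alt q j) @ post))"
  define B where "B = (\<Sum>(l, r)\<in>splits i (j - 1) ws.
    weight ((pre @ [(w, q)]) @ zip l (alt p i) @ zip r (alt (\<not> q) (j - 1)) @ post))"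
  define c where "c = (- 1) ^ i * X ^ (if p = q then i div 2 else (i + 1) div 2)"
  have alt_pos: "alt s k = s # alt (\<not> s) (k - 1)" if "k > 0" for s k
    using that by (cases k) auto
  have len: "length ws = i + j - 1" using Cons.prems by simp
  have W: "weight (pre @ zip (w # ws) (alt s (i + j)) @ post) = W s (\<not> s)" for s
    using Cons.prems(3) by (simp add: W_def alt_pos)
  have "(\<Sum>(l, r)\<in>splits i (j - 1) ws.
        weight (pre @ zip l (alt p i) @ zip (w # r) (alt q j) @ post)) = c * B" if "j > 0"
    unfolding B_def sum_distrib_left
  proof (intro sum.cong refl, clarify)
    fix l r assume lr: "(l, r) \<in> splits i (j - 1) ws"
    have "w < v" if "v \<in> set l" for v
      using that lr Cons.prems(1) by (auto simp: splits_def)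
    then have lt: "fst (w, q) < fst y" if "y \<in> set (zip l (alt p i))" for y
      using that by (cases y) (auto dest: set_zip_leftD)
    have "length l = i" using lr by (simp add: splits_def)
    then have "(\<Prod>y\<leftarrow>zip l (alt p i). swap_weight (snd y) (snd (w, q))) = c"
      unfolding c_def snd_conv by (rule prod_swap_weight_alt)
    then have "weight (pre @ zip l (alt p i) @ (w, q) # zip r (alt (\<not> q) (j - 1)) @ post) =
      c * weight (pre @ (w, q) # zip l (alt p i) @ zip r (alt (\<not> q) (j - 1)) @ post)"
      using weight_move_left[OF lt, of "zip l (alt p i)" pre] by metis
    then show "weight (pre @ zip l (alt p i) @ zip (w # r) (alt q j) @ post) =
      c * weight ((pre @ [(w, q)]) @ zip l (alt p i) @ zip r (alt (\<not> q) (j - 1)) @ post)"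
      using that by (simp add: alt_pos)
  qed
  moreover have "(\<Sum>(l, r)\<in>splits (i - 1) j ws.
        weight (pre @ zip (w # l) (alt p i) @ zip r (alt q j) @ post)) = A" if "i > 0"
    unfolding A_def using that by (simp add: alt_pos)
  ultimately have sum: "(\<Sum>(l, r)\<in>splits i j (w # ws).
      weight (pre @ zip l (alt p i) @ zip r (alt q j) @ post)) =
    (if i > 0 then A else 0) + (if j > 0 then c * B else 0)"
    unfolding sum_splits_Cons[OF Cons.prems(1)]
    by (cases "i > 0"; cases "j > 0"; simp only: simp_thms if_True if_False)
  show ?case
  proof (cases "i + j = 1")
    case True
    then have "ws = []" and ij: "i = 1 \<and> j = 0 \<or> i = 0 \<and> j = 1" using len by auto
    then show ?thesis
      unfolding sum W by (auto simp: A_def B_def W_def c_def splits_Nil)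
  next
    case False
    have srt: "sorted_wrt (<) ws" using Cons.prems(1) by simp
    have A: "A = (if p \<noteq> q then merge_coeff (i - 1) j * W p (\<not> p)
       else (if i = 1 then 0 else merge_coeff (i - 2) j) * W p (\<not> p)
       + (if j = 0 then 0 else (- 1) ^ (i - 1) * X ^ (i div 2) * merge_coeff (i - 1) (j - 1)) * W p p)"
      if "i > 0"
      unfolding A_def using that False len Cons.prems(3) srt
      by (subst Cons.IH) (auto simp: W_def diff_diff_left numeral_2_eq_2)
    have B: "B = (if p \<noteq> q then merge_coeff i (j - 1) * W q (\<not> q)
       else (if i = 0 then 0 else merge_coeff (i - 1) (j - 1)) * W p p
       + (if j = 1 then 0 else (- 1) ^ i * X ^ ((i + 1) div 2) * merge_coeff i (j - 2)) * W p (\<not> p))"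
      if "j > 0"
      unfolding B_def using that False len Cons.prems(3) srt
      by (subst Cons.IH) (auto simp: W_def diff_diff_left numeral_2_eq_2)
    \<comment> \<open>Floor and ceiling of \<open>i / 2\<close> add up to \<open>i\<close>, which
      produces the factor \<open>X ^ i\<close> of \<open>merge_coeff_rec\<close>.\<close>
    have sq: "(- 1) ^ i * X ^ (i div 2) * ((- 1) ^ i * X ^ ((i + 1) div 2) * y) = X ^ i * y" for y
    proof -
      have "i = i div 2 + (i + 1) div 2" by presburger
      then have "X ^ i = X ^ (i div 2) * X ^ ((i + 1) div 2)" by (metis power_add)
      moreover have "(- 1) ^ i * (- 1) ^ i = (1 :: int poly fract)"
        by (metis minus_one_mult_self)
      ultimately show ?thesis by (metis (no_types, lifting) mult.assoc mult.commute mult_1)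
    qed
    have sgn: "(- 1) ^ (i - 1) = - ((- 1) ^ i :: int poly fract)" if "i > 0"
      using that by (cases i) auto
    show ?thesis
    proof (cases "p = q")
      case True
      show ?thesis
      proof (cases "i = 0 \<or> j = 0")
        case True
        with \<open>p = q\<close> False Cons.prems(3) show ?thesis
          unfolding sum W by (auto simp: A B c_def)
      next
        case pos: False
        define e where "e = (- 1) ^ i * X ^ (i div 2)"
        define m where "m = merge_coeff (i - 1) (j - 1)"
        define a where "a = (if i = 1 then 0 else merge_coeff (i - 2) j)"
        define b where "b = (if j = 1 then 0 else (- 1) ^ i * X ^ ((i + 1) div 2) * merge_coeff i (j - 2))"
        \<comment> \<open>The terms with \<open>W p p\<close>, where the two smallest values get
          equal parities, enter \<open>A\<close> and \<open>c * B\<close> with opposite coefficients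
          and cancel.\<close>
        have "A = a * W p (\<not> p) - e * m * W p p"
          using A True pos sgn by (simp add: a_def e_def m_def)
        moreover have "B = m * W p p + b * W p (\<not> p)"
          using B True pos unfolding m_def b_def by simp
        moreover have "c = e"
          using True by (simp add: c_def e_def)
        moreover have "e * b = (if j \<ge> 2 then X ^ i * merge_coeff i (j - 2) else 0)"
        proof (cases "j = 1")
          case False
          with pos have "j \<ge> 2" by simp
          with False show ?thesis
            unfolding e_def b_def using sq[of "merge_coeff i (j - 2)"] by simp
        qed (simp add: b_def)
        moreover have "a = (if i \<ge> 2 then merge_coeff (i - 2) j else 0)"
          using pos by (auto simp: a_def)
        ultimately have "A + c * B = (if i \<ge> 2 then merge_coeff (i - 2) j else 0) * W p (\<not> p) +
          (if j \<ge> 2 then X ^ i * merge_coeff i (j - 2) else 0) * W p (\<not> p)"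
          by (simp only: distrib_left distrib_right mult.assoc[symmetric])
        also have "\<dots> = merge_coeff i j * W p (\<not> p)"
          using merge_coeff_rec[of i j] pos by (simp add: algebra_simps)
        finally show ?thesis unfolding sum W using True pos by simp
      qed
    next
      case pq: False
      then show ?thesis unfolding sum W by (auto simp: A B c_def)
    qed
  qed
qed simp

section \<open>Redistributing signs in an increasing block\<close>

definition signings :: "int list \<Rightarrow> int list set" where
  "signings as = {l. sorted_wrt (<) l \<and> distinct (map abs l) \<and> abs ` set l = set as}"

lemma finite_signings: "finite (signings as)"
proof (rule finite_subset)
  show "signings as \<subseteq> {l. set l \<subseteq> set as \<union> uminus ` set as \<and> length l \<le> card (set as)}"
  proof
    fix l assume l: "l \<in> signings as"
    then have "length l = card (set as)"
      by (metis (mono_tags, lifting) distinct_card image_set length_map mem_Collect_eq signings_def)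
    moreover have "v \<in> set as \<union> uminus ` set as" if "v \<in> set l" for v
    proof -
      have "\<bar>v\<bar> \<in> set as" using l that by (auto simp: signings_def)
      moreover have "v = \<bar>v\<bar> \<or> v = - \<bar>v\<bar>" by auto
      ultimately show ?thesis by (metis UnI1 UnI2 image_eqI)
    qed
    ultimately show "l \<in> {l. set l \<subseteq> set as \<union> uminus ` set as \<and> length l \<le> card (set as)}"
      by auto
  qed
qed (simp add: finite_lists_length_le)

lemma signings_Nil: "signings [] = {[]}"
  by (auto simp: signings_def)

lemma signings_bounded:
  assumes "l \<in> signings as" "v \<in> set l" "\<And>a. a \<in> set as \<Longrightarrow> a < w"
  shows "v < w" "- w < v"
proof -
  have "\<bar>v\<bar> \<in> set as" using assms by (auto simp: signings_def)
  then have "\<bar>v\<bar> < w" by (rule assms(3))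
  then show "v < w" "- w < v" by auto
qed

text \<open>In an increasing list the entry of largest absolute value stands last if it is positive
  and first if it is negative.\<close>

lemma signings_snoc:
  assumes "\<And>a. a \<in> set as \<Longrightarrow> a < w" "w > 0"
  shows "signings (as @ [w]) = (\<lambda>l. l @ [w]) ` signings as \<union> (\<lambda>l. (- w) # l) ` signings as"
proof
  have "w \<notin> set as" using assms(1) by blast
  have "l @ [w] \<in> signings (as @ [w])" "(- w) # l \<in> signings (as @ [w])"
    if l: "l \<in> signings as" for l
  proof -
    have "abs ` set l = set as" "sorted_wrt (<) l" "distinct (map abs l)"
      using l by (auto simp: signings_def)
    moreover have "\<forall>v\<in>set l. v < w \<and> - w < v"
      using signings_bounded[OF l _ assms(1)] by blast
    moreover have "w \<notin> abs ` set l"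
      using calculation \<open>w \<notin> set as\<close> by simp
    ultimately show "l @ [w] \<in> signings (as @ [w])" "(- w) # l \<in> signings (as @ [w])"
      using assms(2) by (simp_all add: signings_def sorted_wrt_append)
  qed
  then show "(\<lambda>l. l @ [w]) ` signings as \<union> (\<lambda>l. (- w) # l) ` signings as \<subseteq> signings (as @ [w])"
    by blast
next
  have "w \<notin> set as" using assms(1) by blast
  show "signings (as @ [w]) \<subseteq> (\<lambda>l. l @ [w]) ` signings as \<union> (\<lambda>l. (- w) # l) ` signings as"
  proof
    fix l assume l: "l \<in> signings (as @ [w])"
    have bd: "\<bar>v\<bar> \<le> w" if "v \<in> set l" for v
    proof -
      have "\<bar>v\<bar> \<in> insert w (set as)" using l that by (auto simp: signings_def)
      then show ?thesis using assms(1) by force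
    qed
    have "w \<in> abs ` set l" using l by (auto simp: signings_def)
    then have "w \<in> set l \<or> - w \<in> set l" by (auto simp: abs_if split: if_splits)
    then show "l \<in> (\<lambda>l. l @ [w]) ` signings as \<union> (\<lambda>l. (- w) # l) ` signings as"
    proof
      assume w: "w \<in> set l"
      then obtain l' z where l': "l = l' @ [z]" by (cases l rule: rev_cases) auto
      have "z = w"
      proof (rule ccontr)
        assume "z \<noteq> w"
        then have "w < z" using w l l' by (auto simp: signings_def sorted_wrt_append)
        then show False using bd[of z] l' by auto
      qed
      then have "w \<notin> abs ` set l'" using l l' assms(2) by (auto simp: signings_def)
      then have "l' \<in> signings as"
        using l \<open>w \<notin> set as\<close> assms(2) unfolding l' \<open>z = w\<close> signings_def
        by (auto simp: sorted_wrt_append dest!: insert_ident[THEN iffD1, rotated 2])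
      then show ?thesis using l' \<open>z = w\<close> by blast
    next
      assume w: "- w \<in> set l"
      then obtain l' z where l': "l = z # l'" by (cases l) auto
      have "z = - w"
      proof (rule ccontr)
        assume "z \<noteq> - w"
        then have "z < - w" using w l l' by (auto simp: signings_def)
        then show False using bd[of z] l' by auto
      qed
      then have "w \<notin> abs ` set l'" using l l' assms(2) by (auto simp: signings_def)
      then have "l' \<in> signings as"
        using l \<open>w \<notin> set as\<close> assms(2) unfolding l' \<open>z = - w\<close> signings_def
        by (auto dest!: insert_ident[THEN iffD1, rotated 2])
      then show ?thesis using l' \<open>z = - w\<close> by blast
    qed
  qed
qed

lemma sum_signings_snoc:
  assumes "\<And>a. a \<in> set as \<Longrightarrow> a < w" "w > 0"
  shows "(\<Sum>l\<in>signings (as @ [w]). f l) =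
    (\<Sum>l\<in>signings as. f (l @ [w])) + (\<Sum>l\<in>signings as. f ((- w) # l) :: 'a :: comm_monoid_add)"
proof -
  have "l @ [w] \<noteq> (- w) # l'" if "l \<in> signings as" for l l'
  proof
    assume eq: "l @ [w] = (- w) # l'"
    show False
    proof (cases l)
      case Nil
      with eq assms(2) show ?thesis by simp
    next
      case (Cons a l'')
      with eq signings_bounded(2)[OF that, of "- w" w] assms(1) show ?thesis by auto
    qed
  qed
  then have "(\<lambda>l. l @ [w]) ` signings as \<inter> (\<lambda>l. (- w) # l) ` signings as = {}" by blast
  moreover have "inj_on (\<lambda>l. l @ [w]) (signings as)" "inj_on (\<lambda>l. (- w) # l) (signings as)"
    by (auto simp: inj_on_def)
  ultimately show ?thesis
    using signings_snoc[OF assms]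
    by (simp add: sum.union_disjoint finite_signings sum.reindex)
qed

lemma length_signings:
  assumes "l \<in> signings as" "distinct as"
  shows "length l = length as"
  using assms unfolding signings_def
  by (metis (mono_tags, lifting) distinct_card image_set length_map mem_Collect_eq)

text \<open>The factor with index 1 equals 2: it counts the two signs of the least absolute value.\<close>

definition sign_coeff :: "nat \<Rightarrow> int poly fract" where
  "sign_coeff a = (\<Prod>i=1..a. 1 + (- 1) ^ (i - 1) * X ^ (i div 2))"

lemma sign_coeff_0 [simp]: "sign_coeff 0 = 1"
  by (simp add: sign_coeff_def)

lemma sign_coeff_Suc: "sign_coeff (Suc a) = sign_coeff a * (1 + (- 1) ^ a * X ^ (Suc a div 2))"
  by (simp add: sign_coeff_def)

text \<open>Induction on the largest absolute value \<open>w\<close>. A leading \<open>- w\<close>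
  can be replaced by \<open>w\<close>, because the sign of the very first entry does not affect the
  weight, and then moved to the end of the block. Only positive blocks remain, once with the given
  pattern and once with the pattern that starts with the last parity of the given one.\<close>

lemma sum_signings_weight:
  assumes "sorted_wrt (<) as" "\<And>a. a \<in> set as \<Longrightarrow> a > 0" "length as = Suc k"
  shows "(\<Sum>l\<in>signings as. weight (zip l (alt p (Suc k)) @ post)) =
    sign_coeff k * (weight (zip as (alt p (Suc k)) @ post) +
      (- 1) ^ k * X ^ (Suc k div 2) * weight (zip as (alt (p = even k) (Suc k)) @ post))"
  using assms
proof (induction as arbitrary: k p post rule: rev_induct)
  case (snoc w as)
  have len: "length as = k" using snoc.prems by simp
  have as: "a < w" "a > 0" if "a \<in> set as" for a
    using that snoc.prems by (auto simp: sorted_wrt_append)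
  have w: "w > 0" using snoc.prems by simp
  have srt: "sorted_wrt (<) as" using snoc.prems by (simp add: sorted_wrt_append)
  then have dist: "distinct as" by (simp add: strict_sorted_iff)
  \<comment> \<open>In both abbreviations \<open>w\<close> closes the block with parity
    \<open>t\<close> and the entries before it alternate from \<open>s\<close>; \<open>S\<close>
    sums over their signs, \<open>V\<close> takes all of them positive.\<close>
  define S where "S = (\<lambda>s t. \<Sum>l\<in>signings as. weight (zip l (alt s k) @ (w, t) # post))"
  define V where "V = (\<lambda>s t. weight (zip as (alt s k) @ (w, t) # post))"
  have V: "weight (zip (as @ [w]) (alt s (Suc k)) @ post) = V s (s = even k)" for s
    using len by (simp only: alt_Suc_right) (simp add: V_def)
  have "(\<Sum>l\<in>signings as. weight (zip (l @ [w]) (alt p (Suc k)) @ post)) = S p (p = even k)"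
    unfolding S_def alt_Suc_right
    by (intro sum.cong refl) (simp add: length_signings[OF _ dist] len)
  moreover have "(\<Sum>l\<in>signings as. weight (zip ((- w) # l) (alt p (Suc k)) @ post)) =
    (- 1) ^ k * X ^ (Suc k div 2) * S (\<not> p) p"
    unfolding S_def sum_distrib_left
  proof (intro sum.cong refl)
    fix l assume l: "l \<in> signings as"
    have lt: "fst y < fst (w, p)" if "y \<in> set (zip l (alt (\<not> p) k))" for y
      using that signings_bounded(1)[OF l _ as(1)]
      by (metis fst_conv prod.collapse set_zip_leftD)
    have "length l = k" using length_signings[OF l dist] len by simp
    moreover have "((\<not> p) = p) = False" by simp
    ultimately have "(\<Prod>y\<leftarrow>zip l (alt (\<not> p) k). swap_weight (snd y) (snd (w, p))) =
      (- 1) ^ k * X ^ (Suc k div 2)"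
      using prod_swap_weight_alt[of l k p "\<not> p"] by (simp only: if_False snd_conv Suc_eq_plus1)
    then have "weight ((w, p) # zip l (alt (\<not> p) k) @ post) =
      (- 1) ^ k * X ^ (Suc k div 2) * weight (zip l (alt (\<not> p) k) @ (w, p) # post)"
      using weight_move_right[OF lt, of "zip l (alt (\<not> p) k)" "[]" post] by simp
    then show "weight (zip ((- w) # l) (alt p (Suc k)) @ post) =
      (- 1) ^ k * X ^ (Suc k div 2) * weight (zip l (alt (\<not> p) k) @ (w, p) # post)"
      by (simp add: weight_flip_first del: weight.simps)
  qed
  ultimately have sum: "(\<Sum>l\<in>signings (as @ [w]). weight (zip l (alt p (Suc k)) @ post)) =
    S p (p = even k) + (- 1) ^ k * X ^ (Suc k div 2) * S (\<not> p) p"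
    by (simp add: sum_signings_snoc[OF as(1) w])
  show ?case
  proof (cases k)
    case 0
    with len show ?thesis
      unfolding sum V by (simp add: S_def V_def signings_Nil)
  next
    case (Suc k')
    have S: "S s t = sign_coeff k' * (V s t + (- 1) ^ k' * X ^ (k div 2) * V (s = even k') t)" for s t
      unfolding S_def V_def using snoc.IH[of k' s "(w, t) # post"] srt as(2) len Suc by simp
    show ?thesis
    proof (cases "even k'")
      case True
      then have "(p = even k) = (\<not> p)" "(p = even k') = p" "((\<not> p) = even k') = (\<not> p)" using Suc by auto
      with True Suc show ?thesis
        unfolding sum V S by (simp add: sign_coeff_Suc algebra_simps)
    next
      case False
      \<comment> \<open>The terms \<open>V (\<not> p) p\<close>, with equal parities in the last two
        places of the block, cancel. What remains is \<open>1 - X ^ k\<close>, the product of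
        \<open>1 - X ^ (k div 2)\<close> and \<open>1 + X ^ (k div 2)\<close>.\<close>
      then have "(p = even k) = p" "(p = even k') = (\<not> p)" "((\<not> p) = even k') = p"
        "Suc k div 2 = k div 2" using Suc by auto
      with False Suc show ?thesis
        unfolding sum V S by (simp add: sign_coeff_Suc algebra_simps)
    qed
  qed
qed simp

section \<open>Sums over signed words with prescribed increasing blocks\<close>

definition signed_words :: "nat \<Rightarrow> int list set" where
  "signed_words n = {vs. length vs = n \<and> distinct (map abs vs) \<and> abs ` set vs = {1..int n}}"

lemma finite_signed_words: "finite (signed_words n)"
proof (rule finite_subset)
  show "signed_words n \<subseteq> {vs. set vs \<subseteq> {- int n..int n} \<and> length vs = n}"
  proof
    fix vs assume vs: "vs \<in> signed_words n"
    have "v \<in> {- int n..int n}" if "v \<in> set vs" for v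
    proof -
      have "\<bar>v\<bar> \<in> {1..int n}" using vs that by (auto simp: signed_words_def)
      then show ?thesis by auto
    qed
    with vs show "vs \<in> {vs. set vs \<subseteq> {- int n..int n} \<and> length vs = n}"
      by (auto simp: signed_words_def)
  qed
qed (simp add: finite_lists_length_eq)

lemma signed_words_cong:
  assumes "mset (map abs vs) = mset (map abs vs')"
  shows "vs \<in> signed_words n \<longleftrightarrow> vs' \<in> signed_words n"
proof -
  have "length vs = length vs'" using assms by (metis length_map mset_eq_length)
  moreover have "distinct (map abs vs) = distinct (map abs vs')"
    using assms by (rule mset_eq_imp_distinct_iff)
  moreover have "abs ` set vs = abs ` set vs'" using assms by (metis list.set_map mset_eq_setD)
  ultimately show ?thesis by (simp add: signed_words_def)
qed

text \<open>A shape lists consecutive blocks of positions as pairs of the parity of the first position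
  (\<open>True\<close> for odd) and the length. Merging blocks can produce a block whose recorded parities
  differ from those of its actual positions, so they are part of the data.\<close>

type_synonym shape = "(bool \<times> nat) list"

fun fits :: "shape \<Rightarrow> int list \<Rightarrow> bool" where
  "fits [] vs \<longleftrightarrow> vs = []"
| "fits ((p, b) # sh) vs \<longleftrightarrow>
     (\<exists>l r. vs = l @ r \<and> length l = b \<and> sorted_wrt (<) l \<and> fits sh r)"

definition shape_size :: "shape \<Rightarrow> nat" where
  "shape_size sh = (\<Sum>(p, b)\<leftarrow>sh. b)"

definition parities :: "shape \<Rightarrow> bool list" where
  "parities sh = concat (map (\<lambda>(p, b). alt p b) sh)"

lemma shape_size_simps [simp]:
  "shape_size [] = 0" "shape_size ((p, b) # sh) = b + shape_size sh"
  "shape_size (s1 @ s2) = shape_size s1 + shape_size s2"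
  by (simp_all add: shape_size_def)

lemma parities_simps [simp]:
  "parities [] = []" "parities ((p, b) # sh) = alt p b @ parities sh"
  "parities (s1 @ s2) = parities s1 @ parities s2"
  by (simp_all add: parities_def)

lemma length_parities [simp]: "length (parities sh) = shape_size sh"
  by (induction sh) auto

lemma fits_length: "fits sh vs \<Longrightarrow> length vs = shape_size sh"
  by (induction sh vs rule: fits.induct) auto

lemma fits_append: "fits (s1 @ s2) vs \<longleftrightarrow> (\<exists>l r. vs = l @ r \<and> fits s1 l \<and> fits s2 r)"
proof (induction s1 arbitrary: vs)
  case (Cons pb s1)
  obtain p b where "pb = (p, b)" by fastforce
  with Cons show ?case by (auto; metis append.assoc)
qed simp

definition shape_sum :: "shape \<Rightarrow> int poly fract" where
  "shape_sum sh =
     (\<Sum>vs | vs \<in> signed_words (shape_size sh) \<and> fits sh vs. weight (zip vs (parities sh)))"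

text \<open>Sorting the union of the two blocks groups the words into fibres, each formed by the
  splits of one increasing block, and \<open>sum_splits_weight\<close> evaluates every
  fibre.\<close>

lemma shape_sum_merge:
  assumes "i + j > 0"
  shows "shape_sum (s1 @ (p, i) # (q, j) # s2) =
    (if p = q then merge_coeff i j * shape_sum (s1 @ (p, i + j) # s2)
     else (if i = 0 then 0 else merge_coeff (i - 1) j) * shape_sum (s1 @ (p, i + j) # s2)
       + (if j = 0 then 0 else (- 1) ^ i * X ^ ((i + 1) div 2) * merge_coeff i (j - 1)) *
         shape_sum (s1 @ (q, i + j) # s2))" (is "_ = ?rhs")
proof -
  define n where "n = shape_size (s1 @ (p, i) # (q, j) # s2)"
  \<comment> \<open>The words with merged block, cut at the block. The set does not depend on
    parities, so it serves both merged shapes on the right.\<close>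
  define T where "T = {(pre, ws, post). fits s1 pre \<and> length ws = i + j \<and> sorted_wrt (<) ws \<and>
    fits s2 post \<and> pre @ ws @ post \<in> signed_words n}"
  define f where "f = (\<lambda>pre mid post. weight (zip pre (parities s1) @ mid @ zip post (parities s2)))"
  have len: "length pre = shape_size s1" "length ws = i + j" "length post = shape_size s2"
    if "(pre, ws, post) \<in> T" for pre ws post
    using that fits_length by (auto simp: T_def)
  have merged: "shape_sum (s1 @ (s, i + j) # s2) =
      (\<Sum>(pre, ws, post)\<in>T. f pre (zip ws (alt s (i + j))) post)" for s
  proof -
    have size: "shape_size (s1 @ (s, i + j) # s2) = n" by (simp add: n_def)
    have bij: "bij_betw (\<lambda>(pre, ws, post). pre @ ws @ post) T
      {vs \<in> signed_words n. fits (s1 @ (s, i + j) # s2) vs}"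
      unfolding bij_betw_def
    proof
      show "inj_on (\<lambda>(pre, ws, post). pre @ ws @ post) T"
        by (auto simp: inj_on_def len)
      show "(\<lambda>(pre, ws, post). pre @ ws @ post) ` T =
          {vs \<in> signed_words n. fits (s1 @ (s, i + j) # s2) vs}"
      proof (intro equalityI subsetI)
        fix vs assume "vs \<in> {vs \<in> signed_words n. fits (s1 @ (s, i + j) # s2) vs}"
        then obtain pre ws post where "vs = pre @ ws @ post" "(pre, ws, post) \<in> T"
          by (auto simp: T_def fits_append)
        then show "vs \<in> (\<lambda>(pre, ws, post). pre @ ws @ post) ` T" by force
      qed (auto simp: T_def fits_append)
    qed
    have "shape_sum (s1 @ (s, i + j) # s2) =
      (\<Sum>(pre, ws, post)\<in>T. weight (zip (pre @ ws @ post) (parities (s1 @ (s, i + j) # s2))))"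
      unfolding shape_sum_def size
      using sum.reindex_bij_betw[OF bij, of "\<lambda>vs. weight (zip vs (parities (s1 @ (s, i + j) # s2)))"]
      by (simp add: case_prod_unfold)
    also have "\<dots> = (\<Sum>(pre, ws, post)\<in>T. f pre (zip ws (alt s (i + j))) post)"
      by (intro sum.cong refl) (auto simp: f_def len)
    finally show ?thesis .
  qed
  let ?S = "SIGMA (pre, ws, post):T. splits i j ws"
  let ?g = "\<lambda>((pre, ws, post), (l, r)). pre @ l @ r @ post"
  have mset_splits: "mset (l @ r) = mset ws" if "(l, r) \<in> splits i j ws" "sorted_wrt (<) ws" for l r ws
    using that by (intro set_eq_iff_mset_eq_distinct[THEN iffD1]) (auto simp: splits_def strict_sorted_iff)
  have bij: "bij_betw ?g ?S {vs \<in> signed_words n. fits (s1 @ (p, i) # (q, j) # s2) vs}"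
    unfolding bij_betw_def
  proof
    show "inj_on ?g ?S"
    proof (rule inj_onI)
      fix x y assume xy: "x \<in> ?S" "y \<in> ?S" "?g x = ?g y"
      obtain pre ws post l r where x: "x = ((pre, ws, post), l, r)" by (metis surj_pair)
      obtain pre' ws' post' l' r' where y: "y = ((pre', ws', post'), l', r')" by (metis surj_pair)
      from xy have T: "(pre, ws, post) \<in> T" "(pre', ws', post') \<in> T"
        and s: "(l, r) \<in> splits i j ws" "(l', r') \<in> splits i j ws'"
        and eq: "pre @ l @ r @ post = pre' @ l' @ r' @ post'"
        unfolding x y by auto
      have "length l = i" "length l' = i" "length r = j" "length r' = j"
        using s by (auto simp: splits_def)
      then have eqs: "pre = pre'" "l = l'" "r = r'" "post = post'"
        using eq len[OF T(1)] len[OF T(2)] by auto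
      then have "set ws = set ws'" using s by (auto simp: splits_def)
      then have "ws = ws'"
        using T by (auto simp: T_def intro: strict_sorted_equal)
      with eqs show "x = y" by (simp add: x y)
    qed
    show "?g ` ?S = {vs \<in> signed_words n. fits (s1 @ (p, i) # (q, j) # s2) vs}"
    proof (intro equalityI subsetI)
      fix vs assume "vs \<in> ?g ` ?S"
      then obtain pre ws post l r where T: "(pre, ws, post) \<in> T" and s: "(l, r) \<in> splits i j ws"
        and vs: "vs = pre @ l @ r @ post" by auto
      have "mset (l @ r) = mset ws" using mset_splits[OF s] T by (auto simp: T_def)
      then have "mset (map abs vs) = mset (map abs (pre @ ws @ post))"
        unfolding vs by (metis append.assoc mset_append mset_map)
      then have "vs \<in> signed_words n"
        using T signed_words_cong unfolding T_def by blast
      moreover have "fits (s1 @ (p, i) # (q, j) # s2) vs"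
        using T s unfolding vs fits_append T_def splits_def by auto
      ultimately show "vs \<in> {vs \<in> signed_words n. fits (s1 @ (p, i) # (q, j) # s2) vs}" by simp
    next
      fix vs assume vs: "vs \<in> {vs \<in> signed_words n. fits (s1 @ (p, i) # (q, j) # s2) vs}"
      then obtain pre l r post where d: "vs = pre @ l @ r @ post" "fits s1 pre" "length l = i"
        "sorted_wrt (<) l" "length r = j" "sorted_wrt (<) r" "fits s2 post"
        by (auto simp: fits_append)
      have "distinct (map abs vs)" using vs by (simp add: signed_words_def)
      then have "distinct vs" by (simp add: distinct_map)
      then have dist: "distinct (l @ r)" unfolding d(1) by auto
      define ws where "ws = sort (l @ r)"
      have "sorted_wrt (<) ws" using dist by (simp add: ws_def strict_sorted_iff)
      moreover have "mset (map abs vs) = mset (map abs (pre @ ws @ post))"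
        unfolding d(1) ws_def by simp
      then have "pre @ ws @ post \<in> signed_words n"
        using vs signed_words_cong by blast
      ultimately have "(pre, ws, post) \<in> T" using d by (simp add: T_def ws_def)
      moreover have "(l, r) \<in> splits i j ws"
        using d dist by (auto simp: splits_def ws_def)
      ultimately have "((pre, ws, post), (l, r)) \<in> ?S" by simp
      then show "vs \<in> ?g ` ?S" unfolding d(1) by (force intro: rev_image_eqI)
    qed
  qed
  have finT: "finite T"
  proof (rule finite_imageD)
    show "finite ((\<lambda>(pre, ws, post). pre @ ws @ post) ` T)"
      by (rule finite_subset[OF _ finite_signed_words[of n]]) (auto simp: T_def)
    show "inj_on (\<lambda>(pre, ws, post). pre @ ws @ post) T"
      by (auto simp: inj_on_def len)
  qed
  have "shape_sum (s1 @ (p, i) # (q, j) # s2) =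
      (\<Sum>x\<in>?S. weight (zip (?g x) (parities (s1 @ (p, i) # (q, j) # s2))))"
    unfolding shape_sum_def n_def[symmetric]
    by (rule sum.reindex_bij_betw[OF bij, symmetric])
  also have "\<dots> = (\<Sum>((pre, ws, post), (l, r))\<in>?S.
      f pre (zip l (alt p i) @ zip r (alt q j)) post)"
    by (intro sum.cong refl) (auto simp: f_def splits_def len)
  also have "\<dots> = (\<Sum>(pre, ws, post)\<in>T. \<Sum>(l, r)\<in>splits i j ws.
      f pre (zip l (alt p i) @ zip r (alt q j)) post)"
    using finT by (subst sum.Sigma[symmetric]) (auto simp: finite_splits case_prod_unfold)
  also have "\<dots> = (\<Sum>(pre, ws, post)\<in>T.
      if p = q then merge_coeff i j * f pre (zip ws (alt p (i + j))) post
      else (if i = 0 then 0 else merge_coeff (i - 1) j) * f pre (zip ws (alt p (i + j))) post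
       + (if j = 0 then 0 else (- 1) ^ i * X ^ ((i + 1) div 2) * merge_coeff i (j - 1)) *
         f pre (zip ws (alt q (i + j))) post)"
  proof (intro sum.cong refl, clarify)
    fix pre ws post assume "(pre, ws, post) \<in> T"
    then have "sorted_wrt (<) ws" "length ws = i + j" by (auto simp: T_def)
    from sum_splits_weight[OF this assms, of "zip pre (parities s1)" p q "zip post (parities s2)"]
    show "(\<Sum>(l, r)\<in>splits i j ws. f pre (zip l (alt p i) @ zip r (alt q j)) post) =
      (if p = q then merge_coeff i j * f pre (zip ws (alt p (i + j))) post
      else (if i = 0 then 0 else merge_coeff (i - 1) j) * f pre (zip ws (alt p (i + j))) post
       + (if j = 0 then 0 else (- 1) ^ i * X ^ ((i + 1) div 2) * merge_coeff i (j - 1)) *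
         f pre (zip ws (alt q (i + j))) post)"
      by (simp only: f_def append.assoc)
  qed
  also have "\<dots> = ?rhs"
    unfolding merged
    by (simp add: sum_distrib_left sum.distrib case_prod_unfold)
  finally show ?thesis .
qed

text \<open>Restricting the first block to positive values accounts for the type D condition
  \<open>\<bar>\<sigma> 1\<bar> < \<sigma> 2 < \<dots> < \<sigma> a\<close>, up to the sign of \<open>\<sigma> 1\<close>.\<close>

definition positive_sum :: "bool \<Rightarrow> nat \<Rightarrow> shape \<Rightarrow> int poly fract" where
  "positive_sum p a sh =
     (\<Sum>vs | vs \<in> signed_words (a + shape_size sh) \<and> fits ((p, a) # sh) vs \<and>
        (\<forall>v\<in>set (take a vs). v > 0). weight (zip vs (alt p a @ parities sh)))"

text \<open>Taking absolute values in the first block and sorting them groups the words into fibres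
  of the form \<open>signings as\<close>, which \<open>sum_signings_weight\<close>
  evaluates.\<close>

lemma shape_sum_positive_sum:
  "shape_sum ((p, Suc k) # sh) = sign_coeff k * (positive_sum p (Suc k) sh +
     (- 1) ^ k * X ^ (Suc k div 2) * positive_sum (p = even k) (Suc k) sh)"
proof -
  define n where "n = Suc k + shape_size sh"
  define T where "T = {(as, post). length as = Suc k \<and> sorted_wrt (<) as \<and> (\<forall>a\<in>set as. a > 0) \<and>
    fits sh post \<and> as @ post \<in> signed_words n}"
  define f where "f = (\<lambda>mid post. weight (mid @ zip post (parities sh)))"
  have len: "length as = Suc k" "length post = shape_size sh" if "(as, post) \<in> T" for as post
    using that fits_length by (auto simp: T_def)
  have positive: "positive_sum s (Suc k) sh = (\<Sum>(as, post)\<in>T. f (zip as (alt s (Suc k))) post)" for s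
  proof -
    have bij: "bij_betw (\<lambda>(as, post). as @ post) T {vs \<in> signed_words n. fits ((s, Suc k) # sh) vs \<and>
        (\<forall>v\<in>set (take (Suc k) vs). v > 0)}"
      unfolding bij_betw_def
    proof
      show "inj_on (\<lambda>(as, post). as @ post) T" by (auto simp: inj_on_def len)
      show "(\<lambda>(as, post). as @ post) ` T = {vs \<in> signed_words n. fits ((s, Suc k) # sh) vs \<and>
        (\<forall>v\<in>set (take (Suc k) vs). v > 0)}"
        by (force simp: T_def)
    qed
    have "positive_sum s (Suc k) sh =
      (\<Sum>(as, post)\<in>T. weight (zip (as @ post) (alt s (Suc k) @ parities sh)))"
      unfolding positive_sum_def n_def[symmetric]
      using sum.reindex_bij_betw[OF bij, of "\<lambda>vs. weight (zip vs (alt s (Suc k) @ parities sh))"]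
      by (simp add: case_prod_unfold del: alt.simps)
    also have "\<dots> = (\<Sum>(as, post)\<in>T. f (zip as (alt s (Suc k))) post)"
      by (intro sum.cong refl) (auto simp: f_def len simp del: alt.simps)
    finally show ?thesis .
  qed
  let ?S = "SIGMA (as, post):T. signings as"
  let ?g = "\<lambda>((as, post), l). l @ post :: int list"
  have len_l: "length l = Suc k" if "(as, post) \<in> T" "l \<in> signings as" for as post l
    using length_signings[OF that(2)] that(1) by (simp add: T_def strict_sorted_iff)
  have bij: "bij_betw ?g ?S {vs \<in> signed_words n. fits ((p, Suc k) # sh) vs}"
    unfolding bij_betw_def
  proof
    show "inj_on ?g ?S"
    proof (rule inj_onI)
      fix x y assume xy: "x \<in> ?S" "y \<in> ?S" "?g x = ?g y"
      obtain as post l where x: "x = ((as, post), l)" by (metis surj_pair)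
      obtain as' post' l' where y: "y = ((as', post'), l')" by (metis surj_pair)
      from xy have T: "(as, post) \<in> T" "(as', post') \<in> T"
        and s: "l \<in> signings as" "l' \<in> signings as'" and eq: "l @ post = l' @ post'"
        unfolding x y by auto
      have eqs: "l = l'" "post = post'"
        using eq len_l[OF T(1) s(1)] len_l[OF T(2) s(2)] by auto
      then have "set as = set as'" using s by (auto simp: signings_def)
      then have "as = as'"
        using T by (auto simp: T_def intro: strict_sorted_equal)
      with eqs show "x = y" by (simp add: x y)
    qed
    show "?g ` ?S = {vs \<in> signed_words n. fits ((p, Suc k) # sh) vs}"
    proof (intro equalityI subsetI)
      fix vs assume "vs \<in> ?g ` ?S"
      then obtain as post l where T: "(as, post) \<in> T" and s: "l \<in> signings as"
        and vs: "vs = l @ post" by auto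
      have pos: "map abs as = as" using T by (intro map_idI) (auto simp: T_def)
      have "mset (map abs l) = mset as"
        using s T by (intro set_eq_iff_mset_eq_distinct[THEN iffD1])
          (auto simp: signings_def T_def strict_sorted_iff)
      then have "mset (map abs vs) = mset (map abs (as @ post))"
        unfolding vs by (simp add: pos)
      then have "vs \<in> signed_words n"
        using T signed_words_cong unfolding T_def by blast
      moreover have "fits ((p, Suc k) # sh) vs"
        using T s len_l[OF T s] unfolding vs T_def signings_def by auto
      ultimately show "vs \<in> {vs \<in> signed_words n. fits ((p, Suc k) # sh) vs}" by simp
    next
      fix vs assume vs: "vs \<in> {vs \<in> signed_words n. fits ((p, Suc k) # sh) vs}"
      then obtain l post where d: "vs = l @ post" "length l = Suc k" "sorted_wrt (<) l" "fits sh post"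
        by auto
      have dist: "distinct (map abs l)" and "abs ` set vs = {1..int n}"
        using vs by (auto simp: signed_words_def d(1))
      then have pos: "\<bar>v\<bar> > 0" if "v \<in> set l" for v
        using that d(1) by (metis UnI1 atLeastAtMost_iff image_eqI int_one_le_iff_zero_less set_append)
      define as where "as = sort (map abs l)"
      have "sorted_wrt (<) as" using dist by (simp add: as_def strict_sorted_iff)
      moreover have "map abs as = as" unfolding as_def using pos by (intro map_idI) auto
      then have "mset (map abs vs) = mset (map abs (as @ post))"
        unfolding d(1) by (simp add: as_def)
      then have "as @ post \<in> signed_words n"
        using vs signed_words_cong by blast
      ultimately have "(as, post) \<in> T" using d pos by (auto simp: T_def as_def)
      moreover have "l \<in> signings as"
        using d dist by (auto simp: signings_def as_def)
      ultimately have "((as, post), l) \<in> ?S" by simp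
      then show "vs \<in> ?g ` ?S" unfolding d(1) by (force intro: rev_image_eqI)
    qed
  qed
  have finT: "finite T"
  proof (rule finite_imageD)
    show "finite ((\<lambda>(as, post). as @ post) ` T)"
      by (rule finite_subset[OF _ finite_signed_words[of n]]) (auto simp: T_def)
    show "inj_on (\<lambda>(as, post). as @ post) T"
      by (auto simp: inj_on_def len)
  qed
  have "shape_size ((p, Suc k) # sh) = n" by (simp add: n_def)
  then have "shape_sum ((p, Suc k) # sh) =
      (\<Sum>x\<in>?S. weight (zip (?g x) (parities ((p, Suc k) # sh))))"
    unfolding shape_sum_def
    using sum.reindex_bij_betw[OF bij, of "\<lambda>vs. weight (zip vs (parities ((p, Suc k) # sh)))"] by simp
  also have "\<dots> = (\<Sum>((as, post), l)\<in>?S. f (zip l (alt p (Suc k))) post)"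
    by (intro sum.cong refl) (auto simp: f_def len_l simp del: alt.simps)
  also have "\<dots> = (\<Sum>(as, post)\<in>T. \<Sum>l\<in>signings as. f (zip l (alt p (Suc k))) post)"
    using finT by (subst sum.Sigma[symmetric]) (auto simp: finite_signings case_prod_unfold)
  also have "\<dots> = (\<Sum>(as, post)\<in>T. sign_coeff k * (f (zip as (alt p (Suc k))) post +
      (- 1) ^ k * X ^ (Suc k div 2) * f (zip as (alt (p = even k) (Suc k))) post))"
    by (intro sum.cong refl) (auto simp: f_def T_def sum_signings_weight simp del: alt.simps)
  also have "\<dots> = sign_coeff k * (positive_sum p (Suc k) sh +
      (- 1) ^ k * X ^ (Suc k div 2) * positive_sum (p = even k) (Suc k) sh)"
    unfolding positive
    by (simp add: sum_distrib_left sum.distrib case_prod_unfold distrib_left)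
  finally show ?thesis .
qed

lemma weight_sorted_positive:
  assumes "sorted_wrt (<) vs" "\<And>v. v \<in> set vs \<Longrightarrow> v > 0"
  shows "weight (zip vs ps) = 1"
  using assms
proof (induction vs arbitrary: ps)
  case (Cons v vs)
  show ?case
  proof (cases ps)
    case (Cons p ps')
    have "pair_weight (v, p) y = 1" if "y \<in> set (zip vs ps')" for y
    proof -
      have "fst y \<in> set vs" using that by (metis prod.collapse set_zip_leftD)
      then have "v < fst y" "v > 0" using Cons.prems by auto
      then show ?thesis by (simp add: pair_weight_def)
    qed
    then have "map (pair_weight (v, p)) (zip vs ps') = map (\<lambda>_. 1) (zip vs ps')"
      by (intro map_cong refl) auto
    then have "(\<Prod>y\<leftarrow>zip vs ps'. pair_weight (v, p) y) = 1"
      by (simp only: map_replicate_const) simp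
    with Cons Cons.IH[of ps'] Cons.prems show ?thesis by simp
  qed simp
qed simp

text \<open>Only the identity word qualifies, and it has neither inversions nor negative
  sums.\<close>

lemma positive_sum_single: "positive_sum p n [] = 1"
proof -
  have eq: "{vs \<in> signed_words (n + shape_size []). fits ((p, n) # []) vs \<and> (\<forall>v\<in>set (take n vs). v > 0)} =
    {[1..int n]}"
  proof (intro equalityI subsetI)
    fix vs assume vs: "vs \<in> {vs \<in> signed_words (n + shape_size []). fits ((p, n) # []) vs \<and>
      (\<forall>v\<in>set (take n vs). v > 0)}"
    then have "sorted_wrt (<) vs" "\<forall>v\<in>set vs. v > 0" "abs ` set vs = {1..int n}"
      by (auto simp: signed_words_def)
    moreover from this have "abs ` set vs = set vs" by force
    ultimately show "vs \<in> {[1..int n]}"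
      using strict_sorted_equal[of "[1..int n]" vs] by simp
  next
    fix vs assume "vs \<in> {[1..int n]}"
    then show "vs \<in> {vs \<in> signed_words (n + shape_size []). fits ((p, n) # []) vs \<and>
      (\<forall>v\<in>set (take n vs). v > 0)}"
      by (auto simp: signed_words_def distinct_map inj_on_def dest: in_set_takeD)
  qed
  show ?thesis
    unfolding positive_sum_def eq using weight_sorted_positive[of "[1..int n]" "alt p n"] by simp
qed

text \<open>Both positive sums in \<open>shape_sum_positive_sum\<close> equal 1, so their
  combination is the last factor of \<open>sign_coeff n\<close>.\<close>

lemma shape_sum_single: "n > 0 \<Longrightarrow> shape_sum [(p, n)] = sign_coeff n"
  by (cases n) (auto simp: shape_sum_positive_sum positive_sum_single sign_coeff_Suc)

section \<open>Products of cyclotomic polynomials in the indeterminate\<close>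

text \<open>Up to sign, the quotients of products of \<open>X ^ k - 1\<close>. This class is closed
  under division and lives in the field where the sums are computed; for polynomials,
  \<open>signed_cyclotomic_product_if_ratio\<close> leads back to products of cyclotomic
  polynomials.\<close>

definition cyclotomic_ratio :: "int poly fract \<Rightarrow> bool" where
  "cyclotomic_ratio p \<longleftrightarrow> (\<exists>as bs :: nat list. (\<forall>k\<in>set as \<union> set bs. k > 0) \<and>
     (p * (\<Prod>b\<leftarrow>bs. X ^ b - 1) = (\<Prod>a\<leftarrow>as. X ^ a - 1) \<or>
      p * (\<Prod>b\<leftarrow>bs. X ^ b - 1) = - (\<Prod>a\<leftarrow>as. X ^ a - 1)))"

lemma prod_X_power_nonzero: "\<forall>k\<in>set as. k > 0 \<Longrightarrow> (\<Prod>a\<leftarrow>as. X ^ a - 1) \<noteq> 0"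
  by (auto simp: prod_list_zero_iff)

lemma cyclotomic_ratioI:
  assumes "p * (\<Prod>b\<leftarrow>bs. X ^ b - 1) = (\<Prod>a\<leftarrow>as. X ^ a - 1)" "\<forall>k\<in>set as \<union> set bs. k > 0"
  shows "cyclotomic_ratio p"
  using assms unfolding cyclotomic_ratio_def by blast

lemma cyclotomic_ratio_1: "cyclotomic_ratio 1"
  by (rule cyclotomic_ratioI[of _ "[]" "[]"]) auto

lemma cyclotomic_ratio_uminus: "cyclotomic_ratio p \<Longrightarrow> cyclotomic_ratio (- p)"
  unfolding cyclotomic_ratio_def by (metis (no_types, lifting) minus_mult_left minus_minus)

lemma cyclotomic_ratio_mult:
  assumes "cyclotomic_ratio p" "cyclotomic_ratio q"
  shows "cyclotomic_ratio (p * q)"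
proof -
  have *: "cyclotomic_ratio (p * q)"
    if "p * (\<Prod>b\<leftarrow>bs. X ^ b - 1) = (\<Prod>a\<leftarrow>as. X ^ a - 1)" "\<forall>k\<in>set as \<union> set bs. k > 0"
      "q * (\<Prod>b\<leftarrow>bs'. X ^ b - 1) = (\<Prod>a\<leftarrow>as'. X ^ a - 1)" "\<forall>k\<in>set as' \<union> set bs'. k > 0"
    for p q as bs as' bs'
  proof (rule cyclotomic_ratioI[of _ "bs @ bs'" "as @ as'"])
    show "p * q * (\<Prod>b\<leftarrow>bs @ bs'. X ^ b - 1) = (\<Prod>a\<leftarrow>as @ as'. X ^ a - 1)"
      using that(1,3) by (simp flip: that(1,3))
  qed (use that in auto)
  \<comment> \<open>Moving the sign over to \<open>p\<close> leaves one case for the product instead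
    of four.\<close>
  have sgn: "\<exists>as bs s. (\<forall>k\<in>set as \<union> set bs. k > 0) \<and> s \<in> {1, -1} \<and>
      (s * p) * (\<Prod>b\<leftarrow>bs. X ^ b - 1) = (\<Prod>a\<leftarrow>as. X ^ a - 1)" if "cyclotomic_ratio p" for p
    using that unfolding cyclotomic_ratio_def
    by (metis (no_types, lifting) insert_iff minus_minus mult_1 mult_minus_left)
  obtain as bs s where s: "\<forall>k\<in>set as \<union> set bs. k > 0" "s \<in> {1, -1}"
      "(s * p) * (\<Prod>b\<leftarrow>bs. X ^ b - 1) = (\<Prod>a\<leftarrow>as. X ^ a - 1)"
    using sgn[OF assms(1)] by blast
  obtain as' bs' t where t: "\<forall>k\<in>set as' \<union> set bs'. k > 0" "t \<in> {1, -1}"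
      "(t * q) * (\<Prod>b\<leftarrow>bs'. X ^ b - 1) = (\<Prod>a\<leftarrow>as'. X ^ a - 1)"
    using sgn[OF assms(2)] by blast
  have "cyclotomic_ratio ((s * p) * (t * q))" using *[OF s(3,1) t(3,1)] .
  with s(2) t(2) cyclotomic_ratio_uminus[of "- (p * q)"] show ?thesis by auto
qed

lemma cyclotomic_ratio_inverse:
  assumes "cyclotomic_ratio p"
  shows "cyclotomic_ratio (inverse p)"
proof -
  obtain as bs where *: "\<forall>k\<in>set as \<union> set bs. k > 0"
    "p * (\<Prod>b\<leftarrow>bs. X ^ b - 1) = (\<Prod>a\<leftarrow>as. X ^ a - 1) \<or>
      p * (\<Prod>b\<leftarrow>bs. X ^ b - 1) = - (\<Prod>a\<leftarrow>as. X ^ a - 1)"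
    using assms unfolding cyclotomic_ratio_def by blast
  have nz: "(\<Prod>a\<leftarrow>as. X ^ a - 1) \<noteq> 0" using * by (intro prod_X_power_nonzero) auto
  with *(2) have "p \<noteq> 0" by auto
  then have "inverse p * (\<Prod>a\<leftarrow>as. X ^ a - 1) = (\<Prod>b\<leftarrow>bs. X ^ b - 1) \<or>
    inverse p * (\<Prod>a\<leftarrow>as. X ^ a - 1) = - (\<Prod>b\<leftarrow>bs. X ^ b - 1)"
    using *(2) by (auto simp: field_simps)
  then show ?thesis using *(1) unfolding cyclotomic_ratio_def by blast
qed

lemma cyclotomic_ratio_divide:
  "cyclotomic_ratio p \<Longrightarrow> cyclotomic_ratio q \<Longrightarrow> cyclotomic_ratio (p / q)"
  by (simp add: divide_inverse cyclotomic_ratio_mult cyclotomic_ratio_inverse)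

lemma cyclotomic_ratio_prod:
  "(\<And>i. i \<in> A \<Longrightarrow> cyclotomic_ratio (f i)) \<Longrightarrow> cyclotomic_ratio (prod f A)"
  by (induction A rule: infinite_finite_induct) (auto intro: cyclotomic_ratio_mult cyclotomic_ratio_1)

lemma cyclotomic_ratio_one_minus_power: "k > 0 \<Longrightarrow> cyclotomic_ratio (1 - X ^ k)"
  using cyclotomic_ratio_uminus[of "X ^ k - 1"] cyclotomic_ratioI[of "X ^ k - 1" "[]" "[k]"] by simp

text \<open>\<open>1 + X ^ k\<close> is the quotient of \<open>X ^ (2 * k) - 1\<close> by
  \<open>X ^ k - 1\<close>.\<close>

lemma cyclotomic_ratio_one_plus_power:
  assumes "k > 0"
  shows "cyclotomic_ratio (1 + X ^ k)"
proof (rule cyclotomic_ratioI[of _ "[k]" "[2 * k]"])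
  show "(1 + X ^ k) * (\<Prod>b\<leftarrow>[k]. X ^ b - 1) = (\<Prod>a\<leftarrow>[2 * k]. X ^ a - 1)"
  proof -
    have "X ^ (2 * k) = X ^ k * X ^ k" by (simp only: mult_2 power_add)
    then show ?thesis by (simp add: ring_distribs)
  qed
qed (use assms in auto)

lemma cyclotomic_ratio_qpoch: "cyclotomic_ratio (qpoch k)"
  unfolding qpoch_def by (intro cyclotomic_ratio_prod cyclotomic_ratio_one_minus_power) auto

lemma cyclotomic_ratio_qbinom: "cyclotomic_ratio (qbinom g h)"
  unfolding qbinom_def by (intro cyclotomic_ratio_divide cyclotomic_ratio_mult cyclotomic_ratio_qpoch)

lemma sign_coeff_split:
  assumes "1 \<le> a" "a \<le> n"
  shows "sign_coeff n = sign_coeff a * (\<Prod>i=a + 1..n. 1 + (- 1) ^ (i - 1) * X ^ (i div 2))"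
  using assms prod.ub_add_nat[of 1 a "\<lambda>i. 1 + (- 1) ^ (i - 1) * X ^ (i div 2)" "n - a"]
  by (simp add: sign_coeff_def)

text \<open>The range starts beyond index 1, where the factor is the constant 2; from index 2 on the
  exponent \<open>i div 2\<close> is positive.\<close>

lemma cyclotomic_ratio_sign_factors:
  assumes "a \<ge> 1"
  shows "cyclotomic_ratio (\<Prod>i=a + 1..n. 1 + (- 1) ^ (i - 1) * X ^ (i div 2))"
proof (intro cyclotomic_ratio_prod)
  fix i assume "i \<in> {a + 1..n}"
  with assms have "i div 2 > 0" by auto
  then show "cyclotomic_ratio (1 + (- 1) ^ (i - 1) * X ^ (i div 2))"
    using cyclotomic_ratio_one_minus_power cyclotomic_ratio_one_plus_power
    by (cases "even (i - 1)") auto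
qed

lemma two_neq_zero: "(2 :: int poly fract) \<noteq> 0"
proof -
  have "(2 :: int poly fract) = to_fract 2"
    by (metis one_add_one to_fract_1 to_fract_add)
  then show ?thesis by simp
qed

lemma sign_coeff_1: "sign_coeff (Suc 0) = 2"
  by (simp add: sign_coeff_def)

text \<open>The shape whose recorded parities are those of the actual positions, when the first
  position has parity \<open>p\<close>.\<close>

fun contiguous :: "bool \<Rightarrow> nat list \<Rightarrow> shape" where
  "contiguous p [] = []"
| "contiguous p (b # bs) = (p, b) # contiguous (p = even b) bs"

lemma shape_size_contiguous [simp]: "shape_size (contiguous p bs) = sum_list bs"
  by (induction bs arbitrary: p) auto

lemma merge_same: "i + j > 0 \<Longrightarrow>
    shape_sum (s1 @ (p, i) # (p, j) # s2) = merge_coeff i j * shape_sum (s1 @ (p, i + j) # s2)"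
  by (simp add: shape_sum_merge)

lemma merge_opposite: "i > 0 \<Longrightarrow> j > 0 \<Longrightarrow>
    shape_sum (s1 @ (p, i) # (\<not> p, j) # s2) =
      merge_coeff (i - 1) j * shape_sum (s1 @ (p, i + j) # s2) +
      (- 1) ^ i * X ^ ((i + 1) div 2) * merge_coeff i (j - 1) * shape_sum (s1 @ (\<not> p, i + j) # s2)"
  by (simp add: shape_sum_merge)

text \<open>For odd \<open>i\<close> and even \<open>j\<close> the blocks start with opposite
  parities, but the second term of \<open>merge_opposite\<close> then carries a
  \<open>merge_coeff\<close> with two odd arguments, which is 0.\<close>

lemma merge_contiguous:
  assumes "i > 0" "j > 0" "even i \<or> even j"
  shows "shape_sum (s1 @ (p, i) # (p = even i, j) # s2) =
    qbinom (i div 2) (j div 2) * shape_sum (s1 @ (p, i + j) # s2)"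
proof (cases "even i")
  case True
  then show ?thesis using assms by (simp add: merge_same merge_coeff_def)
next
  case False
  then have "(p = even i) = (\<not> p)" "(i - 1) div 2 = i div 2" "odd (j - 1)"
    using assms by (auto elim!: oddE)
  with False show ?thesis
    using assms merge_opposite[of i j s1 p s2] by (simp add: merge_coeff_def)
qed

text \<open>Here both patterns survive, so a block appears whose recorded parities disagree with its
  positions.\<close>

lemma merge_odd_odd:
  assumes "odd i" "odd j"
  shows "shape_sum (s1 @ (p, i) # (\<not> p, j) # s2) = qbinom (i div 2) (j div 2) *
    (shape_sum (s1 @ (p, i + j) # s2) - X ^ ((i + j) div 2) * shape_sum (s1 @ (\<not> p, i + j) # s2))"
proof -
  have "(i + j) div 2 = (i + 1) div 2 + j div 2" "(j - 1) div 2 = j div 2" "(i - 1) div 2 = i div 2"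
    using assms by presburger+
  moreover have "i > 0" "j > 0" using assms by (auto intro: Nat.gr0I)
  ultimately show ?thesis
    using assms by (subst merge_opposite) (auto simp: merge_coeff_def power_add algebra_simps)
qed

text \<open>Induction on the number of blocks: each step merges blocks near the front at the cost of
  q-binomial coefficients and possibly a factor \<open>1 - X ^ k\<close>, until one block is left.
  Division by 2 removes the factor of index 1 from \<open>sign_coeff\<close>.\<close>

lemma cyclotomic_ratio_shape_sum:
  assumes "bs \<noteq> []" "\<forall>b\<in>set bs. b > 0"
  shows "cyclotomic_ratio (shape_sum (contiguous p bs) / 2)"
  using assms
proof (induction "length bs" arbitrary: bs p rule: less_induct)
  case less
  have single: "cyclotomic_ratio (shape_sum [(s, n)] / 2)" if "n > 0" for s n
    using that sign_coeff_split[of 1 n] cyclotomic_ratio_sign_factors[of 1 n] two_neq_zero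
    by (simp add: shape_sum_single sign_coeff_1)
  have scale: "cyclotomic_ratio (c * y / 2)" if "cyclotomic_ratio c" "cyclotomic_ratio (y / 2)" for c y
    using cyclotomic_ratio_mult[OF that] by simp
  show ?case
  proof (cases bs)
    case Nil
    with less.prems show ?thesis by simp
  next
    case bs1: (Cons b1 bs1)
    show ?thesis
    proof (cases bs1)
      case Nil
      with bs1 less.prems show ?thesis by (simp add: single)
    next
      case bs2: (Cons b2 bs2)
      have pos: "b1 > 0" "b2 > 0" using bs1 bs2 less.prems by auto
      show ?thesis
      proof (cases "even b1 \<or> even b2")
        case True
        have "((p = even b1) = even b2) = (p = even (b1 + b2))" using True by auto
        then have "shape_sum (contiguous p bs) =
            qbinom (b1 div 2) (b2 div 2) * shape_sum (contiguous p ((b1 + b2) # bs2))"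
          using merge_contiguous[OF pos True, of "[]" p] bs1 bs2 by simp
        moreover have "cyclotomic_ratio (shape_sum (contiguous p ((b1 + b2) # bs2)) / 2)"
          by (rule less.hyps) (use bs1 bs2 less.prems in auto)
        ultimately show ?thesis by (simp only: scale cyclotomic_ratio_qbinom)
      next
        case odd: False
        then have b12: "(p = even b1) = (\<not> p)" "((\<not> p) = even b2) = p" by auto
        show ?thesis
        proof (cases bs2)
          case Nil
          \<comment> \<open>Two odd blocks and nothing else: both patterns lead to a single block,
            whose sum does not depend on its first parity.\<close>
          have eq: "shape_sum (contiguous p bs) = qbinom (b1 div 2) (b2 div 2) *
              (1 - X ^ ((b1 + b2) div 2)) * sign_coeff (b1 + b2)"
            using merge_odd_odd[of b1 b2 "[]" p "[]"] odd pos bs1 bs2 Nil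
            by (simp add: shape_sum_single b12 algebra_simps)
          have "(b1 + b2) div 2 > 0" using pos by linarith
          then have "cyclotomic_ratio (qbinom (b1 div 2) (b2 div 2) * (1 - X ^ ((b1 + b2) div 2)))"
            by (intro cyclotomic_ratio_mult cyclotomic_ratio_qbinom cyclotomic_ratio_one_minus_power)
          moreover have "cyclotomic_ratio (sign_coeff (b1 + b2) / 2)"
            using single[of "b1 + b2" p] pos by (simp add: shape_sum_single)
          ultimately show ?thesis unfolding eq by (rule scale)
        next
          case bs3: (Cons b3 bs3)
          have pos3: "b3 > 0" using bs1 bs2 bs3 less.prems by auto
          have ctg: "contiguous p bs = (p, b1) # (\<not> p, b2) # (p, b3) # contiguous (p = even b3) bs3"
            using bs1 bs2 bs3 by (simp add: b12)
          show ?thesis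
          proof (cases "even b3")
            case True
            have "((\<not> p) = even b2) = p" "(p = even b3) = p"
              "contiguous p (b1 # (b2 + b3) # bs3) = (p, b1) # (\<not> p, b2 + b3) # contiguous p bs3"
              using True odd by (auto simp: b12)
            then have "shape_sum (contiguous p bs) = qbinom (b2 div 2) (b3 div 2) *
                shape_sum (contiguous p (b1 # (b2 + b3) # bs3))"
              using merge_contiguous[of b2 b3 "[(p, b1)]" "\<not> p" "contiguous p bs3"] True pos pos3
              by (simp add: ctg del: contiguous.simps)
            moreover have "cyclotomic_ratio (shape_sum (contiguous p (b1 # (b2 + b3) # bs3)) / 2)"
              by (rule less.hyps) (use bs1 bs2 bs3 less.prems in auto)
            ultimately show ?thesis by (simp only: scale cyclotomic_ratio_qbinom)
          next
            case False
            \<comment> \<open>Three odd blocks in a row. The last two merge into an even block of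
              size \<open>k\<close> in both patterns. Each of these merges with the odd block
              \<open>b1\<close> into the same shape, the second one with an extra
              \<open>X ^ (k div 2)\<close>, and the difference yields the factor
              \<open>1 - X ^ k\<close>.\<close>
            define k where "k = b2 + b3"
            have k: "even k" "k > 0" using False odd pos3 by (auto simp: k_def)
            define rest where "rest = contiguous (\<not> p) bs3"
            have ctg': "contiguous p bs = (p, b1) # (\<not> p, b2) # (p, b3) # rest"
              "contiguous p ((b1 + k) # bs3) = (p, b1 + k) # rest"
              using False odd k by (simp_all add: ctg rest_def)
            have "shape_sum (contiguous p bs) = qbinom (b2 div 2) (b3 div 2) *
                (shape_sum ((p, b1) # (\<not> p, k) # rest) -
                 X ^ (k div 2) * shape_sum ((p, b1) # (p, k) # rest))"
              using merge_odd_odd[of b2 b3 "[(p, b1)]" "\<not> p" rest] False odd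
              by (simp add: ctg' k_def)
            also have "shape_sum ((p, b1) # (\<not> p, k) # rest) =
                qbinom (b1 div 2) (k div 2) * shape_sum ((p, b1 + k) # rest)"
              using merge_contiguous[of b1 k "[]" p rest] pos k odd by (simp add: b12)
            also have "shape_sum ((p, b1) # (p, k) # rest) =
                X ^ (k div 2) * qbinom (b1 div 2) (k div 2) * shape_sum ((p, b1 + k) # rest)"
              using merge_same[of b1 k "[]" p rest] pos k odd by (simp add: merge_coeff_def)
            finally have "shape_sum (contiguous p bs) = qbinom (b2 div 2) (b3 div 2) *
                (qbinom (b1 div 2) (k div 2) * shape_sum ((p, b1 + k) # rest) - X ^ (k div 2) *
                  (X ^ (k div 2) * qbinom (b1 div 2) (k div 2) * shape_sum ((p, b1 + k) # rest)))" .
            moreover have "X ^ k = X ^ (k div 2) * X ^ (k div 2)"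
              using k(1) by (metis dvd_div_mult_self mult_2_right power_add)
            ultimately have eq: "shape_sum (contiguous p bs) = qbinom (b2 div 2) (b3 div 2) *
                qbinom (b1 div 2) (k div 2) * (1 - X ^ k) * shape_sum (contiguous p ((b1 + k) # bs3))"
              unfolding ctg' by (simp add: algebra_simps)
            have "cyclotomic_ratio (shape_sum (contiguous p ((b1 + k) # bs3)) / 2)"
              by (rule less.hyps) (use bs1 bs2 bs3 less.prems in auto)
            then show ?thesis
              unfolding eq using k
              by (intro scale cyclotomic_ratio_mult cyclotomic_ratio_qbinom cyclotomic_ratio_one_minus_power)
          qed
        qed
      qed
    qed
  qed
qed

section \<open>Cyclotomic polynomials\<close>

abbreviation complex_poly :: "int poly \<Rightarrow> complex poly" where
  "complex_poly \<equiv> map_poly of_int"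

lemma complex_poly_add: "complex_poly (p + q) = complex_poly p + complex_poly q"
  by (rule poly_eqI) (simp add: coeff_map_poly)

lemma complex_poly_diff: "complex_poly (p - q) = complex_poly p - complex_poly q"
  by (rule poly_eqI) (simp add: coeff_map_poly)

lemma complex_poly_uminus: "complex_poly (- p) = - complex_poly p"
  by (rule poly_eqI) (simp add: coeff_map_poly)

lemma complex_poly_mult: "complex_poly (p * q) = complex_poly p * complex_poly q"
  by (rule poly_eqI) (simp add: coeff_map_poly coeff_mult)

lemma complex_poly_monom: "complex_poly (monom c k) = monom (of_int c) k"
  by (simp add: map_poly_monom)

lemma complex_poly_1: "complex_poly 1 = 1"
  by (simp add: map_poly_1)

lemma complex_poly_prod_list: "complex_poly (prod_list ps) = prod_list (map complex_poly ps)"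
  by (induction ps) (simp_all add: complex_poly_1 complex_poly_mult)

lemma poly_prod_list_eq_0_iff:
  fixes ps :: "complex poly list"
  shows "poly (prod_list ps) z = 0 \<longleftrightarrow> (\<exists>p\<in>set ps. poly p z = 0)"
  by (induction ps) auto

lemma finite_primitive_roots: "k > 0 \<Longrightarrow> finite (primitive_roots k)"
  by (rule finite_subset[OF _ finite_roots_unity[of k]]) (auto simp: primitive_roots_def)

lemma poly_cyclotomic_eq_0_iff:
  "k > 0 \<Longrightarrow> poly (cyclotomic k) z = 0 \<longleftrightarrow> z \<in> primitive_roots k"
  by (auto simp: cyclotomic_def poly_prod finite_primitive_roots)

lemma cyclotomic_nonzero: "cyclotomic k \<noteq> 0"
  by (cases "finite (primitive_roots k)") (auto simp: cyclotomic_def)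

lemma primitive_roots_inject:
  assumes "z \<in> primitive_roots j" "z \<in> primitive_roots k" "j > 0" "k > 0"
  shows "j = k"
  using assms unfolding primitive_roots_def by (metis (mono_tags, lifting) linorder_cases mem_Collect_eq)

text \<open>The number \<open>cis (2 * pi / k)\<close> is a primitive root, because its powers with
  exponents below \<open>k\<close> are distinct.\<close>

lemma primitive_roots_nonempty:
  assumes "k > 0"
  shows "primitive_roots k \<noteq> {}"
proof -
  let ?f = "\<lambda>j. cis (2 * pi * real j / real k)"
  have bij: "bij_betw ?f {..<k} {z. z ^ k = 1}" using assms by (rule bij_betw_roots_unity)
  have pow: "cis (2 * pi / real k) ^ j = ?f j" for j
    by (simp add: DeMoivre mult_ac)
  have "?f k = 1" using assms by simp
  moreover have "?f j \<noteq> 1" if "0 < j" "j < k" for j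
  proof
    assume "?f j = 1"
    then have "?f j = ?f 0" by simp
    moreover have "inj_on ?f {..<k}" using bij by (simp add: bij_betw_def)
    ultimately have "j = 0" using that by (elim inj_onD) auto
    with that show False by simp
  qed
  ultimately have "cis (2 * pi / real k) \<in> primitive_roots k"
    by (simp add: primitive_roots_def pow)
  then show ?thesis by blast
qed

lemma roots_unity_Union_primitive_roots:
  assumes "a > 0"
  shows "{z. z ^ a = 1} = (\<Union>d\<in>{d. d dvd a}. primitive_roots d)"
proof (intro equalityI subsetI)
  fix z :: complex assume z: "z \<in> {z. z ^ a = 1}"
  \<comment> \<open>The multiplicative order of \<open>z\<close>.\<close>
  define d where "d = (LEAST d. d > 0 \<and> z ^ d = 1)"
  have d: "d > 0 \<and> z ^ d = 1"
    unfolding d_def by (rule LeastI[of _ a]) (use assms z in simp)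
  have least: "d \<le> j" if "j > 0" "z ^ j = 1" for j
    unfolding d_def using that by (intro Least_le) simp
  have "z ^ a = (z ^ d) ^ (a div d) * z ^ (a mod d)"
    by (metis mult_div_mod_eq power_add power_mult)
  then have "z ^ (a mod d) = 1" using z d by simp
  then have "a mod d = 0" using least[of "a mod d"] d by (meson mod_less_divisor gr0I leD)
  then have "d dvd a" by auto
  moreover have "z ^ j \<noteq> 1" if "0 < j" "j < d" for j using least[of j] that by auto
  then have "z \<in> primitive_roots d" using d by (simp add: primitive_roots_def)
  ultimately show "z \<in> (\<Union>d\<in>{d. d dvd a}. primitive_roots d)" by blast
qed (auto simp: primitive_roots_def power_mult elim!: dvdE)

text \<open>The polynomial has simple roots, and grouping them by their orders, the divisors of
  \<open>a\<close>, gives the cyclotomic polynomials.\<close>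

lemma root_unity_poly_cyclotomic:
  assumes "a > 0"
  shows "\<exists>ks. (\<forall>k\<in>set ks. k > 0) \<and> monom 1 a - 1 = prod_list (map cyclotomic ks)"
proof -
  let ?p = "monom 1 a - 1 :: complex poly"
  have fin: "finite {d. d dvd a}" using assms by simp
  have pos: "d > 0" if "d \<in> {d. d dvd a}" for d using that assms by (auto intro: Nat.gr0I)
  have root: "poly ?p z = 0 \<longleftrightarrow> z ^ a = 1" for z by (simp add: poly_monom)
  have "rsquarefree ?p"
    unfolding rsquarefree_roots
    using assms by (auto simp: root pderiv_diff pderiv_monom poly_monom power_0_left)
  moreover have "degree ?p = a" "lead_coeff ?p = 1"
  proof -
    have "degree ?p = degree (monom (1::complex) a)"
      using assms degree_add_eq_left[of "- 1" "monom (1::complex) a"] by (simp add: degree_monom_eq)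
    then show "degree ?p = a" by (simp add: degree_monom_eq)
    then show "lead_coeff ?p = 1" using assms by simp
  qed
  ultimately have "?p = (\<Prod>z | z ^ a = 1. [:- z, 1:])"
    using complex_poly_decompose_rsquarefree[of ?p] by (simp add: poly_monom)
  also have "\<dots> = (\<Prod>d | d dvd a. cyclotomic d)"
    unfolding roots_unity_Union_primitive_roots[OF assms] cyclotomic_def
  proof (rule prod.UNION_disjoint)
    show "\<forall>d\<in>{d. d dvd a}. finite (primitive_roots d)" using pos finite_primitive_roots by blast
    show "\<forall>d\<in>{d. d dvd a}. \<forall>e\<in>{d. d dvd a}. d \<noteq> e \<longrightarrow> primitive_roots d \<inter> primitive_roots e = {}"
      using pos primitive_roots_inject by blast
  qed (rule fin)
  also have "\<dots> = prod_list (map cyclotomic (sorted_list_of_set {d. d dvd a}))"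
    using fin by (subst prod.distinct_set_conv_list[symmetric]) auto
  finally show ?thesis using fin pos by (metis set_sorted_list_of_set)
qed

lemma prod_root_unity_polys_cyclotomic:
  assumes "\<forall>a\<in>set as. a > 0"
  shows "\<exists>ks. (\<forall>k\<in>set ks. k > 0) \<and>
    (\<Prod>a\<leftarrow>as. monom 1 a - 1) = prod_list (map cyclotomic ks)"
  using assms
proof (induction as)
  case (Cons a as)
  then obtain ks ks' where "\<forall>k\<in>set ks. k > 0" "(\<Prod>a\<leftarrow>as. monom 1 a - 1) = prod_list (map cyclotomic ks)"
    "\<forall>k\<in>set ks'. k > 0" "monom 1 a - 1 = prod_list (map cyclotomic ks')"
    using root_unity_poly_cyclotomic[of a] by auto
  then show ?case by (intro exI[of _ "ks' @ ks"]) auto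
qed (auto intro: exI[of _ "[]"])

text \<open>A primitive \<open>b\<close>-th root of unity is a root of no other cyclotomic polynomial, so the
  factors on the left can be cancelled one at a time.\<close>

lemma cyclotomic_cancel:
  assumes "p * prod_list (map cyclotomic bs) = prod_list (map cyclotomic as)"
    "\<forall>k\<in>set as \<union> set bs. k > 0"
  shows "\<exists>ks. (\<forall>k\<in>set ks. k > 0) \<and> p = prod_list (map cyclotomic ks)"
  using assms
proof (induction bs arbitrary: as)
  case Nil
  then show ?case by auto
next
  case (Cons b bs)
  obtain z where z: "z \<in> primitive_roots b" using primitive_roots_nonempty[of b] Cons.prems by auto
  then have "poly (cyclotomic b) z = 0"
    using poly_cyclotomic_eq_0_iff[of b] Cons.prems(2) by simp
  then have "poly (p * prod_list (map cyclotomic (b # bs))) z = 0"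
    by (simp only: list.map prod_list.Cons poly_mult mult_zero_left mult_zero_right)
  then obtain k where "k \<in> set as" "poly (cyclotomic k) z = 0"
    unfolding Cons.prems(1) poly_prod_list_eq_0_iff by auto
  then have "b \<in> set as"
    using poly_cyclotomic_eq_0_iff[of k z] primitive_roots_inject[OF _ z] Cons.prems(2) by auto
  then obtain xs ys where as: "as = xs @ b # ys" by (meson split_list)
  have "cyclotomic b * (p * prod_list (map cyclotomic bs)) =
      cyclotomic b * prod_list (map cyclotomic (xs @ ys))"
    using Cons.prems(1) by (simp add: as mult_ac)
  then have "p * prod_list (map cyclotomic bs) = prod_list (map cyclotomic (xs @ ys))"
    using cyclotomic_nonzero[of b] by simp
  then show ?case using Cons.IH[of "xs @ ys"] Cons.prems(2) as by auto
qed

lemma to_fract_prod_list: "to_fract (prod_list ps) = prod_list (map to_fract ps)"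
  by (induction ps) auto

lemma prod_X_power: "(\<Prod>a\<leftarrow>as. X ^ a - 1) = to_fract (\<Prod>a\<leftarrow>as. monom 1 a - 1)"
  by (simp add: to_fract_prod_list X_power comp_def)

lemma complex_poly_prod_root_unity:
  "complex_poly (\<Prod>a\<leftarrow>as. monom 1 a - 1) = (\<Prod>a\<leftarrow>as. monom 1 a - 1)"
  by (simp add: complex_poly_prod_list complex_poly_diff complex_poly_monom complex_poly_1 comp_def)

text \<open>Clearing denominators gives an identity of integer polynomials. Over the complex numbers
  both products split into cyclotomic polynomials, and those of the denominator cancel.\<close>

lemma signed_cyclotomic_product_if_ratio:
  assumes "cyclotomic_ratio (to_fract p)"
  shows "signed_cyclotomic_product p"
proof -
  obtain as bs where pos: "\<forall>k\<in>set as \<union> set bs. k > 0" and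
    "to_fract p * (\<Prod>b\<leftarrow>bs. X ^ b - 1) = (\<Prod>a\<leftarrow>as. X ^ a - 1) \<or>
      to_fract p * (\<Prod>b\<leftarrow>bs. X ^ b - 1) = - (\<Prod>a\<leftarrow>as. X ^ a - 1)"
    using assms unfolding cyclotomic_ratio_def by blast
  then have "p * (\<Prod>b\<leftarrow>bs. monom 1 b - 1) = (\<Prod>a\<leftarrow>as. monom 1 a - 1) \<or>
      p * (\<Prod>b\<leftarrow>bs. monom 1 b - 1) = - (\<Prod>a\<leftarrow>as. monom 1 a - 1)"
    unfolding prod_X_power by (simp only: to_fract_mult[symmetric] to_fract_uminus[symmetric] to_fract_eq_iff)
  then have "complex_poly (p * (\<Prod>b\<leftarrow>bs. monom 1 b - 1)) = complex_poly (\<Prod>a\<leftarrow>as. monom 1 a - 1) \<or>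
      complex_poly (p * (\<Prod>b\<leftarrow>bs. monom 1 b - 1)) = complex_poly (- (\<Prod>a\<leftarrow>as. monom 1 a - 1))"
    by (elim disjE) (simp_all only: simp_thms)
  then have "complex_poly p * (\<Prod>b\<leftarrow>bs. monom 1 b - 1) = (\<Prod>a\<leftarrow>as. monom 1 a - 1) \<or>
      (- complex_poly p) * (\<Prod>b\<leftarrow>bs. monom 1 b - 1) = (\<Prod>a\<leftarrow>as. monom 1 a - 1)"
    unfolding complex_poly_mult complex_poly_uminus complex_poly_prod_root_unity mult_minus_left
    by (elim disjE) simp_all
  moreover obtain ks ks' where ks: "\<forall>k\<in>set ks. k > 0" "\<forall>k\<in>set ks'. k > 0"
    "(\<Prod>a\<leftarrow>as. monom 1 a - 1) = prod_list (map cyclotomic ks)"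
    "(\<Prod>a\<leftarrow>bs. monom 1 a - 1) = prod_list (map cyclotomic ks')"
    using prod_root_unity_polys_cyclotomic[of as] prod_root_unity_polys_cyclotomic[of bs] pos by auto
  ultimately obtain q where q: "q = complex_poly p \<or> q = - complex_poly p"
    "q * prod_list (map cyclotomic ks') = prod_list (map cyclotomic ks)" by metis
  obtain cs where "\<forall>k\<in>set cs. k > 0" "q = prod_list (map cyclotomic cs)"
    using cyclotomic_cancel[OF q(2)] ks by auto
  then show ?thesis using q(1) unfolding signed_cyclotomic_product_def by (metis minus_minus)
qed

lemma norm_eq_1_if_power_eq_1:
  fixes z :: complex
  assumes "z ^ k = 1" "k > 0"
  shows "norm z = 1"
  using assms by (metis norm_ge_zero norm_one norm_power power_eq_imp_eq_base power_one zero_le_one)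

text \<open>If all roots lay on the unit circle, equality in the triangle inequality would force
  \<open>z ^ a = 1\<close> and \<open>z ^ m = - 1\<close> at each of them. The roots would be
  simple, so the degree, being their number, would be at most \<open>a\<close> and at most
  \<open>m\<close>. This gives \<open>a = m\<close>, and then \<open>1 = - 1\<close>.\<close>

lemma trinomial_root_off_circle:
  fixes a m :: nat
  assumes "a > 0" "a < 2 * m"
  shows "\<exists>z::complex. 1 + z ^ a + 2 * z ^ m = 0 \<and> norm z \<noteq> 1"
proof (rule ccontr)
  assume "\<not> ?thesis"
  then have circle: "norm z = 1" if "1 + z ^ a + 2 * z ^ m = 0" for z :: complex using that by blast
  define r :: "complex poly" where "r = 1 + monom 1 a + monom 2 m"
  have poly_r: "poly r z = 1 + z ^ a + 2 * z ^ m" for z by (simp add: r_def poly_monom)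
  have root: "z ^ a = 1 \<and> z ^ m = - 1" if "poly r z = 0" for z
  proof -
    have eq: "1 + z ^ a = - 2 * z ^ m" using that by (simp add: poly_r eq_neg_iff_add_eq_0)
    have n1: "norm z = 1" using that circle by (simp add: poly_r)
    define w where "w = z ^ a"
    have "norm (1 + w) = 2" "norm w = 1"
      unfolding w_def eq using n1 by (simp_all add: norm_mult norm_power)
    then have "(1 + Re w)\<^sup>2 + (Im w)\<^sup>2 = 4" "(Re w)\<^sup>2 + (Im w)\<^sup>2 = 1"
      using cmod_power2[of "1 + w"] cmod_power2[of w] by simp_all
    then have "Re w = 1" by (simp add: power2_eq_square algebra_simps)
    moreover from this have "Im w = 0" using \<open>(Re w)\<^sup>2 + (Im w)\<^sup>2 = 1\<close> by simp
    ultimately have "w = 1" by (simp add: complex_eq_iff)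
    then have "2 * (z ^ m + 1) = 0" using that by (simp add: poly_r w_def algebra_simps)
    then have "z ^ m + 1 = 0" by (simp only: mult_eq_0_iff) simp
    with \<open>w = 1\<close> show ?thesis by (simp add: w_def eq_neg_iff_add_eq_0)
  qed
  have "rsquarefree r"
    unfolding rsquarefree_roots
  proof (intro allI notI, elim conjE)
    fix z assume z: "poly r z = 0" and d: "poly (pderiv r) z = 0"
    \<comment> \<open>At a root this value is \<open>a - 2 * m\<close>, which is nonzero by
      hypothesis, so every root is simple.\<close>
    have "z * poly (pderiv r) z = of_nat a * z ^ a + 2 * of_nat m * z ^ m"
      using assms by (cases a; cases m) (auto simp: r_def pderiv_add pderiv_monom poly_monom algebra_simps)
    then have "of_nat a = (of_nat (2 * m) :: complex)" using d root[OF z] by simp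
    then show False using assms(2) by (simp only: of_nat_eq_iff)
  qed
  then have decomp: "smult (lead_coeff r) (\<Prod>z | poly r z = 0. [:- z, 1:]) = r"
    by (rule complex_poly_decompose_rsquarefree)
  have "r \<noteq> 0" using poly_r[of 0] assms by (auto simp: power_0_left)
  have deg: "degree r = card {z. poly r z = 0}"
  proof -
    have "degree r = degree (\<Prod>z | poly r z = 0. [:- z, 1:])"
      using \<open>r \<noteq> 0\<close> by (subst decomp[symmetric]) simp
    also have "\<dots> = card {z. poly r z = 0}"
      by (subst degree_prod_eq_sum_degree) auto
    finally show ?thesis .
  qed
  have m: "m > 0" using assms by simp
  \<comment> \<open>All coefficients are positive, so nothing cancels even if \<open>a = m\<close>,
    where the coefficient is 3.\<close>
  have coeffs: "coeff r a \<noteq> 0" "coeff r m \<noteq> 0"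
    using assms m by (auto simp: r_def)
  have "card {z. poly r z = 0} \<le> card {z::complex. z ^ a = 1}"
    by (intro card_mono finite_roots_unity) (use root assms in auto)
  then have "degree r \<le> a" using deg card_roots_unity_eq[of a] assms by simp
  moreover have "card {z. poly r z = 0} \<le> card {z::complex. z ^ m = - 1}"
    by (intro card_mono) (use root m in \<open>auto intro: finite_nth_roots\<close>)
  then have "degree r \<le> m" using deg card_nth_roots[of "- 1" m] m by simp
  moreover have "a \<le> degree r" "m \<le> degree r" using coeffs by (auto intro: le_degree)
  ultimately have "a = m" by simp
  have "{z. poly r z = 0} \<noteq> {}"
    using deg \<open>a \<le> degree r\<close> assms(1) by (metis card.empty le_zero_eq less_numeral_extra(3))
  then obtain z where "poly r z = 0" by blast
  then have "z ^ m = 1" "z ^ m = - 1" using root[of z] unfolding \<open>a = m\<close> by blast+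
  then show False by simp
qed

text \<open>Roots of cyclotomic polynomials and of \<open>x ^ k - 1\<close> lie on the unit circle,
  whereas the trinomial has a root elsewhere, at which the whole left side must vanish.\<close>

lemma not_signed_cyclotomic_product:
  assumes "to_fract p = c * (1 + X ^ a + 2 * X ^ m)" "cyclotomic_ratio c" "a > 0" "a < 2 * m"
  shows "\<not> signed_cyclotomic_product p"
proof
  assume "signed_cyclotomic_product p"
  then obtain ks where ks: "\<forall>k\<in>set ks. k > 0" "complex_poly p = prod_list (map cyclotomic ks) \<or>
    complex_poly p = - prod_list (map cyclotomic ks)"
    unfolding signed_cyclotomic_product_def by blast
  obtain as bs where pos: "\<forall>k\<in>set as \<union> set bs. k > 0" and
    "c * (\<Prod>b\<leftarrow>bs. X ^ b - 1) = (\<Prod>a\<leftarrow>as. X ^ a - 1) \<or>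
      c * (\<Prod>b\<leftarrow>bs. X ^ b - 1) = - (\<Prod>a\<leftarrow>as. X ^ a - 1)"
    using assms(2) unfolding cyclotomic_ratio_def by blast
  then have "to_fract p * (\<Prod>b\<leftarrow>bs. X ^ b - 1) = (\<Prod>a\<leftarrow>as. X ^ a - 1) * (1 + X ^ a + 2 * X ^ m) \<or>
      to_fract p * (\<Prod>b\<leftarrow>bs. X ^ b - 1) = (- (\<Prod>a\<leftarrow>as. X ^ a - 1)) * (1 + X ^ a + 2 * X ^ m)"
  proof -
    have swap: "(u * v) * w = (u * w) * v" for u v w :: "int poly fract" by (simp only: mult_ac)
    assume "c * (\<Prod>b\<leftarrow>bs. X ^ b - 1) = (\<Prod>a\<leftarrow>as. X ^ a - 1) \<or>
      c * (\<Prod>b\<leftarrow>bs. X ^ b - 1) = - (\<Prod>a\<leftarrow>as. X ^ a - 1)"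
    then show ?thesis
      unfolding assms(1) swap[of c "1 + X ^ a + 2 * X ^ m"] by (elim disjE) (simp_all only: simp_thms)
  qed
  moreover have "1 + X ^ a + 2 * X ^ m = to_fract (1 + monom 1 a + (monom 1 m + monom 1 m))"
    by (simp only: X_power to_fract_add to_fract_1 mult_2)
  ultimately have "p * (\<Prod>b\<leftarrow>bs. monom 1 b - 1) =
      (\<Prod>a\<leftarrow>as. monom 1 a - 1) * (1 + monom 1 a + (monom 1 m + monom 1 m)) \<or>
    p * (\<Prod>b\<leftarrow>bs. monom 1 b - 1) =
      (- (\<Prod>a\<leftarrow>as. monom 1 a - 1)) * (1 + monom 1 a + (monom 1 m + monom 1 m))"
    unfolding prod_X_power by (simp only: to_fract_mult[symmetric] to_fract_uminus[symmetric] to_fract_eq_iff)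
  then have "complex_poly (p * (\<Prod>b\<leftarrow>bs. monom 1 b - 1)) =
      complex_poly ((\<Prod>a\<leftarrow>as. monom 1 a - 1) * (1 + monom 1 a + (monom 1 m + monom 1 m))) \<or>
    complex_poly (p * (\<Prod>b\<leftarrow>bs. monom 1 b - 1)) =
      complex_poly ((- (\<Prod>a\<leftarrow>as. monom 1 a - 1)) * (1 + monom 1 a + (monom 1 m + monom 1 m)))"
    by (elim disjE) (simp_all only: simp_thms)
  then have eq: "complex_poly p * (\<Prod>b\<leftarrow>bs. monom 1 b - 1) =
      (\<Prod>a\<leftarrow>as. monom 1 a - 1) * (1 + monom 1 a + (monom 1 m + monom 1 m)) \<or>
    complex_poly p * (\<Prod>b\<leftarrow>bs. monom 1 b - 1) =
      (- (\<Prod>a\<leftarrow>as. monom 1 a - 1)) * (1 + monom 1 a + (monom 1 m + monom 1 m))"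
    by (simp only: complex_poly_mult complex_poly_uminus complex_poly_prod_root_unity
        complex_poly_add complex_poly_monom complex_poly_1 of_int_1)
  obtain z :: complex where z: "1 + z ^ a + 2 * z ^ m = 0" "norm z \<noteq> 1"
    using trinomial_root_off_circle assms(3,4) by blast
  then have "poly (1 + monom 1 a + (monom 1 m + monom 1 m)) z = 0"
    by (simp only: poly_monom poly_add poly_1 mult_1 mult_2)
  with eq have "poly (complex_poly p * (\<Prod>b\<leftarrow>bs. monom 1 b - 1)) z = 0" by (elim disjE) simp_all
  then have "poly (prod_list (map cyclotomic ks)) z = 0 \<or> poly (\<Prod>b\<leftarrow>bs. monom 1 b - 1) z = 0"
    using ks(2) by auto
  then show False
  proof
    assume "poly (prod_list (map cyclotomic ks)) z = 0"
    then obtain k where "k \<in> set ks" "poly (cyclotomic k) z = 0"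
      by (auto simp: poly_prod_list_eq_0_iff)
    then have "z ^ k = 1" "k > 0" using poly_cyclotomic_eq_0_iff[of k z] ks(1) by (auto simp: primitive_roots_def)
    then show False using z(2) norm_eq_1_if_power_eq_1 by blast
  next
    assume "poly (\<Prod>b\<leftarrow>bs. monom 1 b - 1) z = 0"
    then obtain b where "b \<in> set bs" "z ^ b = 1"
      by (auto simp: poly_prod_list_eq_0_iff poly_monom)
    then show False using z(2) norm_eq_1_if_power_eq_1 pos by blast
  qed
qed

section \<open>Sums with a positive first block\<close>

text \<open>A block of odd length starts and ends with the same parity, so the two patterns in
  \<open>shape_sum_positive_sum\<close> coincide.\<close>

lemma shape_sum_positive_sum_odd:
  assumes "odd a"
  shows "shape_sum ((p, a) # sh) = sign_coeff a * positive_sum p a sh"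
proof -
  obtain k where "a = Suc k" "even k" using assms by (cases a) auto
  then show ?thesis by (simp add: shape_sum_positive_sum sign_coeff_Suc algebra_simps)
qed

lemma shape_sum_positive_sum_even:
  assumes "even a" "a > 0"
  shows "shape_sum ((p, a) # sh) =
    sign_coeff (a - 1) * (positive_sum p a sh - X ^ (a div 2) * positive_sum (\<not> p) a sh)"
proof -
  obtain k where "a = Suc k" "odd k" using assms by (cases a) auto
  then show ?thesis using shape_sum_positive_sum[of p k sh] by simp
qed

text \<open>The preceding equation for \<open>p\<close> and for \<open>\<not> p\<close> is a linear
  system in the two positive sums; the one for \<open>\<not> p\<close> is eliminated.\<close>

lemma positive_sum_even:
  assumes "even a" "a > 0"
  shows "sign_coeff (a - 1) * (1 - X ^ a) * positive_sum p a sh =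
    shape_sum ((p, a) # sh) + X ^ (a div 2) * shape_sum ((\<not> p, a) # sh)"
proof -
  have "X ^ a = X ^ (a div 2) * X ^ (a div 2)"
    using assms(1) by (metis dvd_div_mult_self mult_2_right power_add)
  then show ?thesis by (simp add: shape_sum_positive_sum_even[OF assms] algebra_simps)
qed

lemma sign_coeff_nonzero: "sign_coeff a \<noteq> 0"
proof -
  have "1 + (- 1) ^ (i - 1) * X ^ (i div 2) \<noteq> 0" if "i \<ge> 1" for i
  proof (cases "i = 1")
    case False
    with that have "i div 2 > 0" by linarith
    then have "cyclotomic_ratio (1 + (- 1) ^ (i - 1) * X ^ (i div 2))"
      using cyclotomic_ratio_one_minus_power cyclotomic_ratio_one_plus_power
      by (cases "even (i - 1)") auto
    then show ?thesis
      unfolding cyclotomic_ratio_def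
      using prod_X_power_nonzero by (metis Un_iff mult_zero_left neg_equal_0_iff_equal)
  qed (simp add: two_neq_zero)
  then show ?thesis by (simp add: sign_coeff_def)
qed

lemma cyclotomic_ratio_half_sign_coeff: "a > 0 \<Longrightarrow> cyclotomic_ratio (sign_coeff a / 2)"
  using cyclotomic_ratio_shape_sum[of "[a]" True] by (simp add: shape_sum_single)

text \<open>Even blocks are merged into their successors until an odd block \<open>b\<close> follows
  the first one. Merging across opposite parities then leaves only the term with factor
  \<open>X ^ (a div 2)\<close>, since \<open>merge_coeff (a - 1) b\<close> has two odd arguments,
  and its shape is the one obtained from equal parities.\<close>

lemma shape_sum_opposite_even:
  assumes "even a" "a > 0" "\<forall>b\<in>set bs. b > 0" "\<exists>b\<in>set bs. odd b"
  shows "shape_sum ((\<not> p, a) # contiguous p bs) =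
    X ^ (a div 2) * shape_sum ((p, a) # contiguous p bs)"
  using assms(3,4)
proof (induction "length bs" arbitrary: bs rule: less_induct)
  case less
  then obtain b bs' where bs: "bs = b # bs'" by (cases bs) auto
  show ?case
  proof (cases "even b")
    case True
    then obtain b2 bs2 where bs': "bs' = b2 # bs2" using less.prems bs by (cases bs') auto
    have pos: "b > 0" "b2 > 0" using bs bs' less.prems by auto
    have ctg: "contiguous p bs = (p, b) # (p = even b, b2) # contiguous (p = even b2) bs2"
      "contiguous p ((b + b2) # bs2) = (p, b + b2) # contiguous (p = even b2) bs2"
      using True by (auto simp: bs bs')
    have "shape_sum ((s, a) # contiguous p bs) =
        qbinom (b div 2) (b2 div 2) * shape_sum ((s, a) # contiguous p ((b + b2) # bs2))" for s
      using merge_contiguous[OF pos disjI1[OF True], of "[(s, a)]" p]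
      by (simp only: ctg append_Cons append_Nil)
    moreover have "shape_sum ((\<not> p, a) # contiguous p ((b + b2) # bs2)) =
        X ^ (a div 2) * shape_sum ((p, a) # contiguous p ((b + b2) # bs2))"
      by (rule less.hyps) (use True bs bs' less.prems in auto)
    ultimately show ?thesis by simp
  next
    case False
    then have b: "b > 0" "(b - 1) div 2 = b div 2" by (auto elim!: oddE)
    have "(a + 1) div 2 = a div 2" "odd (a - 1)" using assms by auto
    then show ?thesis
      using merge_same[of a b "[]" p] merge_opposite[of a b "[]" "\<not> p"] assms False b
      by (simp add: bs merge_coeff_def)
  qed
qed

text \<open>For odd \<open>a\<close> this is a plain division. For even \<open>a\<close> an odd
  block makes the flipped sum proportional to the actual one, so the linear system only contributes
  the factor \<open>1 + X ^ a\<close> over \<open>1 - X ^ a\<close>.\<close>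

lemma cyclotomic_ratio_positive_sum:
  assumes "a \<ge> 2" "bs \<noteq> []" "\<forall>b\<in>set bs. b > 0" "odd a \<or> (\<exists>b\<in>set bs. odd b)"
  shows "cyclotomic_ratio (positive_sum p a (contiguous (p = even a) bs))"
proof -
  let ?sh = "contiguous (p = even a) bs"
  have half: "cyclotomic_ratio (shape_sum ((p, a) # ?sh) / 2)"
    using cyclotomic_ratio_shape_sum[of "a # bs" p] assms by simp
  show ?thesis
  proof (cases "odd a")
    case True
    have "positive_sum p a ?sh = (shape_sum ((p, a) # ?sh) / 2) / (sign_coeff a / 2)"
      using shape_sum_positive_sum_odd[OF True] sign_coeff_nonzero[of a] two_neq_zero by simp
    moreover have "cyclotomic_ratio (sign_coeff a / 2)"
      using cyclotomic_ratio_half_sign_coeff[of a] assms(1) by simp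
    ultimately show ?thesis using half by (simp only: cyclotomic_ratio_divide)
  next
    case False
    then have a: "even a" "a > 0" "(p = even a) = p" using assms(1) by auto
    have "shape_sum ((\<not> p, a) # ?sh) = X ^ (a div 2) * shape_sum ((p, a) # ?sh)"
      unfolding a(3) using a assms by (intro shape_sum_opposite_even) auto
    moreover have "X ^ a = X ^ (a div 2) * X ^ (a div 2)"
      using a(1) by (metis dvd_div_mult_self mult_2_right power_add)
    ultimately have "sign_coeff (a - 1) * (1 - X ^ a) * positive_sum p a ?sh =
        (1 + X ^ a) * shape_sum ((p, a) # ?sh)"
      using positive_sum_even[OF a(1,2), of p ?sh] by (simp add: algebra_simps)
    moreover have "1 - X ^ a \<noteq> 0" using a by simp
    ultimately have "positive_sum p a ?sh =
      (1 + X ^ a) * (shape_sum ((p, a) # ?sh) / 2) / ((sign_coeff (a - 1) / 2) * (1 - X ^ a))"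
      using sign_coeff_nonzero[of "a - 1"] two_neq_zero by (simp add: field_simps)
    moreover have "cyclotomic_ratio (sign_coeff (a - 1) / 2)"
      using cyclotomic_ratio_half_sign_coeff[of "a - 1"] assms(1) by simp
    ultimately show ?thesis
      using half a(2)
      by (simp only: cyclotomic_ratio_divide cyclotomic_ratio_mult cyclotomic_ratio_one_plus_power
          cyclotomic_ratio_one_minus_power)
  qed
qed

text \<open>Merging from the left, the q-binomial coefficients telescope to a q-multinomial
  coefficient.\<close>

lemma shape_sum_merge_evens:
  assumes "bs \<noteq> []" "\<forall>b\<in>set bs. b > 0 \<and> even b"
  shows "shape_sum (s1 @ contiguous p bs) =
    qpoch (sum_list bs div 2) / (\<Prod>b\<leftarrow>bs. qpoch (b div 2)) * shape_sum (s1 @ [(p, sum_list bs)])"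
  using assms
proof (induction "length bs" arbitrary: bs rule: less_induct)
  case less
  show ?case
  proof (cases bs)
    case (Cons b bs')
    show ?thesis
    proof (cases bs')
      case Nil
      then show ?thesis using Cons by simp
    next
      case bs': (Cons b2 bs2)
      have b: "b > 0" "b2 > 0" "even b" "even b2" using Cons bs' less.prems by auto
      have "contiguous p bs = (p, b) # (p = even b, b2) # contiguous p bs2"
        "contiguous p ((b + b2) # bs2) = (p, b + b2) # contiguous p bs2"
        using b by (auto simp: Cons bs')
      then have "shape_sum (s1 @ contiguous p bs) =
          qbinom (b div 2) (b2 div 2) * shape_sum (s1 @ contiguous p ((b + b2) # bs2))"
        using merge_contiguous[of b b2 s1 p "contiguous p bs2"] b by simp
      also have "shape_sum (s1 @ contiguous p ((b + b2) # bs2)) =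
          qpoch (sum_list bs div 2) / (\<Prod>b\<leftarrow>(b + b2) # bs2. qpoch (b div 2)) *
          shape_sum (s1 @ [(p, sum_list bs)])"
      proof -
        have "sum_list ((b + b2) # bs2) = sum_list bs" by (simp add: Cons bs')
        then show ?thesis
          using less.hyps[of "(b + b2) # bs2"] less.prems b Cons bs' by (simp del: sum_list.Cons)
      qed
      also have "(b + b2) div 2 = b div 2 + b2 div 2" using b by auto
      ultimately show ?thesis
        by (simp add: Cons bs' qbinom_def field_simps)
    qed
  qed (use less.prems in simp)
qed

text \<open>The absorption identity for Gaussian binomial coefficients.\<close>

lemma qbinom_pred:
  assumes "g > 0"
  shows "qbinom (g - 1) h * (1 - X ^ (2 * (g + h))) = qbinom g h * (1 - X ^ (2 * g))"
proof -
  obtain g' where g: "g = Suc g'" using assms by (cases g) auto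
  have "qpoch (Suc k) = qpoch k * (1 - X ^ (2 * Suc k))" for k
    by (simp add: qpoch_Suc)
  moreover have "1 - X ^ (2 * Suc k) \<noteq> 0" for k
    by (simp del: power_Suc mult_Suc_right)
  ultimately show ?thesis
    by (simp add: g qbinom_def del: power_Suc mult_Suc_right)
qed

lemma qbinom_commute: "qbinom g h = qbinom h g"
  by (simp add: qbinom_def add.commute mult.commute)

text \<open>Both terms of \<open>merge_opposite\<close> survive. After multiplication by
  \<open>1 - X ^ (2 * (g + h))\<close> the absorption identity brings both to
  \<open>qbinom g h\<close>, and the factor \<open>1 - X ^ (g + h)\<close> can be cancelled.\<close>

lemma shape_sum_opposite_evens:
  assumes "g > 0" "h > 0"
  shows "shape_sum [(\<not> p, 2 * g), (p, 2 * h)] * (1 + X ^ (g + h)) =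
    (X ^ g + X ^ h) * qbinom g h * sign_coeff (2 * (g + h))"
proof -
  have sq: "X ^ (2 * k) = X ^ k * X ^ k" for k by (simp only: mult_2 power_add)
  have "(2 * g - 1) div 2 = g - 1" "odd (2 * g - 1)" "(2 * h - 1) div 2 = h - 1" "odd (2 * h - 1)"
    using assms by auto
  then have eq: "shape_sum [(\<not> p, 2 * g), (p, 2 * h)] =
      (X ^ h * qbinom (g - 1) h + X ^ g * qbinom g (h - 1)) * sign_coeff (2 * (g + h))"
    using merge_opposite[of "2 * g" "2 * h" "[]" "\<not> p" "[]"] assms
    by (simp add: shape_sum_single merge_coeff_def algebra_simps)
  have "(1 - X ^ (g + h)) * ((X ^ h * qbinom (g - 1) h + X ^ g * qbinom g (h - 1)) * (1 + X ^ (g + h)))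
      = X ^ h * (qbinom (g - 1) h * (1 - X ^ (2 * (g + h)))) +
        X ^ g * (qbinom g (h - 1) * (1 - X ^ (2 * (g + h))))"
    unfolding sq by (simp add: algebra_simps)
  also have "\<dots> = X ^ h * (qbinom g h * (1 - X ^ (2 * g))) + X ^ g * (qbinom g h * (1 - X ^ (2 * h)))"
    using qbinom_pred[OF assms(1)] qbinom_pred[OF assms(2)]
    by (metis add.commute qbinom_commute)
  also have "\<dots> = (1 - X ^ (g + h)) * ((X ^ g + X ^ h) * qbinom g h)"
    unfolding sq power_add by (simp add: algebra_simps)
  finally have "(X ^ h * qbinom (g - 1) h + X ^ g * qbinom g (h - 1)) * (1 + X ^ (g + h)) =
      (X ^ g + X ^ h) * qbinom g h"
    using assms by simp
  moreover have "a * b * c = a * c * b" for a b c :: "int poly fract" by (simp add: mult_ac)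
  ultimately show ?thesis unfolding eq by metis
qed

text \<open>All later blocks merge into one of size \<open>2 * h\<close>. For the two remaining
  blocks the sums with actual and with flipped first parity are both known, and
  \<open>positive_sum_even\<close> combines them; the bracket
  \<open>1 + X ^ g * (X ^ g + X ^ h) / (1 + X ^ (g + h))\<close> is the source of the
  trinomial.\<close>

lemma positive_sum_all_even:
  assumes "even a" "a > 0" "bs \<noteq> []" "\<forall>b\<in>set bs. b > 0 \<and> even b" "n = a + sum_list bs"
  shows "positive_sum p a (contiguous p bs) =
    qpoch (n div 2) / (qpoch (a div 2) * (\<Prod>b\<leftarrow>bs. qpoch (b div 2))) *
    ((1 + X ^ a + 2 * X ^ (n div 2)) / (1 + X ^ (n div 2))) *
    (\<Prod>i=a + 2..n. 1 + (- 1) ^ (i - 1) * X ^ (i div 2))"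
proof -
  define g where "g = a div 2"
  define h where "h = sum_list bs div 2"
  define M where "M = (\<Prod>b\<leftarrow>bs. qpoch (b div 2))"
  define R where "R = (\<Prod>i=a + 2..n. 1 + (- 1) ^ (i - 1) * X ^ (i div 2))"
  have "sum_list bs > 0" using assms(3,4) by (cases bs) auto
  moreover have "even (sum_list bs)" using assms(4) by (induction bs) auto
  ultimately have h: "sum_list bs = 2 * h" "h > 0" by (auto simp: h_def)
  have g: "a = 2 * g" "g > 0" using assms by (auto simp: g_def)
  have n: "n = 2 * (g + h)" "n div 2 = g + h" using assms(5) g h by auto
  have sq: "X ^ (2 * k) = X ^ k * X ^ k" for k by (simp only: mult_2 power_add)
  have nz: "1 + X ^ (g + h) \<noteq> 0" "1 - X ^ a \<noteq> 0" "M \<noteq> 0"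
  proof -
    have "(1 + X ^ (g + h)) * (1 - X ^ (g + h)) = 1 - X ^ (2 * (g + h))"
      unfolding sq by (simp add: algebra_simps)
    moreover have "1 - X ^ (2 * (g + h)) \<noteq> 0" using g by simp
    ultimately show "1 + X ^ (g + h) \<noteq> 0" by (metis mult_zero_left)
    show "1 - X ^ a \<noteq> 0" using assms by simp
    show "M \<noteq> 0" by (auto simp: M_def prod_list_zero_iff)
  qed
  have "sign_coeff n = sign_coeff (a + 1) * R"
    using sign_coeff_split[of "a + 1" n] g h n by (simp add: R_def)
  \<comment> \<open>The factors with indices \<open>a\<close> and \<open>a + 1\<close> are
    \<open>1 - X ^ g\<close> and \<open>1 + X ^ g\<close>. They absorb \<open>1 - X ^ a\<close>,
    which is why the remaining product starts at \<open>a + 2\<close>.\<close>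
  moreover have "sign_coeff (a + 1) = sign_coeff (a - 1) * (1 - X ^ g) * (1 + X ^ g)"
  proof -
    obtain k where k: "a = Suc k" "odd k" using assms(1,2) by (cases a) auto
    then show ?thesis using assms(1) by (simp add: sign_coeff_Suc g_def)
  qed
  moreover have "1 - X ^ a = (1 - X ^ g) * (1 + X ^ g)"
    unfolding g(1) sq by (simp add: algebra_simps)
  ultimately have coeff: "sign_coeff n = sign_coeff (a - 1) * (1 - X ^ a) * R"
    by (simp only: mult.assoc)
  have evens: "shape_sum ((s, a) # contiguous p bs) = qpoch h / M * shape_sum [(s, a), (p, 2 * h)]" for s
    using shape_sum_merge_evens[OF assms(3,4), of "[(s, a)]" p] by (simp add: M_def h)
  have same: "shape_sum [(p, a), (p, 2 * h)] = qbinom g h * sign_coeff n"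
    using merge_same[of a "2 * h" "[]" p "[]"] g h n by (simp add: shape_sum_single merge_coeff_def)
  have opp: "shape_sum [(\<not> p, a), (p, 2 * h)] = (X ^ g + X ^ h) * qbinom g h * sign_coeff n / (1 + X ^ (g + h))"
    using shape_sum_opposite_evens[OF g(2) h(2), of p] nz by (simp add: g(1) n(1) field_simps)
  have "sign_coeff (a - 1) * (1 - X ^ a) * positive_sum p a (contiguous p bs) =
      qpoch h / M * (qbinom g h * sign_coeff n * (1 + X ^ g * (X ^ g + X ^ h) / (1 + X ^ (g + h))))"
    unfolding positive_sum_even[OF assms(1,2)] evens same opp g_def[symmetric]
    by (simp add: distrib_left mult_ac)
  also have "1 + X ^ g * (X ^ g + X ^ h) / (1 + X ^ (g + h)) =
      (1 + X ^ a + 2 * X ^ (g + h)) / (1 + X ^ (g + h))"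
  proof -
    have "X ^ a = X ^ g * X ^ g" by (simp only: g(1) sq)
    then show ?thesis using nz(1) by (simp add: power_add field_simps)
  qed
  also have "qpoch h / M * (qbinom g h * sign_coeff n * ((1 + X ^ a + 2 * X ^ (g + h)) / (1 + X ^ (g + h)))) =
      sign_coeff (a - 1) * (1 - X ^ a) *
      (qpoch (g + h) / (qpoch g * M) * ((1 + X ^ a + 2 * X ^ (g + h)) / (1 + X ^ (g + h))) * R)"
    by (simp add: coeff qbinom_def mult_ac)
  finally have "positive_sum p a (contiguous p bs) =
      qpoch (g + h) / (qpoch g * M) * ((1 + X ^ a + 2 * X ^ (g + h)) / (1 + X ^ (g + h))) * R"
    by (simp only: mult_left_cancel[OF no_zero_divisors[OF sign_coeff_nonzero nz(2)]])
  then show ?thesis unfolding n(2) M_def R_def g_def .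
qed

section \<open>From signed permutations to words\<close>

definition window :: "nat \<Rightarrow> (int \<Rightarrow> int) \<Rightarrow> int list" where
  "window n \<sigma> = map (\<lambda>i. \<sigma> (int i)) [1..<Suc n]"

lemma length_window [simp]: "length (window n \<sigma>) = n"
  by (simp add: window_def)

lemma nth_window: "i < n \<Longrightarrow> window n \<sigma> ! i = \<sigma> (int i + 1)"
  by (simp add: window_def nth_append add.commute del: upt_Suc)

lemma set_window: "set (window n \<sigma>) = \<sigma> ` {1..int n}"
proof -
  have "int ` {1..<Suc n} = {1..int n}"
    by (simp add: atLeastLessThanSuc_atLeastAtMost image_int_atLeastAtMost)
  then show ?thesis by (simp add: window_def flip: image_image del: upt_Suc)
qed

lemma window_signed_words:
  assumes "\<sigma> \<in> signed_perms n"
  shows "window n \<sigma> \<in> signed_words n"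
proof -
  let ?S = "{- int n..int n} - {0}"
  have perm: "\<sigma> permutes ?S" and neg: "\<And>i. i \<in> ?S \<Longrightarrow> \<sigma> (- i) = - \<sigma> i"
    using assms by (auto simp: signed_perms_def)
  have inj: "i = j" if "i \<in> {1..int n}" "j \<in> {1..int n}" "\<bar>\<sigma> i\<bar> = \<bar>\<sigma> j\<bar>" for i j
  proof -
    have "\<sigma> i = \<sigma> j \<or> \<sigma> i = - \<sigma> j" using that(3) by (simp add: abs_eq_iff)
    also have "- \<sigma> j = \<sigma> (- j)" using neg[of j] that by auto
    finally have "i = j \<or> i = - j" using permutes_inj[OF perm] by (auto dest: injD)
    with that show ?thesis by auto
  qed
  have "\<bar>\<sigma> i\<bar> \<in> {1..int n}" if "i \<in> {1..int n}" for i
  proof -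
    have "\<sigma> i \<in> ?S" using that permutes_in_image[OF perm, of i] by auto
    then show ?thesis by auto
  qed
  then have "(abs \<circ> \<sigma>) ` {1..int n} \<subseteq> {1..int n}" by auto
  moreover have inj': "inj_on (abs \<circ> \<sigma>) {1..int n}" using inj by (auto intro: inj_onI)
  ultimately have "(abs \<circ> \<sigma>) ` {1..int n} = {1..int n}"
    by (intro endo_inj_surj) auto
  moreover have "distinct (map abs (window n \<sigma>))"
  proof -
    have "inj_on (\<lambda>i. \<bar>\<sigma> (int i)\<bar>) (set [1..<Suc n])"
    proof (rule inj_onI)
      fix i j assume "i \<in> set [1..<Suc n]" "j \<in> set [1..<Suc n]" "\<bar>\<sigma> (int i)\<bar> = \<bar>\<sigma> (int j)\<bar>"
      then show "i = j" using inj[of "int i" "int j"] by (auto simp del: upt_Suc)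
    qed
    then show ?thesis by (simp add: window_def distinct_map comp_def del: upt_Suc)
  qed
  ultimately show ?thesis
    by (simp add: signed_words_def set_window image_image)
qed

text \<open>The window fixes the values at positive arguments, oddness those at negative ones, and
  all other points are fixed points.\<close>

lemma inj_on_window: "inj_on (window n) (signed_perms n)"
proof (rule inj_onI)
  fix \<sigma> \<tau> assume s: "\<sigma> \<in> signed_perms n" "\<tau> \<in> signed_perms n" and eq: "window n \<sigma> = window n \<tau>"
  have pos: "\<sigma> i = \<tau> i" if "i \<in> {1..int n}" for i
    using that nth_window[of "nat i - 1" n \<sigma>] nth_window[of "nat i - 1" n \<tau>] eq by auto
  show "\<sigma> = \<tau>"
  proof
    fix i
    consider "i \<in> {1..int n}" | "- i \<in> {1..int n}" | "i \<notin> {- int n..int n} - {0}" by fastforce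
    then show "\<sigma> i = \<tau> i"
    proof cases
      case 2
      then have "\<sigma> (- (- i)) = - \<sigma> (- i)" "\<tau> (- (- i)) = - \<tau> (- i)"
        using s unfolding signed_perms_def by (auto simp del: minus_minus)
      with pos[OF 2] show ?thesis by simp
    next
      case 3
      with s show ?thesis by (auto simp: signed_perms_def permutes_def)
    qed (rule pos)
  qed
qed

lemma signed_words_window:
  assumes vs: "vs \<in> signed_words n"
  shows "\<exists>\<sigma>\<in>signed_perms n. window n \<sigma> = vs"
proof -
  let ?S = "{- int n..int n} - {0}"
  \<comment> \<open>The odd extension of the word, with the identity elsewhere; list indices are one
    less than positions.\<close>
  define \<sigma> where "\<sigma> = (\<lambda>i. if i \<in> {1..int n} then vs ! (nat i - 1)
    else if - i \<in> {1..int n} then - vs ! (nat (- i) - 1) else i)"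
  have len: "length vs = n" using vs by (simp add: signed_words_def)
  have dist: "distinct (map abs vs)" using vs by (simp add: signed_words_def)
  have idx: "nat \<bar>i\<bar> - 1 < n" if "i \<in> ?S" for i using that by auto
  have abs_\<sigma>: "\<bar>\<sigma> i\<bar> = \<bar>vs ! (nat \<bar>i\<bar> - 1)\<bar>" if "i \<in> ?S" for i
    using that by (auto simp: \<sigma>_def)
  have range: "\<bar>vs ! k\<bar> \<in> {1..int n}" if "k < n" for k
    using vs that len by (auto simp: signed_words_def)
  have neg: "\<sigma> (- i) = - \<sigma> i" if "i \<in> ?S" for i
    using that by (auto simp: \<sigma>_def)
  have "inj_on \<sigma> ?S"
  proof (rule inj_onI)
    fix i j assume ij: "i \<in> ?S" "j \<in> ?S" "\<sigma> i = \<sigma> j"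
    then have "\<bar>vs ! (nat \<bar>i\<bar> - 1)\<bar> = \<bar>vs ! (nat \<bar>j\<bar> - 1)\<bar>" using abs_\<sigma> by metis
    then have "nat \<bar>i\<bar> - 1 = nat \<bar>j\<bar> - 1"
      using dist idx[OF ij(1)] idx[OF ij(2)] len
      by (metis length_map nth_eq_iff_index_eq nth_map)
    then have "\<bar>i\<bar> = \<bar>j\<bar>" using ij(1,2) by auto
    moreover have "i \<noteq> - j"
    proof
      assume "i = - j"
      then have "\<sigma> j = 0" using ij neg[of j] by simp
      then show False using abs_\<sigma>[OF ij(2)] range[OF idx[OF ij(2)]] by simp
    qed
    ultimately show "i = j" by (simp add: abs_eq_iff)
  qed
  moreover have "\<sigma> ` ?S \<subseteq> ?S"
  proof
    fix x assume "x \<in> \<sigma> ` ?S"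
    then obtain i where i: "i \<in> ?S" "x = \<sigma> i" by blast
    have "\<bar>x\<bar> \<in> {1..int n}" using abs_\<sigma>[OF i(1)] range[OF idx[OF i(1)]] i(2) by simp
    then show "x \<in> ?S" by auto
  qed
  ultimately have "bij_betw \<sigma> ?S ?S"
    by (simp add: bij_betw_def endo_inj_surj)
  then have "\<sigma> permutes ?S"
    by (rule bij_imp_permutes) (auto simp: \<sigma>_def)
  then have "\<sigma> \<in> signed_perms n" using neg by (simp add: signed_perms_def)
  moreover have "window n \<sigma> = vs"
    using len by (intro nth_equalityI) (auto simp: nth_window \<sigma>_def nat_add_distrib)
  ultimately show ?thesis by blast
qed

text \<open>Grouping pairs by their right index matches the recursion that appends the last entry of
  a word.\<close>

lemma card_ordered_pairs:
  "card {(i, j) \<in> {1..n} \<times> {1..n}. i < j \<and> P i j} = (\<Sum>j=1..n. card {i \<in> {1..<j :: nat}. P i j})"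
proof -
  have "{(i, j) \<in> {1..n} \<times> {1..n}. i < j \<and> P i j} =
      prod.swap ` (SIGMA j:{1..n}. {i \<in> {1..<j}. P i j})" by force
  then show ?thesis by (simp add: card_image)
qed

lemma zip_window_alt:
  "zip (window n \<sigma>) (alt True n) = map (\<lambda>i. (\<sigma> (int i), odd i)) [1..<Suc n]"
  by (induction n) (auto simp: window_def alt_Suc_right simp del: alt.simps(2))

lemma weight_snoc: "weight (zs @ [z]) = weight zs * (\<Prod>y\<leftarrow>zs. pair_weight y z)"
  by (simp add: weight_append cross_weight_def)

lemma prod_pair_weight:
  fixes j :: nat
  assumes "finite A"
  shows "(\<Prod>i\<in>A. pair_weight (f i, odd i) (f j, odd j)) =
    (- 1) ^ (card {i \<in> A. f i > f j} + card {i \<in> A. f i + f j < 0}) *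
    X ^ (card {i \<in> A. f i > f j \<and> i mod 2 \<noteq> j mod 2} + card {i \<in> A. f i + f j < 0 \<and> i mod 2 \<noteq> j mod 2})"
proof -
  have pw: "pair_weight (f i, odd i) (f j, odd j) =
      (- 1) ^ (of_bool (f i > f j) + of_bool (f i + f j < 0)) *
      X ^ (of_bool (f i > f j \<and> i mod 2 \<noteq> j mod 2) + of_bool (f i + f j < 0 \<and> i mod 2 \<noteq> j mod 2))" for i
  proof -
    have par: "(odd i = odd j) = (i mod 2 = j mod 2)" by presburger
    have "pair_weight (f i, odd i) (f j, odd j) = (if i mod 2 = j mod 2 then - 1 else - X) ^
        (of_bool (f i > f j) + of_bool (f i + f j < 0))"
      by (simp only: pair_weight_def swap_weight_def fst_conv snd_conv par)
    then show ?thesis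
      by (cases "i mod 2 = j mod 2"; cases "f i > f j"; cases "f i + f j < 0") simp_all
  qed
  have card: "card {i \<in> A. P i} = (\<Sum>i\<in>A. of_bool (P i))" for P
    using assms by (simp add: Int_def)
  show ?thesis
    unfolding pw card prod.distrib sum.distrib[symmetric] by (simp only: power_sum)
qed

text \<open>The pattern starts with \<open>True\<close> because position 1 is odd; the weight is
  then the summand of \<open>D_poly\<close>.\<close>

lemma weight_window:
  "weight (zip (window n \<sigma>) (alt True n)) = (- 1) ^ D_length n \<sigma> * X ^ odd_length n \<sigma>"
proof -
  define f where "f = (\<lambda>i::nat. \<sigma> (int i))"
  have len: "D_length n \<sigma> = (\<Sum>j=1..n. card {i \<in> {1..<j}. f i > f j} + card {i \<in> {1..<j}. f i + f j < 0})"
    "odd_length n \<sigma> = (\<Sum>j=1..n. card {i \<in> {1..<j}. f i > f j \<and> i mod 2 \<noteq> j mod 2} +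
      card {i \<in> {1..<j}. f i + f j < 0 \<and> i mod 2 \<noteq> j mod 2})"
    unfolding D_length_def odd_length_def card_ordered_pairs sum.distrib f_def by simp_all
  have "weight (map (\<lambda>i. (f i, odd i)) [1..<Suc n]) =
      (\<Prod>j=1..n. \<Prod>i=1..<j. pair_weight (f i, odd i) (f j, odd j))"
  proof (induction n)
    case (Suc n)
    have "(\<Prod>y\<leftarrow>map (\<lambda>i. (f i, odd i)) [1..<Suc n]. pair_weight y (f (Suc n), odd (Suc n))) =
        (\<Prod>i=1..<Suc n. pair_weight (f i, odd i) (f (Suc n), odd (Suc n)))"
      using prod.distinct_set_conv_list[of "[1..<Suc n]"
          "\<lambda>i. pair_weight (f i, odd i) (f (Suc n), odd (Suc n))"]
      by (simp add: comp_def del: upt_Suc)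
    moreover have "[1..<Suc (Suc n)] = [1..<Suc n] @ [Suc n]" by simp
    ultimately show ?case
      using Suc by (simp add: weight_snoc del: upt_Suc)
  qed simp
  also have "\<dots> = (- 1) ^ D_length n \<sigma> * X ^ odd_length n \<sigma>"
    unfolding len by (simp add: prod_pair_weight prod.distrib power_sum)
  finally show ?thesis by (simp only: zip_window_alt f_def)
qed

text \<open>The value at position \<open>i\<close> is the list entry with index \<open>i - 1\<close>.\<close>

definition D_conditions :: "nat set \<Rightarrow> int list \<Rightarrow> bool" where
  "D_conditions I vs \<longleftrightarrow>
     (\<forall>i\<in>I. (if i = 0 then - vs ! 1 else vs ! (i - 1)) < vs ! i)"

definition word_sum :: "nat \<Rightarrow> nat set \<Rightarrow> int poly fract" where
  "word_sum n I =
     (\<Sum>vs | vs \<in> signed_words n \<and> D_conditions I vs. weight (zip vs (alt True n)))"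

section \<open>Sign change of the entry with absolute value 1\<close>

definition flip_one :: "int \<Rightarrow> int" where
  "flip_one v = (if \<bar>v\<bar> = 1 then - v else v)"

lemma flip_one_simps [simp]: "\<bar>flip_one v\<bar> = \<bar>v\<bar>" "flip_one (flip_one v) = v" "flip_one (- v) = - flip_one v"
  by (auto simp: flip_one_def)

text \<open>No nonzero integer lies strictly between \<open>- 1\<close> and \<open>1\<close>, so
  exchanging these two does not affect a comparison with a nonzero integer of another absolute
  value.\<close>

lemma flip_one_less_iff:
  "\<bar>v\<bar> \<noteq> \<bar>w\<bar> \<Longrightarrow> v \<noteq> 0 \<Longrightarrow> w \<noteq> 0 \<Longrightarrow> flip_one v < flip_one w \<longleftrightarrow> v < w"
  by (auto simp: flip_one_def)

lemma flip_one_signed_words: "map flip_one vs \<in> signed_words n \<longleftrightarrow> vs \<in> signed_words n"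
  by (rule signed_words_cong) (simp add: comp_def)

lemma weight_flip_one:
  assumes "distinct (map abs vs)" "0 \<notin> set vs"
  shows "weight (zip (map flip_one vs) ps) = weight (zip vs ps)"
  using assms
proof (induction vs arbitrary: ps)
  case (Cons v vs)
  show ?case
  proof (cases ps)
    case (Cons p ps')
    have "pair_weight (flip_one v, p) (flip_one (fst y), snd y) = pair_weight (v, p) y"
      if "y \<in> set (zip vs ps')" for y
    proof -
      have "fst y \<in> set vs" using that by (metis prod.collapse set_zip_leftD)
      then have "\<bar>v\<bar> \<noteq> \<bar>fst y\<bar>" "v \<noteq> 0" "fst y \<noteq> 0" using Cons.prems by auto
      \<comment> \<open>A negative sum is a comparison of \<open>v\<close> with the negative of the
        other entry, so the same lemma covers it.\<close>
      then have "(flip_one v > flip_one (fst y)) = (v > fst y)"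
        "(flip_one v < flip_one (- fst y)) = (v < - fst y)"
        using flip_one_less_iff[of "fst y" v] flip_one_less_iff[of v "- fst y"] by auto
      then have "(flip_one v > flip_one (fst y)) = (v > fst y)"
        "(flip_one v + flip_one (fst y) < 0) = (v + fst y < 0)" by (simp_all, linarith)
      then show ?thesis by (simp add: pair_weight_def)
    qed
    then have "map (\<lambda>y. pair_weight (flip_one v, p) (flip_one (fst y), snd y)) (zip vs ps') =
      map (pair_weight (v, p)) (zip vs ps')"
      by (intro map_cong refl)
    moreover have "zip (map flip_one vs) ps' = map (\<lambda>y. (flip_one (fst y), snd y)) (zip vs ps')"
      by (simp add: zip_map1 case_prod_unfold)
    ultimately show ?thesis
      using Cons Cons.IH[of ps'] Cons.prems
      by (simp only: list.map zip_Cons_Cons weight.simps map_map comp_def) simp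
  qed simp
qed simp

lemma signed_words_nth:
  assumes "vs \<in> signed_words n" "i < n"
  shows "vs ! i \<noteq> 0" "j < n \<Longrightarrow> i \<noteq> j \<Longrightarrow> \<bar>vs ! i\<bar> \<noteq> \<bar>vs ! j\<bar>"
proof -
  have len: "length vs = n" and "distinct (map abs vs)" and img: "abs ` set vs = {1..int n}"
    using assms by (auto simp: signed_words_def)
  then show "j < n \<Longrightarrow> i \<noteq> j \<Longrightarrow> \<bar>vs ! i\<bar> \<noteq> \<bar>vs ! j\<bar>"
    using assms(2) by (metis length_map nth_eq_iff_index_eq nth_map)
  have "\<bar>vs ! i\<bar> \<in> {1..int n}" using img len assms(2) by auto
  then show "vs ! i \<noteq> 0" by auto
qed

lemma D_conditions_flip_one:
  assumes "vs \<in> signed_words n" "I \<subseteq> {0..n - 1}" "n \<ge> 2"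
  shows "D_conditions I (map flip_one vs) \<longleftrightarrow> D_conditions I vs"
proof -
  have len: "length vs = n" using assms(1) by (simp add: signed_words_def)
  have "(if i = 0 then - map flip_one vs ! 1 else map flip_one vs ! (i - 1)) < map flip_one vs ! i \<longleftrightarrow>
      (if i = 0 then - vs ! 1 else vs ! (i - 1)) < vs ! i" if "i \<in> I" for i
  proof -
    have i: "i < n" using that assms(2,3) by (auto simp: less_eq_Suc_le)
    show ?thesis
    proof (cases "i = 0")
      case True
      then show ?thesis
        using flip_one_less_iff[of "- vs ! 1" "vs ! 0"] signed_words_nth[OF assms(1)] assms(3) len by auto
    next
      case False
      then show ?thesis
        using flip_one_less_iff[of "vs ! (i - 1)" "vs ! i"] signed_words_nth[OF assms(1)] i len by auto
    qed
  qed
  then show ?thesis unfolding D_conditions_def by blast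
qed

lemma even_negatives_flip_one:
  assumes "vs \<in> signed_words n" "n \<ge> 1"
  shows "even (length (filter (\<lambda>v. v < 0) (map flip_one vs))) \<longleftrightarrow>
    odd (length (filter (\<lambda>v. v < 0) vs))"
proof -
  have "1 \<in> abs ` set vs" using assms by (auto simp: signed_words_def)
  then obtain v where v: "v \<in> set vs" "\<bar>v\<bar> = 1" by (metis image_iff)
  then obtain xs ys where vs: "vs = xs @ v # ys" by (meson split_list)
  have "\<bar>w\<bar> \<noteq> 1" if "w \<in> set (xs @ ys)" for w
    using assms(1) that v(2) by (auto simp: signed_words_def vs)
  then have "map flip_one xs = xs" "map flip_one ys = ys"
    by (auto intro!: map_idI simp: flip_one_def)
  moreover have "v \<noteq> 0" "flip_one v = - v" using v(2) by (auto simp: flip_one_def)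
  ultimately show ?thesis by (auto simp: vs)
qed

text \<open>Changing the sign of the value \<open>\<plusminus>1\<close> preserves weights and descents but exchanges even and
  odd signed permutations, so the sum over all signed permutations is twice the required one.\<close>

lemma to_fract_D_poly:
  assumes "n \<ge> 2" "I \<subseteq> {0..n - 1}"
  shows "to_fract (D_poly n I) = word_sum n I / 2"
proof -
  define S where "S = {vs \<in> signed_words n. D_conditions I vs}"
  define ev where "ev = (\<lambda>vs :: int list. even (length (filter (\<lambda>v. v < 0) vs)))"
  define w where "w = (\<lambda>vs. weight (zip vs (alt True n)))"
  have fin: "finite S" unfolding S_def using finite_signed_words by (rule finite_subset[rotated]) auto
  have cond: "(\<forall>i\<in>I. D_val \<sigma> i < D_val \<sigma> (i + 1)) \<longleftrightarrow> D_conditions I (window n \<sigma>)" for \<sigma>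
  proof -
    have "D_val \<sigma> i < D_val \<sigma> (i + 1) \<longleftrightarrow>
        (if i = 0 then - window n \<sigma> ! 1 else window n \<sigma> ! (i - 1)) < window n \<sigma> ! i" if "i \<in> I" for i
    proof -
      have "i < n" using that assms by (auto simp: less_eq_Suc_le)
      then show ?thesis using assms(1) by (auto simp: D_val_def nth_window add.commute of_nat_diff)
    qed
    then show ?thesis by (simp add: D_conditions_def)
  qed
  have negs: "card {i \<in> {1..n}. \<sigma> (int i) < 0} = length (filter (\<lambda>v. v < 0) (window n \<sigma>))" for \<sigma>
  proof -
    have "length (filter (\<lambda>v. v < 0) (window n \<sigma>)) = length (filter (\<lambda>i. \<sigma> (int i) < 0) [1..<Suc n])"
      by (simp add: window_def filter_map comp_def del: upt_Suc)
    also have "\<dots> = card (set (filter (\<lambda>i. \<sigma> (int i) < 0) [1..<Suc n]))"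
      by (intro distinct_card[symmetric] distinct_filter distinct_upt)
    also have "set (filter (\<lambda>i. \<sigma> (int i) < 0) [1..<Suc n]) = {i \<in> {1..n}. \<sigma> (int i) < 0}"
      by (auto simp del: upt_Suc)
    finally show ?thesis by simp
  qed
  have "bij_betw (window n) (D_quotient n I) {vs \<in> S. ev vs}"
    unfolding bij_betw_def
  proof
    show "inj_on (window n) (D_quotient n I)"
      by (rule inj_on_subset[OF inj_on_window]) (auto simp: D_quotient_def even_signed_perms_def)
    show "window n ` D_quotient n I = {vs \<in> S. ev vs}"
    proof (intro equalityI subsetI)
      fix vs assume vs: "vs \<in> {vs \<in> S. ev vs}"
      then obtain \<sigma> where "\<sigma> \<in> signed_perms n" "window n \<sigma> = vs"
        using signed_words_window by (auto simp: S_def)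
      moreover from this vs have "\<sigma> \<in> D_quotient n I"
        unfolding D_quotient_def even_signed_perms_def mem_Collect_eq cond negs
        by (simp add: S_def ev_def)
      ultimately show "vs \<in> window n ` D_quotient n I" by blast
    next
      fix vs assume "vs \<in> window n ` D_quotient n I"
      then obtain \<sigma> where "\<sigma> \<in> D_quotient n I" "vs = window n \<sigma>" by blast
      then show "vs \<in> {vs \<in> S. ev vs}"
        unfolding D_quotient_def even_signed_perms_def mem_Collect_eq cond negs
        by (simp add: S_def ev_def window_signed_words)
    qed
  qed
  then have "(\<Sum>\<sigma>\<in>D_quotient n I. w (window n \<sigma>)) = (\<Sum>vs | vs \<in> S \<and> ev vs. w vs)"
    using sum.reindex_bij_betw[of "window n" "D_quotient n I" "{vs \<in> S. ev vs}" w] by simp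
  moreover have "to_fract (monom ((- 1) ^ l) k) = (- 1) ^ l * X ^ k" for l k
  proof -
    have "monom ((- 1) ^ l) k = (- 1) ^ l * monom (1::int) k"
      by (cases "even l") (auto simp: minus_monom)
    then show ?thesis
      by (cases "even l") (auto simp: X_power to_fract_uminus)
  qed
  ultimately have D: "to_fract (D_poly n I) = (\<Sum>vs | vs \<in> S \<and> ev vs. w vs)"
    by (simp add: D_poly_def w_def weight_window)
  have "(\<Sum>vs | vs \<in> S \<and> \<not> ev vs. w vs) = (\<Sum>vs | vs \<in> S \<and> ev vs. w vs)"
  proof (rule sum.reindex_bij_witness[of _ "map flip_one" "map flip_one"])
    fix vs assume vs: "vs \<in> {vs. vs \<in> S \<and> \<not> ev vs}"
    then show "map flip_one vs \<in> {vs. vs \<in> S \<and> ev vs}"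
      using assms D_conditions_flip_one even_negatives_flip_one
      by (auto simp: S_def ev_def flip_one_signed_words)
    have "distinct (map abs vs)" "0 \<notin> set vs"
      using vs signed_words_nth(1) by (auto simp: S_def signed_words_def in_set_conv_nth)
    then show "w (map flip_one vs) = w vs" by (simp add: w_def weight_flip_one)
  next
    fix vs assume "vs \<in> {vs. vs \<in> S \<and> ev vs}"
    then show "map flip_one vs \<in> {vs. vs \<in> S \<and> \<not> ev vs}"
      using assms D_conditions_flip_one even_negatives_flip_one
      by (auto simp: S_def ev_def flip_one_signed_words)
  qed (auto simp: comp_def)
  moreover have "(\<Sum>vs\<in>S. w vs) = (\<Sum>vs | vs \<in> S \<and> ev vs. w vs) + (\<Sum>vs | vs \<in> S \<and> \<not> ev vs. w vs)"
  proof -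
    have "S = {vs. vs \<in> S \<and> ev vs} \<union> {vs. vs \<in> S \<and> \<not> ev vs}" by auto
    then show ?thesis
      using fin by (subst sum.union_disjoint[symmetric]) auto
  qed
  ultimately have "word_sum n I = 2 * to_fract (D_poly n I)"
    unfolding D by (simp add: word_sum_def S_def w_def)
  then show ?thesis using two_neq_zero by simp
qed

section \<open>Blocks and connected components\<close>

text \<open>The first block starts at position \<open>u + 1\<close>. Collected are those
  \<open>i\<close> for which positions \<open>i\<close> and \<open>i + 1\<close> share a block, so a
  block of positive size \<open>b\<close> contributes \<open>b - 1\<close> conditions.\<close>

fun blocks_set :: "nat \<Rightarrow> nat list \<Rightarrow> nat set" where
  "blocks_set u [] = {}"
| "blocks_set u (b # bs) = {u<..<u + b} \<union> blocks_set (u + b) bs"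

lemma blocks_set_bounds: "i \<in> blocks_set u bs \<Longrightarrow> u < i \<and> i < u + sum_list bs"
  by (induction bs arbitrary: u) (fastforce)+

text \<open>Position \<open>Suc u\<close> is peeled off: it enlarges the next block if
  \<open>Suc u \<in> I\<close> and forms a block of size 1 otherwise.\<close>

lemma blocks_set_exists:
  assumes "I \<subseteq> {u<..<n}" "u \<le> n"
  shows "\<exists>bs. (\<forall>b\<in>set bs. b > 0) \<and> u + sum_list bs = n \<and> blocks_set u bs = I"
  using assms
proof (induction "n - u" arbitrary: u I)
  case 0
  then show ?case by (intro exI[of _ "[]"]) auto
next
  case (Suc k)
  have "I \<inter> {Suc u<..<n} \<subseteq> {Suc u<..<n}" "Suc u \<le> n" "k = n - Suc u" using Suc by auto
  then obtain bs where bs: "\<forall>b\<in>set bs. b > 0" "Suc u + sum_list bs = n"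
    "blocks_set (Suc u) bs = I \<inter> {Suc u<..<n}"
    using Suc.hyps(1) by metis
  show ?case
  proof (cases "Suc u \<in> I")
    case True
    then have "Suc u < n" using Suc.prems by auto
    then obtain b bs' where Cons: "bs = b # bs'" using bs(2) by (cases bs) auto
    have "{u<..<u + (b + 1)} = insert (Suc u) {Suc u<..<Suc u + b}" using bs(1) Cons by auto
    then have "blocks_set u ((b + 1) # bs') = insert (Suc u) (blocks_set (Suc u) bs)"
      by (simp add: Cons)
    also have "\<dots> = I"
    proof -
      have "i = Suc u \<or> i \<in> {Suc u<..<n}" if "i \<in> I" for i using Suc.prems(1) that by fastforce
      then show ?thesis unfolding bs(3) using True by blast
    qed
    finally show ?thesis using bs Cons by (intro exI[of _ "(b + 1) # bs'"]) auto
  next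
    case False
    have "I \<inter> {Suc u<..<n} = I"
    proof -
      have "i \<noteq> Suc u \<longrightarrow> i \<in> {Suc u<..<n}" if "i \<in> I" for i using Suc.prems(1) that by fastforce
      then show ?thesis using False by blast
    qed
    then show ?thesis using bs by (intro exI[of _ "1 # bs"]) auto
  qed
qed

lemma fits_Cons:
  "fits ((p, b) # sh) vs \<longleftrightarrow> b \<le> length vs \<and> sorted_wrt (<) (take b vs) \<and> fits sh (drop b vs)"
proof
  assume "b \<le> length vs \<and> sorted_wrt (<) (take b vs) \<and> fits sh (drop b vs)"
  then show "fits ((p, b) # sh) vs"
    unfolding fits.simps by (intro exI[of _ "take b vs"] exI[of _ "drop b vs"]) auto
qed auto

text \<open>The word occupies the positions from \<open>u + 1\<close> on, so position
  \<open>i\<close> has list index \<open>i - u - 1\<close>; the offset \<open>u\<close> varies in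
  the induction.\<close>

lemma fits_contiguous_iff:
  assumes "length vs = sum_list bs"
  shows "fits (contiguous p bs) vs \<longleftrightarrow> (\<forall>i\<in>blocks_set u bs. vs ! (i - u - 1) < vs ! (i - u))"
  using assms
proof (induction bs arbitrary: p u vs)
  case (Cons b bs)
  have "sorted_wrt (<) (take b vs) \<longleftrightarrow> (\<forall>i. Suc i < b \<longrightarrow> vs ! i < vs ! Suc i)"
    using Cons.prems by (simp add: sorted_wrt_iff_nth_Suc_transp)
  also have "\<dots> \<longleftrightarrow> (\<forall>i\<in>{u<..<u + b}. vs ! (i - u - 1) < vs ! (i - u))"
  proof
    assume *: "\<forall>i. Suc i < b \<longrightarrow> vs ! i < vs ! Suc i"
    show "\<forall>i\<in>{u<..<u + b}. vs ! (i - u - 1) < vs ! (i - u)"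
    proof
      fix i assume i: "i \<in> {u<..<u + b}"
      then have "Suc (i - u - 1) = i - u" "i - u < b" by auto
      then show "vs ! (i - u - 1) < vs ! (i - u)" using * by metis
    qed
  next
    assume *: "\<forall>i\<in>{u<..<u + b}. vs ! (i - u - 1) < vs ! (i - u)"
    show "\<forall>i. Suc i < b \<longrightarrow> vs ! i < vs ! Suc i"
      using *[rule_format, of "u + Suc _"] by auto
  qed
  finally have left: "sorted_wrt (<) (take b vs) \<longleftrightarrow>
    (\<forall>i\<in>{u<..<u + b}. vs ! (i - u - 1) < vs ! (i - u))" .
  have "length (drop b vs) = sum_list bs" using Cons.prems by simp
  then have "fits (contiguous (p = even b) bs) (drop b vs) \<longleftrightarrow>
      (\<forall>i\<in>blocks_set (u + b) bs. drop b vs ! (i - (u + b) - 1) < drop b vs ! (i - (u + b)))"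
    by (rule Cons.IH)
  also have "\<dots> \<longleftrightarrow> (\<forall>i\<in>blocks_set (u + b) bs. vs ! (i - u - 1) < vs ! (i - u))"
  proof (rule ball_cong[OF refl])
    fix i assume i: "i \<in> blocks_set (u + b) bs"
    have "b + (i - (u + b) - 1) = i - u - 1" "b + (i - (u + b)) = i - u" "b \<le> length vs"
      using blocks_set_bounds[OF i] Cons.prems by auto
    then show "(drop b vs ! (i - (u + b) - 1) < drop b vs ! (i - (u + b))) \<longleftrightarrow>
        (vs ! (i - u - 1) < vs ! (i - u))"
      by (metis nth_drop)
  qed
  finally show ?case
    using left Cons.prems by (auto simp: fits_Cons simp del: fits.simps(2))
qed simp

lemma parities_contiguous: "parities (contiguous p bs) = alt p (sum_list bs)"
  by (induction bs arbitrary: p) (simp_all add: alt_append)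

lemma signed_words_length: "vs \<in> signed_words n \<Longrightarrow> length vs = n"
  by (simp add: signed_words_def)

lemma word_sum_without_0:
  assumes "sum_list bs = n"
  shows "word_sum n (blocks_set 0 bs) = shape_sum (contiguous True bs)"
proof -
  have "D_conditions (blocks_set 0 bs) vs \<longleftrightarrow> fits (contiguous True bs) vs" if "vs \<in> signed_words n" for vs
  proof -
    have "length vs = sum_list bs" using that assms by (simp add: signed_words_length)
    moreover have "i \<noteq> 0" if "i \<in> blocks_set 0 bs" for i using blocks_set_bounds[OF that] by simp
    ultimately show ?thesis
      using fits_contiguous_iff[of vs bs True 0] by (auto simp: D_conditions_def)
  qed
  then show ?thesis
    unfolding word_sum_def shape_sum_def
    by (intro sum.cong) (auto simp: assms parities_contiguous)
qed

section \<open>Sign change of the first entry\<close>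

definition flip_first :: "int list \<Rightarrow> int list" where
  "flip_first vs = (case vs of [] \<Rightarrow> [] | v # t \<Rightarrow> (- v) # t)"

lemma flip_first_flip_first [simp]: "flip_first (flip_first vs) = vs"
  by (cases vs) (auto simp: flip_first_def)

lemma flip_first_signed_words: "flip_first vs \<in> signed_words n \<longleftrightarrow> vs \<in> signed_words n"
  by (rule signed_words_cong) (cases vs, auto simp: flip_first_def)

lemma weight_flip_first_zip: "weight (zip (flip_first vs) ps) = weight (zip vs ps)"
  by (cases vs; cases ps) (simp_all add: flip_first_def weight_flip_first del: weight.simps(2))

lemma nth_flip_first:
  "vs \<noteq> [] \<Longrightarrow> flip_first vs ! 0 = - vs ! 0" "i > 0 \<Longrightarrow> flip_first vs ! i = vs ! i"
  by (cases vs; simp add: flip_first_def)+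

text \<open>Changing the sign of the first entry keeps the weight and turns the condition at 0,
  \<open>- \<sigma> 2 < \<sigma> 1\<close>, into the condition at 1. Conditions at larger indices do
  not involve the first entry.\<close>

lemma word_sum_0_not_1:
  assumes "0 \<in> I" "1 \<notin> I" "n \<ge> 2"
  shows "word_sum n I = word_sum n (insert 1 (I - {0}))"
proof -
  have iff: "D_conditions (insert 1 (I - {0})) (flip_first vs) \<longleftrightarrow> D_conditions I vs"
    if "vs \<in> signed_words n" for vs
  proof -
    have nth: "flip_first vs ! 0 = - vs ! 0" "i > 0 \<Longrightarrow> flip_first vs ! i = vs ! i" for i
      using nth_flip_first(1)[of vs] nth_flip_first(2) that assms(3) signed_words_length by fastforce+
    have "D_conditions (insert 1 (I - {0})) (flip_first vs) \<longleftrightarrow>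
        - vs ! 0 < vs ! 1 \<and> (\<forall>i\<in>I - {0}. flip_first vs ! (i - 1) < flip_first vs ! i)"
      by (auto simp: D_conditions_def nth)
    also have "(\<forall>i\<in>I - {0}. flip_first vs ! (i - 1) < flip_first vs ! i) \<longleftrightarrow>
        (\<forall>i\<in>I - {0}. vs ! (i - 1) < vs ! i)"
    proof (rule ball_cong[OF refl])
      fix i assume "i \<in> I - {0}"
      then have "i - 1 > 0" "i > 0" using assms(2) by (auto simp: gr0_conv_Suc, metis One_nat_def not0_implies_Suc)
      then show "(flip_first vs ! (i - 1) < flip_first vs ! i) \<longleftrightarrow> (vs ! (i - 1) < vs ! i)"
        by (simp only: nth)
    qed
    also have "- vs ! 0 < vs ! 1 \<longleftrightarrow> - vs ! 1 < vs ! 0" by linarith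
    also have "(- vs ! 1 < vs ! 0 \<and> (\<forall>i\<in>I - {0}. vs ! (i - 1) < vs ! i)) \<longleftrightarrow> D_conditions I vs"
      using assms(1) by (auto simp: D_conditions_def)
    finally show ?thesis .
  qed
  show ?thesis
    unfolding word_sum_def
    by (rule sum.reindex_bij_witness[of _ flip_first flip_first])
      (use iff in \<open>auto simp: flip_first_signed_words weight_flip_first_zip\<close>,
       metis flip_first_flip_first flip_first_signed_words)
qed

text \<open>The conditions at 0 and 1 say \<open>\<bar>\<sigma> 1\<bar> < \<sigma> 2\<close> and are
  symmetric under a sign change of the first entry, so words with negative and with positive first
  entry contribute equally. In the latter case the increasing first block is positive throughout and
  the condition at 0 is automatic.\<close>

lemma word_sum_0_1:
  assumes "a \<ge> 2" "a + sum_list bs = n"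
  shows "word_sum n ({..<a} \<union> blocks_set a bs) = 2 * positive_sum True a (contiguous (even a) bs)"
proof -
  define I where "I = {..<a} \<union> blocks_set a bs"
  define sh where "sh = contiguous (even a) bs"
  define P where "P = {vs \<in> signed_words n. D_conditions I vs \<and> vs ! 0 > 0}"
  define N where "N = {vs \<in> signed_words n. D_conditions I vs \<and> vs ! 0 < 0}"
  define w where "w = (\<lambda>vs. weight (zip vs (alt True n)))"
  have blocks: "{0<..<a} \<union> blocks_set a bs = blocks_set 0 (a # bs)"
    "contiguous True (a # bs) = (True, a) # sh" by (simp_all add: sh_def)
  have I: "I = insert 0 (blocks_set 0 (a # bs))"
    using assms(1) unfolding I_def blocks(1)[symmetric] by auto
  have not0: "0 \<notin> blocks_set 0 (a # bs)" using blocks_set_bounds by blast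
  have cond: "D_conditions I vs \<longleftrightarrow> - vs ! 1 < vs ! 0 \<and> fits ((True, a) # sh) vs"
    if "vs \<in> signed_words n" for vs
  proof -
    have "length vs = sum_list (a # bs)" using that assms by (simp add: signed_words_length)
    then have "fits ((True, a) # sh) vs \<longleftrightarrow> (\<forall>i\<in>blocks_set 0 (a # bs). vs ! (i - 1) < vs ! i)"
      using fits_contiguous_iff[of vs "a # bs" True 0] unfolding blocks(2) by simp
    then show ?thesis
      unfolding D_conditions_def I using not0 by (auto simp del: blocks_set.simps)
  qed
  have flip: "D_conditions I (flip_first vs) \<longleftrightarrow> D_conditions I vs" if vs: "vs \<in> signed_words n" for vs
  proof -
    have nth: "flip_first vs ! 0 = - vs ! 0" "i > 0 \<Longrightarrow> flip_first vs ! i = vs ! i" for i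
      using nth_flip_first(1)[of vs] nth_flip_first(2) that assms signed_words_length by fastforce+
    have "1 \<in> I" "0 \<in> I" using assms(1) by (auto simp: I_def)
    then have split: "D_conditions I us \<longleftrightarrow> - us ! 1 < us ! 0 \<and> us ! 0 < us ! 1 \<and>
        (\<forall>i\<in>I - {0, 1}. us ! (i - 1) < us ! i)" for us
      unfolding D_conditions_def by fastforce
    have "(\<forall>i\<in>I - {0, 1}. flip_first vs ! (i - 1) < flip_first vs ! i) \<longleftrightarrow>
        (\<forall>i\<in>I - {0, 1}. vs ! (i - 1) < vs ! i)"
    proof (rule ball_cong[OF refl])
      fix i assume "i \<in> I - {0, 1}"
      then have "i - 1 > 0" "i > 0" by auto
      then show "(flip_first vs ! (i - 1) < flip_first vs ! i) \<longleftrightarrow> (vs ! (i - 1) < vs ! i)"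
        by (simp only: nth)
    qed
    then show ?thesis unfolding split by (auto simp: nth)
  qed
  have nz: "vs ! 0 \<noteq> 0" if "vs \<in> signed_words n" for vs
    using signed_words_nth(1)[OF that, of 0] assms by simp
  have fin: "finite P" "finite N"
    unfolding P_def N_def using finite_signed_words by (auto intro: finite_subset[rotated])
  have "word_sum n I = (\<Sum>vs\<in>P \<union> N. w vs)"
    unfolding word_sum_def w_def
    by (intro sum.cong) (use nz in \<open>auto simp: P_def N_def, metis linorder_neqE\<close>)
  also have "\<dots> = (\<Sum>vs\<in>P. w vs) + (\<Sum>vs\<in>N. w vs)"
    using fin by (intro sum.union_disjoint) (auto simp: P_def N_def)
  also have "(\<Sum>vs\<in>N. w vs) = (\<Sum>vs\<in>P. w vs)"
  proof (rule sum.reindex_bij_witness[of _ flip_first flip_first])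
    have nonempty: "vs \<noteq> []" if "vs \<in> signed_words n" for vs
      using signed_words_length[OF that] assms by auto
    fix vs assume "vs \<in> N"
    then show "flip_first vs \<in> P" "w (flip_first vs) = w vs"
      by (auto simp: P_def N_def w_def flip_first_signed_words weight_flip_first_zip flip
          nth_flip_first(1) nonempty)
  next
    have nonempty: "vs \<noteq> []" if "vs \<in> signed_words n" for vs
      using signed_words_length[OF that] assms by auto
    fix vs assume "vs \<in> P"
    then show "flip_first vs \<in> N"
      by (auto simp: P_def N_def flip_first_signed_words flip nth_flip_first(1) nonempty)
  qed simp_all
  also have "(\<Sum>vs\<in>P. w vs) = positive_sum True a sh"
  proof -
    have "shape_size sh = sum_list bs" "parities sh = alt (True = even a) (sum_list bs)"
      by (simp_all add: sh_def parities_contiguous)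
    then have par: "a + shape_size sh = n" "alt True a @ parities sh = alt True n"
      using assms(2) alt_append[of True a "sum_list bs"] by auto
    have "vs \<in> P \<longleftrightarrow> vs \<in> signed_words n \<and> fits ((True, a) # sh) vs \<and> (\<forall>v\<in>set (take a vs). v > 0)" for vs
    proof (cases "vs \<in> signed_words n \<and> fits ((True, a) # sh) vs")
      case True
      have "a \<le> length vs" "sorted_wrt (<) (take a vs)"
        using True unfolding fits_Cons by auto
      then have le: "vs ! 0 \<le> vs ! i" if "i < a" for i
        using that sorted_wrt_nth_less[of "(<)" "take a vs" 0 i] by (cases i) auto
      have "(\<forall>v\<in>set (take a vs). v > 0) \<longleftrightarrow> vs ! 0 > 0"
      proof
        assume "\<forall>v\<in>set (take a vs). v > 0"
        moreover have "vs ! 0 \<in> set (take a vs)"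
          using \<open>a \<le> length vs\<close> assms(1) by (auto simp: in_set_conv_nth intro!: exI[of _ 0])
        ultimately show "vs ! 0 > 0" by blast
      next
        assume "vs ! 0 > 0"
        then show "\<forall>v\<in>set (take a vs). v > 0"
          using le \<open>a \<le> length vs\<close> by (fastforce simp: in_set_conv_nth)
      qed
      moreover have "- vs ! 1 < vs ! 0" if "vs ! 0 > 0" using le[of 1] that assms(1) by simp
      ultimately show ?thesis using True cond[of vs] by (auto simp: P_def simp del: fits.simps)
    next
      case False
      then show ?thesis using cond[of vs] by (auto simp: P_def simp del: fits.simps)
    qed
    then show ?thesis
      unfolding positive_sum_def w_def par by (intro sum.cong) auto
  qed
  finally show ?thesis by (simp add: I_def sh_def)
qed

section \<open>Connected components\<close>

lemma interval_subset_Un: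
  fixes A B :: "nat set"
  assumes "{a..b} \<subseteq> A \<union> B" "a \<le> b" "\<And>x y. x \<in> A \<Longrightarrow> y \<in> B \<Longrightarrow> x + 1 < y"
  shows "{a..b} \<subseteq> A \<or> {a..b} \<subseteq> B"
proof (cases "a \<in> A")
  case True
  have "x \<in> A" if "a \<le> x" "x \<le> b" for x
    using that
  proof (induction x rule: dec_induct)
    case (step x)
    then have "x \<in> A" "Suc x \<in> A \<union> B" using subsetD[OF assms(1), of "Suc x"] by auto
    then show ?case using assms(3)[of x "Suc x"] by auto
  qed (rule True)
  then show ?thesis by auto
next
  case False
  then have "a \<in> B" using assms(1,2) by auto
  have "x \<in> B" if "x \<in> {a..b}" for x
    using that assms(1) assms(3)[of x a] \<open>a \<in> B\<close> by fastforce
  then show ?thesis by auto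
qed

text \<open>Because of the gap no interval inside the union meets both sets, so maximality can be
  tested in each set separately.\<close>

lemma components_Un:
  assumes "\<And>x y. x \<in> A \<Longrightarrow> y \<in> B \<Longrightarrow> x + 1 < y"
  shows "components (A \<union> B) = components A \<union> components B"
proof -
  have disj: "A \<inter> B = {}" using assms by fastforce
  have inA: "{c..d} \<subseteq> A" if "{a..b} \<subseteq> A" "a \<le> b" "{a..b} \<subseteq> {c..d}" "{c..d} \<subseteq> A \<union> B" for a b c d
  proof -
    have "a \<in> {c..d}" "a \<in> A" using that by auto
    then have "c \<le> d" by auto
    from interval_subset_Un[OF that(4) this assms] \<open>a \<in> {c..d}\<close> \<open>a \<in> A\<close> disj show ?thesis by blast
  qed
  have inB: "{c..d} \<subseteq> B" if "{a..b} \<subseteq> B" "a \<le> b" "{a..b} \<subseteq> {c..d}" "{c..d} \<subseteq> A \<union> B" for a b c d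
  proof -
    have "a \<in> {c..d}" "a \<in> B" using that by auto
    then have "c \<le> d" by auto
    from interval_subset_Un[OF that(4) this assms] \<open>a \<in> {c..d}\<close> \<open>a \<in> B\<close> disj show ?thesis by blast
  qed
  show ?thesis
  proof (intro equalityI subsetI)
    fix J assume J: "J \<in> components (A \<union> B)"
    then obtain a b where ab: "a \<le> b" "J = {a..b}" "J \<subseteq> A \<union> B" by (auto simp: components_def)
    then have "J \<subseteq> A \<or> J \<subseteq> B" using interval_subset_Un[of a b A B] assms by simp
    moreover have "{c..d} = J" if "J \<subseteq> {c..d}" "{c..d} \<subseteq> A \<union> B" for c d
      using J that unfolding components_def by blast
    then have "J \<subseteq> A \<longrightarrow> J \<in> components A" "J \<subseteq> B \<longrightarrow> J \<in> components B"
      using ab(1,2) unfolding components_def by blast+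
    ultimately show "J \<in> components A \<union> components B" by blast
  next
    fix J assume "J \<in> components A \<union> components B"
    then show "J \<in> components (A \<union> B)"
    proof
      assume J: "J \<in> components A"
      then obtain a b where "a \<le> b" "J = {a..b}" "J \<subseteq> A" by (auto simp: components_def)
      then show ?thesis using J inA[of a b] unfolding components_def by blast
    next
      assume J: "J \<in> components B"
      then obtain a b where "a \<le> b" "J = {a..b}" "J \<subseteq> B" by (auto simp: components_def)
      then show ?thesis using J inB[of a b] unfolding components_def by blast
    qed
  qed
qed

lemma components_interval:
  assumes "a \<le> b"
  shows "components {a..b} = {{a..b}}"
  using assms unfolding components_def by auto

lemma components_empty: "components {} = {}"
  unfolding components_def by auto

lemma components_blocks_set_Cons:
  "components (blocks_set u (b # bs)) =
    (if b \<ge> 2 then {{u<..<u + b}} else {}) \<union> components (blocks_set (u + b) bs)"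
proof -
  have "components (blocks_set u (b # bs)) = components {u<..<u + b} \<union> components (blocks_set (u + b) bs)"
    unfolding blocks_set.simps using blocks_set_bounds by (intro components_Un) fastforce
  also have "components {u<..<u + b} = (if b \<ge> 2 then {{u<..<u + b}} else {})"
  proof (cases "b \<ge> 2")
    case True
    then have "{u<..<u + b} = {Suc u..u + b - 1}" "Suc u \<le> u + b - 1" by auto
    then show ?thesis using True components_interval by simp
  next
    case False
    then have "{u<..<u + b} = {}" by auto
    then show ?thesis using False components_empty by simp
  qed
  finally show ?thesis .
qed

lemma components_subset: "J \<in> components I \<Longrightarrow> J \<subseteq> I \<and> J \<noteq> {}"
  by (auto simp: components_def)

lemma finite_components_blocks_set: "finite (components (blocks_set u bs))"
  by (induction bs arbitrary: u) (simp_all add: components_blocks_set_Cons components_empty del: blocks_set.simps(2))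

text \<open>The component of a block of size \<open>b\<close> has \<open>b - 1\<close> elements, so
  its \<open>half_size\<close> is half the size of the block.\<close>

lemma components_blocks_set_Cons_even:
  assumes "b > 0" "even b"
  shows "components (blocks_set u (b # bs)) = insert {u<..<u + b} (components (blocks_set (u + b) bs))"
    and "{u<..<u + b} \<notin> components (blocks_set (u + b) bs)"
    and "half_size {u<..<u + b} = b div 2"
proof -
  have b: "b \<ge> 2" using assms by (auto elim!: evenE)
  then show "components (blocks_set u (b # bs)) = insert {u<..<u + b} (components (blocks_set (u + b) bs))"
    by (simp add: components_blocks_set_Cons del: blocks_set.simps)
  show "{u<..<u + b} \<notin> components (blocks_set (u + b) bs)"
  proof
    assume "{u<..<u + b} \<in> components (blocks_set (u + b) bs)"
    then have "{u<..<u + b} \<subseteq> blocks_set (u + b) bs" using components_subset by blast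
    then have "Suc u \<in> blocks_set (u + b) bs" using b by auto
    then show False using blocks_set_bounds[of "Suc u"] b by fastforce
  qed
  show "half_size {u<..<u + b} = b div 2" using b by (simp add: half_size_def)
qed

lemma prod_components_blocks_set:
  assumes "\<forall>b\<in>set bs. b > 0 \<and> even b"
  shows "(\<Prod>J\<in>components (blocks_set u bs). f (half_size J)) =
    (\<Prod>b\<leftarrow>bs. f (b div 2) :: 'a :: comm_monoid_mult)"
  using assms
proof (induction bs arbitrary: u)
  case (Cons b bs)
  then show ?case
    using components_blocks_set_Cons_even(1,2)[of b u bs] components_blocks_set_Cons_even(3)[of b u]
    by (simp add: finite_components_blocks_set del: blocks_set.simps)
qed (simp add: components_empty)

lemma sum_components_blocks_set:
  assumes "\<forall>b\<in>set bs. b > 0 \<and> even b"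
  shows "(\<Sum>J\<in>components (blocks_set u bs). half_size J) = sum_list bs div 2"
  using assms
proof (induction bs arbitrary: u)
  case (Cons b bs)
  then show ?case
    using components_blocks_set_Cons_even(1,2)[of b u bs] components_blocks_set_Cons_even(3)[of b u]
    by (auto simp: finite_components_blocks_set simp del: blocks_set.simps)
qed (simp add: components_empty)

lemma component0_eq:
  assumes "a > 0" "I = {..<a} \<union> blocks_set a bs"
  shows "component0 I = {..<a}" "all_components I = insert {..<a} (components (blocks_set a bs))"
proof -
  have int: "{..<a} = {0..a - 1}" using assms(1) by auto
  have "components I = components {..<a} \<union> components (blocks_set a bs)"
    unfolding assms(2) using blocks_set_bounds by (intro components_Un) fastforce
  then have comps: "components I = insert {..<a} (components (blocks_set a bs))"
    unfolding int using components_interval[of 0 "a - 1"] by simp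
  have no0: "0 \<notin> J" if "J \<in> components (blocks_set a bs)" for J
    using components_subset[OF that] blocks_set_bounds by fastforce
  have "{J \<in> components I. 0 \<in> J} = {{..<a}}" unfolding comps using no0 assms(1) by auto
  then show c0: "component0 I = {..<a}" by (simp add: component0_def)
  have "{J \<in> components I. 0 \<notin> J} = components (blocks_set a bs)"
    unfolding comps using no0 assms(1) by auto
  then show "all_components I = insert {..<a} (components (blocks_set a bs))"
    by (simp add: all_components_def c0)
qed

lemma q_fact_X: "q_fact (X ^ 2) N = qpoch N / (1 - X ^ 2) ^ N"
  by (simp add: q_fact_def qpoch_def prod_dividef power_mult)

text \<open>\<open>m_index I\<close> is the sum of the lower entries of the multinomial coefficient,
  so all powers of \<open>1 - X ^ 2\<close> from \<open>q_fact_X\<close> cancel.\<close>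

lemma C_coeff_even:
  assumes "a > 0" "even a" "\<forall>b\<in>set bs. b > 0 \<and> even b" "I = {..<a} \<union> blocks_set a bs"
  shows "C_coeff I = qpoch ((a + sum_list bs) div 2) /
    (qpoch (a div 2) * (\<Prod>b\<leftarrow>bs. qpoch (b div 2)))"
proof -
  let ?C = "components (blocks_set a bs)"
  have notin: "{..<a} \<notin> ?C"
  proof
    assume "{..<a} \<in> ?C"
    then have "0 \<in> blocks_set a bs" using components_subset assms(1) by fastforce
    then show False using blocks_set_bounds by fastforce
  qed
  note fin = finite_components_blocks_set[of a bs]
  \<comment> \<open>The component of 0 has \<open>a\<close> elements, one more than that of a later
    block of size \<open>a\<close>; rounding down still gives \<open>a div 2\<close> as
    \<open>a\<close> is even.\<close>
  have half: "half_size {..<a} = a div 2" using assms(2) by (simp add: half_size_def)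
  have even: "even (sum_list bs)" using assms(3) by (induction bs) auto
  have m: "m_index I = (a + sum_list bs) div 2" and m': "m_index I = a div 2 + (\<Sum>J\<in>?C. half_size J)"
    unfolding m_index_def component0_eq(2)[OF assms(1,4)] using notin fin half assms(2) even
    by (auto simp: sum_components_blocks_set[OF assms(3)])
  have nz: "(1 - X ^ 2) ^ k \<noteq> 0" for k by simp
  have "(\<Prod>J\<in>all_components I. q_fact (X ^ 2) (half_size J)) =
      (qpoch (a div 2) / (1 - X ^ 2) ^ (a div 2)) *
      ((\<Prod>J\<in>?C. qpoch (half_size J)) / (\<Prod>J\<in>?C. (1 - X ^ 2) ^ half_size J))"
    unfolding component0_eq(2)[OF assms(1,4)] using notin fin half
    by (simp add: q_fact_X prod_dividef)
  also have "\<dots> = qpoch (a div 2) * (\<Prod>b\<leftarrow>bs. qpoch (b div 2)) / (1 - X ^ 2) ^ m_index I"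
    unfolding m' prod_components_blocks_set[OF assms(3)] power_sum[symmetric] power_add by simp
  finally show ?thesis
    unfolding C_coeff_def q_multinomial_def q_fact_X m[symmetric]
    using nz[of "m_index I"] by simp
qed

text \<open>Since \<open>u\<close> is even, the first odd block ends at an odd index, which lies
  outside the set. If the total size is even, that index is not the final one and violates the
  condition.\<close>

lemma even_blocks_iff:
  assumes "\<forall>b\<in>set bs. b > 0" "even u"
  shows "(even (sum_list bs) \<and> (\<forall>i\<in>{u<..<u + sum_list bs}. odd i \<longrightarrow> i \<in> blocks_set u bs)) \<longleftrightarrow>
    (\<forall>b\<in>set bs. even b)"
  using assms
proof (induction bs arbitrary: u)
  case (Cons b bs)
  show ?case
  proof (cases "even b")
    case True
    have "(\<forall>i\<in>{u<..<u + sum_list (b # bs)}. odd i \<longrightarrow> i \<in> blocks_set u (b # bs)) \<longleftrightarrow>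
        (\<forall>i\<in>{u + b<..<u + b + sum_list bs}. odd i \<longrightarrow> i \<in> blocks_set (u + b) bs)"
    proof (intro iffI ballI impI)
      fix i assume *: "\<forall>i\<in>{u<..<u + sum_list (b # bs)}. odd i \<longrightarrow> i \<in> blocks_set u (b # bs)"
        and i: "i \<in> {u + b<..<u + b + sum_list bs}" "odd i"
      then have "i \<in> blocks_set u (b # bs)" by auto
      then show "i \<in> blocks_set (u + b) bs" using i(1) by auto
    next
      fix i assume *: "\<forall>i\<in>{u + b<..<u + b + sum_list bs}. odd i \<longrightarrow> i \<in> blocks_set (u + b) bs"
        and i: "i \<in> {u<..<u + sum_list (b # bs)}" "odd i"
      have "i \<noteq> u + b" using i(2) True Cons.prems(2) by auto
      then show "i \<in> blocks_set u (b # bs)" using * i by (cases "i < u + b") auto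
    qed
    then show ?thesis using Cons.IH[of "u + b"] Cons.prems True by auto
  next
    case False
    have "\<not> (even (sum_list (b # bs)) \<and>
        (\<forall>i\<in>{u<..<u + sum_list (b # bs)}. odd i \<longrightarrow> i \<in> blocks_set u (b # bs)))"
    proof
      assume *: "even (sum_list (b # bs)) \<and>
        (\<forall>i\<in>{u<..<u + sum_list (b # bs)}. odd i \<longrightarrow> i \<in> blocks_set u (b # bs))"
      then have "odd (sum_list bs)" using False by simp
      then have "sum_list bs > 0" by (auto intro: Nat.gr0I)
      moreover have "b > 0" using Cons.prems by simp
      ultimately have "u + b \<in> {u<..<u + sum_list (b # bs)}" "odd (u + b)"
        using False Cons.prems(2) by auto
      with * have "u + b \<in> blocks_set u (b # bs)" by blast
      then have "u + b \<in> blocks_set (u + b) bs" by auto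
      then show False using blocks_set_bounds by blast
    qed
    then show ?thesis using False by auto
  qed
qed simp

theorem theorem6p2:
  fixes n :: nat and I :: "nat set"
  assumes "n \<ge> 2" and "I \<subset> {0..n - 1}"
  shows "(\<not> signed_cyclotomic_product (D_poly n I) \<longleftrightarrow>
            even n \<and> {0} \<union> {i\<in>{1..n - 1}. odd i} \<subseteq> I) \<and>
         (even n \<and> {0} \<union> {i\<in>{1..n - 1}. odd i} \<subseteq> I \<longrightarrow>
            to_fract (D_poly n I) =
              C_coeff I *
              ((1 + X ^ card (component0 I) + 2 * X ^ (n div 2)) / (1 + X ^ (n div 2))) *
              (\<Prod>i = card (component0 I) + 2..n. 1 + (-1) ^ (i - 1) * X ^ (i div 2)))"
proof -
  have I: "I \<subseteq> {0..n - 1}" using assms(2) by blast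
  note D = to_fract_D_poly[OF assms(1) I]
  have lt: "i < n" if "i \<in> I" for i using that I assms(1) by (auto simp: less_eq_Suc_le)
  \<comment> \<open>To be applied with \<open>J = I\<close> if \<open>0 \<notin> I\<close>, and
    after the sign change of the first entry if \<open>0 \<in> I\<close> and
    \<open>1 \<notin> I\<close>.\<close>
  have cyclotomic: "signed_cyclotomic_product (D_poly n I)"
    if J: "0 \<notin> J" "J \<subseteq> {0..<n}" and eq: "word_sum n I = word_sum n J" for J
  proof -
    have "J \<subseteq> {0<..<n}"
    proof
      fix i assume "i \<in> J"
      then show "i \<in> {0<..<n}" using J by (cases "i = 0") auto
    qed
    then obtain bs where bs: "\<forall>b\<in>set bs. b > 0" "sum_list bs = n" "blocks_set 0 bs = J"
      using blocks_set_exists[of J 0 n] by auto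
    then have "bs \<noteq> []" using assms(1) by auto
    then have "cyclotomic_ratio (to_fract (D_poly n I))"
      unfolding D eq using word_sum_without_0[OF bs(2)] bs cyclotomic_ratio_shape_sum by simp
    then show ?thesis by (rule signed_cyclotomic_product_if_ratio)
  qed
  show ?thesis
  proof (cases "0 \<in> I \<and> 1 \<in> I")
    case False
    have "1 \<in> {i\<in>{1..n - 1}. odd i}" using assms(1) by auto
    then have not: "\<not> {0} \<union> {i\<in>{1..n - 1}. odd i} \<subseteq> I" using False by blast
    have "signed_cyclotomic_product (D_poly n I)"
    proof (cases "0 \<in> I")
      case True
      then show ?thesis
        using False assms(1) lt
        by (intro cyclotomic[of "insert 1 (I - {0})"] word_sum_0_not_1) auto
    next
      case False
      then show ?thesis using lt by (intro cyclotomic[of I]) auto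
    qed
    with not show ?thesis by blast
  next
    case True
    \<comment> \<open>The size of the component of 0 and at the same time of the first block. As
      \<open>I\<close> is proper, \<open>a < n\<close>, so at least one more block follows.\<close>
    define a where "a = (LEAST i. i \<notin> I)"
    obtain x where x: "x \<in> {0..n - 1}" "x \<notin> I" using assms(2) by blast
    have a: "a \<notin> I" "a < n" and below: "{..<a} \<subseteq> I"
    proof -
      show "a \<notin> I" unfolding a_def using x(2) by (rule LeastI)
      have "a \<le> x" unfolding a_def using x(2) by (rule Least_le)
      then show "a < n" using x(1) assms(1) by auto
      show "{..<a} \<subseteq> I" unfolding a_def using not_less_Least by blast
    qed
    have a2: "a \<ge> 2"
    proof (rule ccontr)
      assume "\<not> a \<ge> 2"
      then have "a = 0 \<or> a = 1" by auto
      then show False using a(1) True by auto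
    qed
    have "I - {..<a} \<subseteq> {a<..<n}"
    proof
      fix i assume "i \<in> I - {..<a}"
      moreover from this have "i \<noteq> a" using a(1) by auto
      ultimately show "i \<in> {a<..<n}" using lt by auto
    qed
    then obtain bs where bs: "\<forall>b\<in>set bs. b > 0" "a + sum_list bs = n" "blocks_set a bs = I - {..<a}"
      using blocks_set_exists[of "I - {..<a}" a n] a(2) by auto
    have Ieq: "I = {..<a} \<union> blocks_set a bs" using below bs(3) by blast
    have "bs \<noteq> []" using a(2) bs(2) by auto
    \<comment> \<open>The factor 2 from the two signs of the first entry cancels the one from
      summing over all signed permutations.\<close>
    have D': "to_fract (D_poly n I) = positive_sum True a (contiguous (even a) bs)"
      unfolding D using word_sum_0_1[OF a2 bs(2)] Ieq two_neq_zero by simp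
    have card: "card (component0 I) = a"
      using component0_eq(1)[OF _ Ieq] a2 by simp
    have iff: "even n \<and> {0} \<union> {i\<in>{1..n - 1}. odd i} \<subseteq> I \<longleftrightarrow> even a \<and> (\<forall>b\<in>set bs. even b)"
    proof (cases "even a")
      case even: True
      have "({0} \<union> {i\<in>{1..n - 1}. odd i} \<subseteq> I) \<longleftrightarrow>
          (\<forall>i\<in>{a<..<a + sum_list bs}. odd i \<longrightarrow> i \<in> blocks_set a bs)"
      proof
        assume *: "{0} \<union> {i\<in>{1..n - 1}. odd i} \<subseteq> I"
        show "\<forall>i\<in>{a<..<a + sum_list bs}. odd i \<longrightarrow> i \<in> blocks_set a bs"
        proof (intro ballI impI)
          fix i assume i: "i \<in> {a<..<a + sum_list bs}" "odd i"
          then have "i \<in> {1..n - 1}" "i \<notin> {..<a}" using bs(2) by auto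
          with * i(2) show "i \<in> blocks_set a bs" unfolding bs(3) by blast
        qed
      next
        assume *: "\<forall>i\<in>{a<..<a + sum_list bs}. odd i \<longrightarrow> i \<in> blocks_set a bs"
        have "i \<in> I" if "i \<in> {1..n - 1}" "odd i" for i
        proof -
          have "i \<noteq> a" using that(2) even by blast
          then consider "i < a" | "i > a" by linarith
          then show ?thesis
          proof cases
            case 1
            then show ?thesis using below by auto
          next
            case 2
            then have "i \<in> {a<..<a + sum_list bs}" using that(1) bs(2) a(2) by auto
            then show ?thesis using * that(2) Ieq by blast
          qed
        qed
        then show "{0} \<union> {i\<in>{1..n - 1}. odd i} \<subseteq> I" using True by auto
      qed
      moreover have "even n \<longleftrightarrow> even (sum_list bs)" using even bs(2) by auto
      ultimately show ?thesis using even_blocks_iff[OF bs(1) even] even by simp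
    next
      case False
      \<comment> \<open>An odd \<open>a\<close> is itself an odd index missing from
        \<open>I\<close>.\<close>
      moreover have "a \<in> {1..n - 1}" using a(2) a2 by auto
      ultimately show ?thesis using a(1) by blast
    qed
    show ?thesis
    proof (cases "even a \<and> (\<forall>b\<in>set bs. even b)")
      case False
      then have "odd a \<or> (\<exists>b\<in>set bs. odd b)" by blast
      then have "cyclotomic_ratio (to_fract (D_poly n I))"
        unfolding D' using cyclotomic_ratio_positive_sum[OF a2 \<open>bs \<noteq> []\<close> bs(1), of True] by simp
      then have "signed_cyclotomic_product (D_poly n I)" by (rule signed_cyclotomic_product_if_ratio)
      with False iff show ?thesis by blast
    next
      case even: True
      have evens: "\<forall>b\<in>set bs. b > 0 \<and> even b" using even bs(1) by blast
      let ?P = "\<Prod>i = a + 2..n. 1 + (-1) ^ (i - 1) * X ^ (i div 2)"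
      have C: "C_coeff I = qpoch (n div 2) / (qpoch (a div 2) * (\<Prod>b\<leftarrow>bs. qpoch (b div 2)))"
        using C_coeff_even[OF _ _ evens Ieq] a2 even bs(2) by simp
      have formula: "to_fract (D_poly n I) =
          C_coeff I * ((1 + X ^ a + 2 * X ^ (n div 2)) / (1 + X ^ (n div 2))) * ?P"
        unfolding D' C
        using positive_sum_all_even[of a bs n True] even a2 \<open>bs \<noteq> []\<close> evens bs(2) by simp
      have m: "a < 2 * (n div 2)" "n div 2 > 0"
        using a(2) even iff assms(1) by auto
      have "cyclotomic_ratio (\<Prod>b\<leftarrow>bs. qpoch (b div 2))"
        by (induction bs) (auto intro: cyclotomic_ratio_1 cyclotomic_ratio_mult cyclotomic_ratio_qpoch)
      \<comment> \<open>Everything except the trinomial is a cyclotomic ratio, so the trinomial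
        decides.\<close>
      then have ratio: "cyclotomic_ratio (C_coeff I / (1 + X ^ (n div 2)) * ?P)"
        unfolding C using cyclotomic_ratio_sign_factors[of "a + 1" n] m(2)
        by (intro cyclotomic_ratio_mult cyclotomic_ratio_divide cyclotomic_ratio_qpoch
            cyclotomic_ratio_one_plus_power) auto
      have "to_fract (D_poly n I) =
          (C_coeff I / (1 + X ^ (n div 2)) * ?P) * (1 + X ^ a + 2 * X ^ (n div 2))"
        unfolding formula by simp
      then have "\<not> signed_cyclotomic_product (D_poly n I)"
        by (rule not_signed_cyclotomic_product[OF _ ratio _ m(1)]) (use a2 in simp)
      with formula even iff show ?thesis unfolding card by blast
    qed
  qed
qed

end
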